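(* For $j=1$ and $j=\frac32$ (with no further assumption) the generating functions $\mathbf T^{(j)}(u)\in\mathcal A_q((u^{-1}))$ satisfy $$\mathbf T^{(j)}(u)=\mathbf T^{(j-\frac12)}(uq^{-\frac12})\,\mathbf T^{(\frac12)}(uq^{j-\frac12})+\frac{\Gamma(uq^{j-\frac32})\,\Gamma_+(uq^{j-\frac32})}{c(u^2q^{2j})\,c(u^2q^{2j-2})}\,\mathbf T^{(j-1)}(uq^{-1}),\qquad \mathbf T^{(0)}(u)=1.$$
   Context: **Conventions.** $q\in\mathbb C^*$ is not a root of unity, $\mathbb N=\{0,1,\dots\}$, $[n]_q=\frac{q^n-q^{-n}}{q-q^{-1}}$, $[X,Y]_q=qXY-q^{-1}YX$, $c(u)=u-u^{-1}$. $A((u^{-1}))$ denotes formal Laurent series in $u^{-1}$ with coefficients in $A$; rational functions $1/p(u)$ are expanded in $u^{-1}$. $X_1=X\otimes\mathbb I$, $X_2=\mathbb I\otimes X$. **Algebra $\mathcal A_q$.** Fix $k_\pm\in\mathbb C^*$, $\rho=k_+k_-(q+q^{-1})^2$. $\mathcal A_q$ is the unital associative $\mathbb C$-algebra generated by $\mathsf W_{-k},\mathsf W_{k+1},\mathsf G_{k+1},\tilde{\mathsf G}_{k+1}$ ($k\in\mathbb N$) with, for all $k,l\in\mathbb N$: $[\mathsf W_0,\mathsf W_{k+1}]=[\mathsf W_{-k},\mathsf W_1]=\frac{\tilde{\mathsf G}_{k+1}-\mathsf G_{k+1}}{q+q^{-1}}$; $[\mathsf W_0,\mathsf G_{k+1}]_q=[\tilde{\mathsf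 G}_{k+1},\mathsf W_0]_q=\rho(\mathsf W_{-k-1}-\mathsf W_{k+1})$; $[\mathsf G_{k+1},\mathsf W_1]_q=[\mathsf W_1,\tilde{\mathsf G}_{k+1}]_q=\rho(\mathsf W_{k+2}-\mathsf W_{-k})$; $[\mathsf W_{-k},\mathsf W_{-l}]=[\mathsf W_{k+1},\mathsf W_{l+1}]=[\mathsf G_{k+1},\mathsf G_{l+1}]=[\tilde{\mathsf G}_{k+1},\tilde{\mathsf G}_{l+1}]=0$; $[\mathsf W_{-k},\mathsf W_{l+1}]+[\mathsf W_{k+1},\mathsf W_{-l}]=0$; $[\mathsf W_{-k},\mathsf G_{l+1}]+[\mathsf G_{k+1},\mathsf W_{-l}]=0$; $[\mathsf W_{-k},\tilde{\mathsf G}_{l+1}]+[\tilde{\mathsf G}_{k+1},\mathsf W_{-l}]=0$; $[\mathsf W_{k+1},\mathsf G_{l+1}]+[\mathsf G_{k+1},\mathsf W_{l+1}]=0$; $[\mathsf W_{k+1},\tilde{\mathsf G}_{l+1}]+[\tilde{\mathsf G}_{k+1},\mathsf W_{l+1}]=0$; $[\tilde{\mathsf G}_{k+1},\mathsf G_{l+1}]+[\mathsf G_{k+1},\tilde{\mathsf G}_{l+1}]=0$. Put $U=\frac{qu^2+q^{-1}u^{-2}}{q+q^{-1}}$ and $\mathsf W_+(u)=\sum_{k\ge0}\mathsf W_{-k}U^{-k-1}$, $\mathsf W_-(u)=\sum_{k\ge0}\mathsf W_{k+1}U^{-k-1}$, $\mathsf G_+(u)=\sum_{k\ge0}\mathsf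 G_{k+1}U^{-k-1}$, $\mathsf G_-(u)=\sum_{k\ge0}\tilde{\mathsf G}_{k+1}U^{-k-1}$, and $$\mathcal K^{(\frac12)}(u)=\begin{pmatrix}uq\mathsf W_+(u)-u^{-1}q^{-1}\mathsf W_-(u)&\frac{\mathsf G_+(u)}{k_-(q+q^{-1})}+\frac{k_+(q+q^{-1})}{q-q^{-1}}\\ \frac{\mathsf G_-(u)}{k_+(q+q^{-1})}+\frac{k_-(q+q^{-1})}{q-q^{-1}}&uq\mathsf W_-(u)-u^{-1}q^{-1}\mathsf W_+(u)\end{pmatrix}.$$ **Spin matrices, fusion maps, R-matrices.** $B_{j,j'}=\sqrt{[j+j']_q[j-j'+1]_q}$; $(S_+)_{mn}=B_{j,j+1-m}\delta_{m,n-1}$, $(S_-)_{mn}=B_{j,j+1-n}\delta_{m-1,n}$, $(S_3)_{mn}=2(j+1-n)\delta_{m,n}$. $\mathcal E^{(j)}:\mathbb C^{2j+1}\to\mathbb C^2\otimes\mathbb C^{2j}$ has nonzero entries $\mathcal E_{1,1}=1$, $\mathcal E_{1+n,1+n}=\prod_{p=0}^{n-1}\frac{B_{j-1/2,j-p-1/2}}{B_{j,j-p}}$ ($1\le n\le2j-1$), $\mathcal E_{2j+m,1+m}=[m]_q\mathcal E_{m,m}/B_{j,j+1-m}$ ($1\le m\le 2j$). $\mathcal F^{(j)}:\mathbb C^2\otimes\mathbb C^{2j}\to\mathbb C^{2j+1}$ has nonzero entries $\mathcal F_{1,1}=1$, $\mathcal F_{n,n+2j-1}=\frac{\mathcal E_{n+2j-1,n}}{\mathcal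 E_{n,n}^2+\mathcal E_{n+2j-1,n}^2}$, $\mathcal F_{n,n}=\frac{1-\mathcal F_{n,n+2j-1}\mathcal E_{n+2j-1,n}}{\mathcal E_{n,n}}$ ($2\le n\le 2j$), $\mathcal F_{2j+1,4j}=\mathcal E_{4j,2j+1}^{-1}$. $R^{(\frac12,0)}=\mathbb I_2$ and, on $\mathbb C^2\otimes\mathbb C^{2j+1}$, $R^{(\frac12,j)}(u)=\prod_{k=0}^{2j-2}c(uq^{j-\frac12-k})\Big((q-q^{-1})(\sigma_+\otimes S_-+\sigma_-\otimes S_+)+uq^{\frac12(\mathbb I+\sigma_z\otimes S_3)}-u^{-1}q^{-\frac12(\mathbb I+\sigma_z\otimes S_3)}\Big)$. **Fused K-operators.** $\mathcal K^{(0)}=1$, $\mathcal K^{(j)}(u)=\mathcal F^{(j)}\mathcal K_1^{(\frac12)}(uq^{-j+\frac12})R^{(\frac12,j-\frac12)}(u^2q^{-j+1})\mathcal K_2^{(j-\frac12)}(uq^{\frac12})\mathcal E^{(j)}$. **Dual K-matrices.** For $\varepsilon_\pm\in\mathbb C$ put $K^{(\frac12)}(u)=\begin{pmatrix}u\varepsilon_++u^{-1}\varepsilon_-&k_+c(u^2)/(q-q^{-1})\\k_-c(u^2)/(q-q^{-1})&u\varepsilon_-+u^{-1}\varepsilon_+\end{pmatrix}$, $K^{(0)}=1$, and $K^{(j)}$ by the same recursion as $\mathcal K^{(j)}$. For $\bar\varepsilon_\pm,\bar k_\pm\in\mathbb C$, $K^{+(j)}(u)=\frac1{f^{(j)}(u)}\big(K^{(j)}(u^{-1}q^{-1})\big)^t$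 with the substitution $\varepsilon_\pm\to\bar\varepsilon_\mp$, $k_\pm\to-\bar k_\mp$, where $f^{(j)}(u)=\prod_{k=1}^{2j-1}\prod_{\ell=1}^kc(u^2q^{k+\ell+2-2j})c(u^{-2}q^{-k-\ell+2j})$ ($f^{(0)}=f^{(1/2)}=1$). **Generating functions.** $\mathbf T^{(j)}(u)=\mathrm{tr}_{\mathbb C^{2j+1}}\big(K^{+(j)}(u)\mathcal K^{(j)}(u)\big)$. **Quantum determinants.** $\Gamma(u)=\mathrm{tr}_{12}\big(\mathcal P^-_{12}\mathcal K_1^{(\frac12)}(u)R^{(\frac12,\frac12)}(qu^2)\mathcal K_2^{(\frac12)}(uq)\big)$, $\mathcal P^-=(1-\mathcal P)/2$, $\mathcal P$ the flip. $\Gamma_+(u)=c(u^{-2}q^{-4})\Big(\bar\varepsilon_+^2+\bar\varepsilon_-^2+\bar\varepsilon_+\bar\varepsilon_-(u^2q^2+u^{-2}q^{-2})-\bar k_+\bar k_-\frac{c(u^2q^2)^2}{(q-q^{-1})^2}\Big)$. *)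

theory Defs
  imports
    "HOL-Library.Poly_Mapping"
    "HOL-Computational_Algebra.Formal_Laurent_Series"
    "HOL-Algebra.QuotRing"
    "Jordan_Normal_Form.Matrix"
begin

text \<open>Conventions.

  Spins \<open>j = 0, 1/2, 1, 3/2, \<dots>\<close> are encoded by the natural number \<open>n = 2j\<close>. A fixed square root
  \<open>s\<close> of \<open>q\<close> gives meaning to the half-integer powers \<open>q\<^sup>m\<^sup>/\<^sup>2 = s powi m\<close>; definitions
  involving such powers take \<open>s\<close> as a parameter, and \<open>q\<close> is then \<open>s\<^sup>2\<close>.

  \<open>A((u\<^sup>-\<^sup>1))\<close> is the type \<open>'a fls\<close> of Laurent series in the variable \<open>fls_X\<close>, read as
  \<open>u\<^sup>-\<^sup>1\<close>, so that \<open>u\<close> itself is \<open>fls_X_inv\<close>. Scalar rational functions of \<open>u\<close> are elements of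
  the field \<open>complex fls\<close>; in it, division is expansion in \<open>u\<^sup>-\<^sup>1\<close>.\<close>


subsection \<open>Complex algebras\<close>

class complex_alg_1 = ring_1 +
  fixes of_cplx :: "complex \<Rightarrow> 'a"
  assumes of_cplx_0: "of_cplx 0 = 0"
    and of_cplx_1: "of_cplx 1 = 1"
    and of_cplx_add: "of_cplx (a + b) = of_cplx a + of_cplx b"
    and of_cplx_mult: "of_cplx (a * b) = of_cplx a * of_cplx b"
    and of_cplx_central: "of_cplx a * x = x * of_cplx a"

instantiation complex :: complex_alg_1
begin
definition of_cplx_complex :: "complex \<Rightarrow> complex" where
  "of_cplx_complex a = a"
instance
  by standard (simp_all add: of_cplx_complex_def)
end

datatype 'a free_monoid = Free_Monoid (letters: "'a list")

instantiation free_monoid :: (type) monoid_add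
begin
definition zero_free_monoid :: "'a free_monoid" where
  "0 = Free_Monoid []"
definition plus_free_monoid :: "'a free_monoid \<Rightarrow> 'a free_monoid \<Rightarrow> 'a free_monoid" where
  "v + w = Free_Monoid (letters v @ letters w)"
instance
  by standard (simp_all add: zero_free_monoid_def plus_free_monoid_def)
end

lemma single_0_central:
  fixes f :: "'m::monoid_add \<Rightarrow>\<^sub>0 'a::ring_1"
  assumes "\<And>x. a * x = x * a"
  shows "Poly_Mapping.single 0 a * f = f * Poly_Mapping.single 0 a"
proof (induction f rule: update_induct)
  case const
  show ?case by simp
next
  case (update f k v)
  have "Poly_Mapping.update k v f = f + Poly_Mapping.single k v"
    using update(1) by (intro poly_mapping_eqI)
      (auto simp: lookup_update lookup_add lookup_single when_def in_keys_iff)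
  then show ?case
    using update(3) by (simp add: distrib_left distrib_right mult_single assms)
qed

instantiation poly_mapping :: (monoid_add, complex_alg_1) complex_alg_1
begin
definition of_cplx_poly_mapping :: "complex \<Rightarrow> 'a \<Rightarrow>\<^sub>0 'b" where
  "of_cplx_poly_mapping a = Poly_Mapping.single 0 (of_cplx a)"
instance
proof
  fix a :: complex and x :: "'a \<Rightarrow>\<^sub>0 'b"
  show "of_cplx a * x = x * of_cplx a"
    unfolding of_cplx_poly_mapping_def by (rule single_0_central) (rule of_cplx_central)
qed (simp_all add: of_cplx_poly_mapping_def of_cplx_0 of_cplx_1 of_cplx_add of_cplx_mult
      single_add mult_single)
end


subsection \<open>The algebra given by generators and relations\<close>

text \<open>\<open>Wgen i\<close> is the generator \<open>W\<^sub>i\<close>, \<open>i \<in> \<int>\<close> (both families \<open>W\<^sub>-\<^sub>k\<close> and \<open>W\<^sub>k\<^sub>+\<^sub>1\<close>); \<open>Ggen k\<close> and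
  \<open>Gtgen k\<close> are \<open>G\<^sub>k\<^sub>+\<^sub>1\<close> and its tilde counterpart.\<close>

datatype gen = Wgen int | Ggen nat | Gtgen nat

type_synonym free_alg = "gen free_monoid \<Rightarrow>\<^sub>0 complex"

definition free_gen :: "gen \<Rightarrow> free_alg" where
  "free_gen x = Poly_Mapping.single (Free_Monoid [x]) 1"

definition comm :: "'a::ring \<Rightarrow> 'a \<Rightarrow> 'a" where
  "comm x y = x * y - y * x"

definition qcomm :: "complex \<Rightarrow> 'a::complex_alg_1 \<Rightarrow> 'a \<Rightarrow> 'a" where
  "qcomm q x y = of_cplx q * x * y - of_cplx (inverse q) * y * x"

text \<open>The defining relations, each \<open>lhs = rhs\<close> rendered as \<open>lhs - rhs\<close>.\<close>

definition oq_relators :: "complex \<Rightarrow> complex \<Rightarrow> complex \<Rightarrow> (gen \<Rightarrow> 'a::complex_alg_1) \<Rightarrow> 'a set" where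
  "oq_relators q kp km g =
    (let \<rho> = of_cplx (kp * km * (q + inverse q)\<^sup>2);
         Wm = (\<lambda>k::nat. g (Wgen (- int k)));
         Wp = (\<lambda>k::nat. g (Wgen (int k + 1)));
         G = (\<lambda>k::nat. g (Ggen k));
         Gt = (\<lambda>k::nat. g (Gtgen k));
         D = (\<lambda>k. of_cplx (inverse (q + inverse q)) * (Gt k - G k))
     in (\<Union>k.
          {comm (Wm 0) (Wp k) - D k,
           comm (Wm k) (Wp 0) - D k,
           qcomm q (Wm 0) (G k) - \<rho> * (Wm (k + 1) - Wp k),
           qcomm q (Gt k) (Wm 0) - \<rho> * (Wm (k + 1) - Wp k),
           qcomm q (G k) (Wp 0) - \<rho> * (Wp (k + 1) - Wm k),
           qcomm q (Wp 0) (Gt k) - \<rho> * (Wp (k + 1) - Wm k)})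
      \<union> (\<Union>k. \<Union>l.
          {comm (Wm k) (Wm l),
           comm (Wp k) (Wp l),
           comm (G k) (G l),
           comm (Gt k) (Gt l),
           comm (Wm k) (Wp l) + comm (Wp k) (Wm l),
           comm (Wm k) (G l) + comm (G k) (Wm l),
           comm (Wm k) (Gt l) + comm (Gt k) (Wm l),
           comm (Wp k) (G l) + comm (G k) (Wp l),
           comm (Wp k) (Gt l) + comm (Gt k) (Wp l),
           comm (Gt k) (G l) + comm (G k) (Gt l)}))"

definition free_ring :: "free_alg ring" where
  "free_ring = \<lparr>carrier = UNIV, mult = (*), one = 1, zero = 0, add = (+)\<rparr>"

text \<open>\<open>Idl\<close> is the generated two-sided ideal; as \<open>free_ring\<close> contains the scalars, it is an
  ideal of algebras.\<close>

definition oq_ideal :: "complex \<Rightarrow> complex \<Rightarrow> complex \<Rightarrow> free_alg set" where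
  "oq_ideal q kp km = Idl\<^bsub>free_ring\<^esub> (oq_relators q kp km free_gen)"

definition oq_algebra :: "complex \<Rightarrow> complex \<Rightarrow> complex \<Rightarrow> free_alg set ring" where
  "oq_algebra q kp km = free_ring Quot oq_ideal q kp km"

definition oq_class :: "complex \<Rightarrow> complex \<Rightarrow> complex \<Rightarrow> free_alg \<Rightarrow> free_alg set" where
  "oq_class q kp km x = oq_ideal q kp km +>\<^bsub>free_ring\<^esub> x"

lemma ring_free_ring: "ring free_ring"
proof (rule ringI)
  show "abelian_group free_ring"
  proof (rule abelian_groupI)
    fix x assume "x \<in> carrier free_ring"
    show "\<exists>y\<in>carrier free_ring. y \<oplus>\<^bsub>free_ring\<^esub> x = \<zero>\<^bsub>free_ring\<^esub>"
      by (rule bexI[of _ "- x"]) (simp_all add: free_ring_def)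
  qed (simp_all add: free_ring_def algebra_simps)
  show "Group.monoid free_ring"
    by (rule monoidI) (simp_all add: free_ring_def algebra_simps)
qed (simp_all add: free_ring_def algebra_simps)

lemma ideal_oq_ideal: "ideal (oq_ideal q kp km) free_ring"
  unfolding oq_ideal_def
  by (rule ring.genideal_ideal[OF ring_free_ring]) (simp add: free_ring_def)

lemma ring_oq_algebra: "ring (oq_algebra q kp km)"
  unfolding oq_algebra_def by (rule ideal.quotient_is_ring[OF ideal_oq_ideal])

lemma oq_class_ring_hom: "oq_class q kp km \<in> Ring.ring_hom free_ring (oq_algebra q kp km)"
  using ideal.rcos_ring_hom[OF ideal_oq_ideal]
  by (simp add: oq_algebra_def oq_class_def[abs_def])

text \<open>Since \<open>oq_algebra q kp km\<close> depends on the parameters, it is not a type. Series with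
  coefficients in it are therefore built from representatives: a Laurent series \<open>f\<close> over the free
  algebra represents the series whose coefficient at \<open>u\<^sup>-\<^sup>m\<close> is the class of \<open>fls_nth f m\<close>. As
  \<open>oq_class\<close> is a surjective ring homomorphism, this is the canonical surjective ring homomorphism
  onto the Laurent series over \<open>oq_algebra q kp km\<close>, so sums and products may be formed on
  representatives.\<close>

definition oq_laurent :: "complex \<Rightarrow> complex \<Rightarrow> complex \<Rightarrow> free_alg fls \<Rightarrow> int \<Rightarrow> free_alg set" where
  "oq_laurent q kp km f = (\<lambda>m. oq_class q kp km (fls_nth f m))"


subsection \<open>Scalars, matrices\<close>

lift_definition lift_fls :: "complex fls \<Rightarrow> 'a::complex_alg_1 fls"
  is "\<lambda>f m. of_cplx (f m)"
  by (auto simp: of_cplx_0 elim: eventually_mono)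

abbreviation lift_mat :: "complex fls mat \<Rightarrow> 'a::complex_alg_1 fls mat" where
  "lift_mat \<equiv> map_mat lift_fls"

abbreviation const_mat :: "complex mat \<Rightarrow> complex fls mat" where
  "const_mat \<equiv> map_mat fls_const"

text \<open>\<open>q\<^sup>m\<^sup>/\<^sup>2\<close> as a constant series.\<close>

definition qpw :: "complex \<Rightarrow> int \<Rightarrow> complex fls" where
  "qpw s m = fls_const (s powi m)"

definition cc :: "complex fls \<Rightarrow> complex fls" where
  "cc x = x - inverse x"

definition qint :: "complex \<Rightarrow> int \<Rightarrow> complex" where
  "qint q m = (q powi m - q powi (- m)) / (q - inverse q)"

text \<open>Matrices from entry functions with indices starting at 1.\<close>

definition mat1 :: "nat \<Rightarrow> nat \<Rightarrow> (nat \<Rightarrow> nat \<Rightarrow> 'a) \<Rightarrow> 'a mat" where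
  "mat1 r c f = mat r c (\<lambda>(a, b). f (a + 1) (b + 1))"

definition mtrace :: "'a::comm_monoid_add mat \<Rightarrow> 'a" where
  "mtrace A = (\<Sum>i<dim_row A. A $$ (i, i))"

definition kron :: "'a::times mat \<Rightarrow> 'a mat \<Rightarrow> 'a mat" (infixl "\<otimes>\<^sub>K" 70) where
  "A \<otimes>\<^sub>K B = mat (dim_row A * dim_row B) (dim_col A * dim_col B)
     (\<lambda>(a, b). A $$ (a div dim_row B, b div dim_col B) * B $$ (a mod dim_row B, b mod dim_col B))"


subsection \<open>Spin matrices, fusion maps, R-matrices\<close>

text \<open>\<open>Bq q (2j) (2j')\<close> is \<open>B\<^sub>j\<^sub>,\<^sub>j\<^sub>'\<close>: both arguments are doubled spins of equal parity.\<close>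

definition Bq :: "complex \<Rightarrow> int \<Rightarrow> int \<Rightarrow> complex" where
  "Bq q a b = csqrt (qint q ((a + b) div 2) * qint q ((a - b) div 2 + 1))"

definition S_plus :: "complex \<Rightarrow> nat \<Rightarrow> complex mat" where
  "S_plus q n = mat1 (n + 1) (n + 1)
     (\<lambda>a b. if a + 1 = b then Bq q (int n) (int n + 2 - 2 * int a) else 0)"

definition S_minus :: "complex \<Rightarrow> nat \<Rightarrow> complex mat" where
  "S_minus q n = mat1 (n + 1) (n + 1)
     (\<lambda>a b. if a = b + 1 then Bq q (int n) (int n + 2 - 2 * int b) else 0)"

definition S_3 :: "nat \<Rightarrow> int mat" where
  "S_3 n = mat1 (n + 1) (n + 1) (\<lambda>a b. if a = b then int n + 2 - 2 * int b else 0)"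

definition sigma_plus :: "complex mat" where
  "sigma_plus = mat_of_rows_list 2 [[0, 1], [0, 0]]"

definition sigma_minus :: "complex mat" where
  "sigma_minus = mat_of_rows_list 2 [[0, 0], [1, 0]]"

definition sigma_z :: "int mat" where
  "sigma_z = mat_of_rows_list 2 [[1, 0], [0, -1]]"

text \<open>\<open>q\<^sup>A\<^sup>/\<^sup>2\<close> for a diagonal integer matrix \<open>A\<close>.\<close>

definition qpw_diag :: "complex \<Rightarrow> int mat \<Rightarrow> complex fls mat" where
  "qpw_diag s A = mat (dim_row A) (dim_row A) (\<lambda>(a, b). if a = b then qpw s (A $$ (a, a)) else 0)"

text \<open>Entries of the matrix of \<open>\<E>\<^sup>(\<^sup>j\<^sup>)\<close>, for \<open>n = 2j \<ge> 1\<close>.\<close>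

definition E_diag :: "complex \<Rightarrow> nat \<Rightarrow> nat \<Rightarrow> complex" where
  "E_diag q n a = (\<Prod>p<a - 1. Bq q (int n - 1) (int n - 2 * int p - 1) / Bq q (int n) (int n - 2 * int p))"

definition E_entry :: "complex \<Rightarrow> nat \<Rightarrow> nat \<Rightarrow> nat \<Rightarrow> complex" where
  "E_entry q n a b =
    (if a = b \<and> 1 \<le> b \<and> b \<le> n then E_diag q n b
     else if 2 \<le> b \<and> b \<le> n + 1 \<and> a = n + (b - 1)
       then qint q (int b - 1) * E_diag q n (b - 1) / Bq q (int n) (int n + 2 - 2 * (int b - 1))
     else 0)"

definition E_mat :: "complex \<Rightarrow> nat \<Rightarrow> complex mat" where
  "E_mat q n = mat1 (2 * n) (n + 1) (E_entry q n)"

definition F_off :: "complex \<Rightarrow> nat \<Rightarrow> nat \<Rightarrow> complex" where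
  "F_off q n a = E_entry q n (a + n - 1) a / ((E_entry q n a a)\<^sup>2 + (E_entry q n (a + n - 1) a)\<^sup>2)"

definition F_mat :: "complex \<Rightarrow> nat \<Rightarrow> complex mat" where
  "F_mat q n = mat1 (n + 1) (2 * n) (\<lambda>a b.
     if a = 1 \<and> b = 1 then 1
     else if 2 \<le> a \<and> a \<le> n \<and> b = a + n - 1 then F_off q n a
     else if 2 \<le> a \<and> a \<le> n \<and> b = a
       then (1 - F_off q n a * E_entry q n (a + n - 1) a) / E_entry q n a a
     else if a = n + 1 \<and> b = 2 * n then inverse (E_entry q n (2 * n) (n + 1))
     else 0)"

definition R_mat :: "complex \<Rightarrow> nat \<Rightarrow> complex fls \<Rightarrow> complex fls mat" where
  "R_mat s n x =
    (if n = 0 then 1\<^sub>m 2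
     else (let q = s\<^sup>2; A = 1\<^sub>m (2 * (n + 1)) + sigma_z \<otimes>\<^sub>K S_3 n in
       (\<Prod>k<n - 1. cc (x * qpw s (int n - 1 - 2 * int k))) \<cdot>\<^sub>m
       (const_mat ((q - inverse q) \<cdot>\<^sub>m (sigma_plus \<otimes>\<^sub>K S_minus q n + sigma_minus \<otimes>\<^sub>K S_plus q n))
        + x \<cdot>\<^sub>m qpw_diag s A - inverse x \<cdot>\<^sub>m qpw_diag s (- A))))"


subsection \<open>Fused K-operators\<close>

text \<open>The common recursion for the K-operators and the scalar K-matrices; \<open>K\<close> is the spin \<open>1/2\<close>
  matrix as a function of the spectral parameter.\<close>

primrec fused_K ::
  "complex \<Rightarrow> (complex fls \<Rightarrow> 'a::complex_alg_1 fls mat) \<Rightarrow> nat \<Rightarrow> complex fls \<Rightarrow> 'a fls mat" where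
  "fused_K s K 0 x = 1\<^sub>m 1"
| "fused_K s K (Suc n) x =
     lift_mat (const_mat (F_mat (s\<^sup>2) (Suc n)))
     * (K (x * qpw s (- int n)) \<otimes>\<^sub>K 1\<^sub>m (Suc n))
     * lift_mat (R_mat s n (x\<^sup>2 * qpw s (1 - int n)))
     * (1\<^sub>m 2 \<otimes>\<^sub>K fused_K s K n (x * qpw s 1))
     * lift_mat (const_mat (E_mat (s\<^sup>2) (Suc n)))"

definition U_ser :: "complex \<Rightarrow> complex fls \<Rightarrow> complex fls" where
  "U_ser s x = (qpw s 2 * x\<^sup>2 + qpw s (-2) * inverse (x\<^sup>2)) / (qpw s 2 + qpw s (-2))"

text \<open>\<open>\<Sum>k\<ge>0. a k U(x)\<^sup>-\<^sup>k\<^sup>-\<^sup>1\<close> for \<open>x\<close> a nonzero scalar multiple of \<open>u\<close>. Then \<open>U(x)\<^sup>-\<^sup>k\<^sup>-\<^sup>1\<close> has order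
  \<open>2k + 2\<close> in \<open>u\<^sup>-\<^sup>1\<close>, so only the terms \<open>k \<le> m\<close> contribute to the coefficient at \<open>u\<^sup>-\<^sup>m\<close>.\<close>

definition gen_ser :: "complex \<Rightarrow> (nat \<Rightarrow> 'a::complex_alg_1) \<Rightarrow> complex fls \<Rightarrow> 'a fls" where
  "gen_ser s a x = fps_to_fls (Abs_fps (\<lambda>m.
     \<Sum>k\<le>m. of_cplx (fls_nth (inverse (U_ser s x) ^ (k + 1)) (int m)) * a k))"

definition K_op ::
  "complex \<Rightarrow> complex \<Rightarrow> complex \<Rightarrow> (gen \<Rightarrow> 'a::complex_alg_1) \<Rightarrow> complex fls \<Rightarrow> 'a fls mat" where
  "K_op s kp km g x =
    (let q = s\<^sup>2;
         Wp = gen_ser s (\<lambda>k. g (Wgen (- int k))) x;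
         Wm = gen_ser s (\<lambda>k. g (Wgen (int k + 1))) x;
         Gp = gen_ser s (\<lambda>k. g (Ggen k)) x;
         Gm = gen_ser s (\<lambda>k. g (Gtgen k)) x;
         v = lift_fls (x * qpw s 2);
         v' = lift_fls (inverse x * qpw s (-2));
         const = (\<lambda>a. lift_fls (fls_const a))
     in mat_of_rows_list 2
       [[v * Wp - v' * Wm,
         const (inverse (km * (q + inverse q))) * Gp + const (kp * (q + inverse q) / (q - inverse q))],
        [const (inverse (kp * (q + inverse q))) * Gm + const (km * (q + inverse q) / (q - inverse q)),
         v * Wm - v' * Wp]])"


subsection \<open>Dual K-matrices, generating functions, quantum determinants\<close>

definition K_scal ::
  "complex \<Rightarrow> complex \<Rightarrow> complex \<Rightarrow> complex \<Rightarrow> complex \<Rightarrow> complex fls \<Rightarrow> complex fls mat" where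
  "K_scal s ep em kp km x =
    (let d = cc (x\<^sup>2) / (qpw s 2 - qpw s (-2)) in
     mat_of_rows_list 2
       [[x * fls_const ep + inverse x * fls_const em, fls_const kp * d],
        [fls_const km * d, x * fls_const em + inverse x * fls_const ep]])"

definition f_norm :: "complex \<Rightarrow> nat \<Rightarrow> complex fls \<Rightarrow> complex fls" where
  "f_norm s n x = (\<Prod>k = 1..n - 1. \<Prod>l = 1..k.
     cc (x\<^sup>2 * qpw s (2 * (int k + int l + 2 - int n)))
     * cc (inverse (x\<^sup>2) * qpw s (2 * (- int k - int l + int n))))"

text \<open>In \<open>K_dual\<close>, \<open>T_op\<close>, \<open>Gamma_plus\<close> the parameters \<open>ep em hp hm\<close> are
  \<open>\<epsilon>\<^sub>+, \<epsilon>\<^sub>-, k\<^sub>+, k\<^sub>-\<close> with bars.\<close>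

definition K_dual ::
  "complex \<Rightarrow> complex \<Rightarrow> complex \<Rightarrow> complex \<Rightarrow> complex \<Rightarrow> nat \<Rightarrow> complex fls \<Rightarrow> complex fls mat" where
  "K_dual s ep em hp hm n x =
     (1 / f_norm s n x) \<cdot>\<^sub>m
     transpose_mat (fused_K s (K_scal s em ep (- hm) (- hp)) n (inverse x * qpw s (-2)))"

definition T_op ::
  "complex \<Rightarrow> complex \<Rightarrow> complex \<Rightarrow> complex \<Rightarrow> complex \<Rightarrow> complex \<Rightarrow> complex
    \<Rightarrow> (gen \<Rightarrow> 'a::complex_alg_1) \<Rightarrow> nat \<Rightarrow> complex fls \<Rightarrow> 'a fls" where
  "T_op s kp km ep em hp hm g n x =
     mtrace (lift_mat (K_dual s ep em hp hm n x) * fused_K s (K_op s kp km g) n x)"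

definition P_flip :: "complex mat" where
  "P_flip = mat 4 4 (\<lambda>(a, b). if a div 2 = b mod 2 \<and> a mod 2 = b div 2 then 1 else 0)"

definition P_minus :: "complex mat" where
  "P_minus = (1 / 2) \<cdot>\<^sub>m (1\<^sub>m 4 - P_flip)"

definition Gamma_op ::
  "complex \<Rightarrow> complex \<Rightarrow> complex \<Rightarrow> (gen \<Rightarrow> 'a::complex_alg_1) \<Rightarrow> complex fls \<Rightarrow> 'a fls" where
  "Gamma_op s kp km g x =
     mtrace (lift_mat (const_mat P_minus)
       * (K_op s kp km g x \<otimes>\<^sub>K 1\<^sub>m 2)
       * lift_mat (R_mat s 1 (qpw s 2 * x\<^sup>2))
       * (1\<^sub>m 2 \<otimes>\<^sub>K K_op s kp km g (x * qpw s 2)))"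

definition Gamma_plus ::
  "complex \<Rightarrow> complex \<Rightarrow> complex \<Rightarrow> complex \<Rightarrow> complex \<Rightarrow> complex fls \<Rightarrow> complex fls" where
  "Gamma_plus s ep em hp hm x =
     cc (inverse (x\<^sup>2) * qpw s (-8)) *
     (fls_const (ep\<^sup>2 + em\<^sup>2)
      + fls_const (ep * em) * (x\<^sup>2 * qpw s 4 + inverse (x\<^sup>2) * qpw s (-4))
      - fls_const (hp * hm) * (cc (x\<^sup>2 * qpw s 4))\<^sup>2 / (qpw s 2 - qpw s (-2))\<^sup>2)"

end

theory Submission
  imports Defs
begin

text \<open>The defining relations amount to the reflection equation for \<open>\<K>\<^sup>(\<^sup>1\<^sup>/\<^sup>2\<^sup>)\<close>. The fused operators of spin \<open>1\<close> and
  \<open>3/2\<close> are then compressions of products of spin \<open>1/2\<close> operators, and the traces can be evaluated with the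
  resolution of the identity on \<open>\<complex>\<^sup>2 \<otimes> \<complex>\<^sup>2\<close> into the image of the fusion map and the antisymmetric line: crossing
  turns the full trace into a product of spin \<open>1/2\<close> traces, and the antisymmetric part is a product of
  quantum determinants. For spin \<open>3/2\<close> the operator quantum determinant has to be moved past a spin \<open>1/2\<close>
  trace, which is possible because it is central, again by the reflection and Yang-Baxter equations.\<close>

subsection \<open>Laurent series over an algebra\<close>

text \<open>The dual matrix enters transposed, so the traces contain E E^t and F^t F for the fusion
  maps E and F, and these are not projections. The calculation works because E E^t is proportional
  to R(q), and for three legs to R12(q) R13(q^2) R23(q). Reflection equations therefore carry the
  transposed scalar K-matrices through this weight, after which the two weights multiply to the
  symmetrizer, that is, to the identity minus antisymmetric terms. The entries of K do not commute,
  so a trace is cyclic only in scalar factors. Every rearrangement is chosen such that only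
  R-matrices, dual K-matrices and projections go round the trace. For spin 3/2 this leaves one
  product in the wrong order, the trace at u/q to the left of a quantum determinant. A last obstacle
  is formal: the argument needs an algebra that is a type, while the algebra of the theorem depends
  on parameters. All these algebras are therefore reduced to a single quotient type.\<close>

lemma fls_times_nth_bounds:
  fixes f g :: "'a::ring_1 fls"
  assumes "\<And>i. i < a \<Longrightarrow> fls_nth f i = 0" "\<And>i. i < b \<Longrightarrow> fls_nth g i = 0"
  shows "fls_nth (f * g) n = (\<Sum>i=a..n-b. fls_nth f i * fls_nth g (n - i))"
proof (cases "f = 0 \<or> g = 0")
  case True
  then show ?thesis by auto
next
  case False
  then have ab: "a \<le> fls_subdegree f" "b \<le> fls_subdegree g"
    using assms nth_fls_subdegree_nonzero[of f] nth_fls_subdegree_nonzero[of g]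
    by (metis not_le)+
  have "fls_nth (f * g) n = (\<Sum>i=fls_subdegree f..n - fls_subdegree g. fls_nth f i * fls_nth g (n - i))"
    by (rule fls_times_nth(2))
  also have "\<dots> = (\<Sum>i=a..n-b. fls_nth f i * fls_nth g (n - i))"
    using ab by (intro sum.mono_neutral_left) auto
  finally show ?thesis .
qed

lemma fls_nth_lift [simp]: "fls_nth (lift_fls f) m = of_cplx (fls_nth f m)"
  by transfer simp

lemma of_cplx_sum: "of_cplx (sum f A) = (\<Sum>i\<in>A. of_cplx (f i))"
  by (induction A rule: infinite_finite_induct) (simp_all add: of_cplx_0 of_cplx_add)

lemma of_cplx_minus: "of_cplx (- a) = - of_cplx a"
  using of_cplx_add[of a "- a"] by (simp add: of_cplx_0 eq_neg_iff_add_eq_0 add.commute)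

lemma lift_0 [simp]: "lift_fls 0 = 0"
  by (rule fls_eqI) (simp add: of_cplx_0)
lemma lift_1 [simp]: "lift_fls 1 = 1"
  by (rule fls_eqI) (simp add: of_cplx_0 of_cplx_1)
lemma lift_add: "lift_fls (a + b) = lift_fls a + lift_fls b"
  by (rule fls_eqI) (simp add: of_cplx_add)
lemma lift_minus: "lift_fls (- a) = - lift_fls a"
  by (rule fls_eqI) (simp add: of_cplx_minus)
lemma lift_diff: "lift_fls (a - b) = lift_fls a - lift_fls b"
  using lift_add[of a "- b"] by (simp add: lift_minus)

lemma lift_mult: "lift_fls (a * b) = lift_fls a * lift_fls b"
proof (rule fls_eqI)
  fix n
  show "fls_nth (lift_fls (a * b) :: 'a fls) n = fls_nth (lift_fls a * lift_fls b) n"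
    by (simp add: fls_times_nth_bounds[of "fls_subdegree a" _ "fls_subdegree b"] of_cplx_0
        of_cplx_sum of_cplx_mult)
qed

lemma lift_commute: "lift_fls a * x = x * lift_fls a"
proof (rule fls_eqI)
  fix n
  let ?a = "fls_subdegree a" and ?b = "fls_subdegree x"
  have "fls_nth (lift_fls a * x) n = (\<Sum>i=?a..n-?b. fls_nth x (n - i) * of_cplx (fls_nth a i))"
    by (simp add: fls_times_nth_bounds[of ?a _ ?b] of_cplx_0 of_cplx_central)
  also have "\<dots> = (\<Sum>i=?b..n-?a. fls_nth x i * of_cplx (fls_nth a (n - i)))"
    by (rule sum.reindex_bij_witness[of _ "\<lambda>i. n - i" "\<lambda>i. n - i"]) auto
  also have "\<dots> = fls_nth (x * lift_fls a) n"
    by (simp add: fls_times_nth_bounds[of ?b _ ?a] of_cplx_0)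
  finally show "fls_nth (lift_fls a * x) n = fls_nth (x * lift_fls a) n" .
qed

lemma lift_complex [simp]: "(lift_fls :: complex fls \<Rightarrow> complex fls) = (\<lambda>a. a)"
  by (intro ext fls_eqI) (simp add: of_cplx_complex_def)

subsection \<open>Exchange relations of the currents\<close>

text \<open>A noncommutative monomial \<open>w\<close> with its scalar coefficient kept apart: the
  coefficients lie in the field \<open>complex fls\<close>, where \<open>field_simps\<close>
  applies, while monomials change only by exchange relations.\<close>

definition scal :: "'a::complex_alg_1 fls \<Rightarrow> complex fls \<Rightarrow> 'a fls" where
  "scal w c = w * lift_fls c"

lemma scal_add_left: "scal (v + w) c = scal v c + scal w c"
  and scal_diff_left: "scal (v - w) c = scal v c - scal w c"
  and scal_minus_left: "scal (- w) c = - scal w c"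
  and scal_scal: "scal (scal w c) d = scal w (c * d)"
  and times_scal: "v * scal w c = scal (v * w) c"
  and scal_minus: "- scal w c = scal w (- c)"
  and scal_diff: "v - scal w c = v + scal w (- c)"
  and scal_merge: "scal w c + scal w d = scal w (c + d)"
  and scal_merge2: "scal w c + (scal w d + z) = scal w (c + d) + z"
  by (simp_all add: scal_def algebra_simps lift_add lift_mult lift_minus)

lemma scal_times: "scal v c * w = scal (v * w) c"
  by (simp add: scal_def mult.assoc lift_commute)

lemma lift_scal: "lift_fls c * w = scal w c" "w * lift_fls c = scal w c"
  by (simp_all add: scal_def lift_commute[of c w])

lemma scal_0 [simp]: "scal w 0 = 0" "scal 0 c = 0"
  and scal_1: "scal w 1 = w"
  by (simp_all add: scal_def)

lemmas scal_nf = lift_scal scal_add_left scal_diff_left scal_minus_left scal_scal scal_times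
  times_scal scal_minus scal_diff distrib_left distrib_right left_diff_distrib right_diff_distrib
  mult.assoc diff_diff_eq2 minus_diff_eq minus_add_distrib diff_add_eq_diff_diff_swap

text \<open>\<open>collects w c z r\<close> splits off from the sum \<open>z\<close> all occurrences of the noncommutative monomial \<open>w\<close>. Resolution with
  \<open>collect\<close> below reduces the vanishing of a sum of monomials to the vanishing of its coefficients.\<close>

definition collects :: "'a::complex_alg_1 fls \<Rightarrow> complex fls \<Rightarrow> 'a fls \<Rightarrow> 'a fls \<Rightarrow> bool" where
  "collects w c z r \<longleftrightarrow> z = scal w c + r"

lemma collects_intros:
  "collects w c z r \<Longrightarrow> collects w (d + c) (scal w d + z) r"
  "collects w d (scal w d) 0"
  "collects w c z r \<Longrightarrow> collects w c (scal v d + z) (scal v d + r)"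
  "collects w 0 (scal v d) (scal v d)"
  "collects w 0 0 0"
  by (simp_all add: collects_def scal_merge scal_merge2 add_ac)

lemma zero_collect:
  "collects w c z r \<Longrightarrow> r = 0 \<Longrightarrow> d + c = 0 \<Longrightarrow> scal w d + z = 0"
  "c = 0 \<Longrightarrow> scal w c = 0"
  by (simp_all add: collects_def scal_merge scal_merge2)

lemmas collect = zero_collect collects_intros refl

lemma scal_cancel: "c \<noteq> 0 \<Longrightarrow> scal w c = 0 \<Longrightarrow> w = 0"
  using scal_scal[of w c "inverse c"] by (simp add: scal_1)

text \<open>One pair of spectral parameters; \<open>p, m, b, c\<close> at the first, primed at the second.\<close>
locale currents =
  fixes p m b c p' m' b' c' w0 w1 :: "'a::complex_alg_1 fls"
    and q t U V kp km :: "complex fls"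
  assumes q: "q \<noteq> 0" and k: "kp \<noteq> 0" "km \<noteq> 0" and t: "t \<noteq> 0" "t = q + inverse q"
   and pp: "p' * p = p * p'" and mm: "m' * m = m * m'" and bb: "b' * b = b * b'" and cc: "c' * c = c * c'"
   and pm: "p' * m = p * m' - m' * p + m * p'"
   and pb: "b' * p = p * b' + b * p' - p' * b"
   and pc: "c' * p = p * c' + c * p' - p' * c"
   and mb: "b' * m = m * b' + b * m' - m' * b"
   and mc: "c' * m = m * c' + c * m' - m' * c"
   and bc: "c' * b = c * b' + b * c' - b' * c"
   and w0p: "w0 * p = p * w0" "w0 * p' = p' * w0"
   and w1m: "w1 * m = m * w1" "w1 * m' = m' * w1"
   and w0m: "scal (w0 * m) 1 + scal (m * w0) (-1) + scal c (- kp) + scal b km = 0"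
     "scal (w0 * m') 1 + scal (m' * w0) (-1) + scal c' (- kp) + scal b' km = 0"
   and w0b: "scal (w0 * b) q + scal (b * w0) (- inverse q) + scal p (- kp * t * U) + scal m (kp * t) = 0"
     "scal (w0 * b') q + scal (b' * w0) (- inverse q) + scal p' (- kp * t * V) + scal m' (kp * t) = 0"
   and bw1: "scal (b * w1) q + scal (w1 * b) (- inverse q) + scal m (- kp * t * U) + scal p (kp * t) = 0"
     "scal (b' * w1) q + scal (w1 * b') (- inverse q) + scal m' (- kp * t * V) + scal p' (kp * t) = 0"
   and cw0: "scal (c * w0) q + scal (w0 * c) (- inverse q) + scal p (- km * t * U) + scal m (km * t) = 0"
     "scal (c' * w0) q + scal (w0 * c') (- inverse q) + scal p' (- km * t * V) + scal m' (km * t) = 0"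
   and w1c: "scal (w1 * c) q + scal (c * w1) (- inverse q) + scal m (- km * t * U) + scal p (km * t) = 0"
     "scal (w1 * c') q + scal (c' * w1) (- inverse q) + scal m' (- km * t * V) + scal p' (km * t) = 0"
begin

text \<open>With products associated to the right, a rule for two factors matches inside a longer
  word only in this form with a tail \<open>z\<close>.\<close>

lemma exch:
  "p' * (p * z) = p * (p' * z)" "m' * (m * z) = m * (m' * z)" "b' * (b * z) = b * (b' * z)" "c' * (c * z) = c * (c' * z)"
  "p' * (m * z) = p * (m' * z) - m' * (p * z) + m * (p' * z)"
  "b' * (p * z) = p * (b' * z) + b * (p' * z) - p' * (b * z)"
  "c' * (p * z) = p * (c' * z) + c * (p' * z) - p' * (c * z)"
  "b' * (m * z) = m * (b' * z) + b * (m' * z) - m' * (b * z)"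
  "c' * (m * z) = m * (c' * z) + c * (m' * z) - m' * (c * z)"
  "c' * (b * z) = c * (b' * z) + b * (c' * z) - b' * (c * z)"
  "w0 * (p * z) = p * (w0 * z)" "w0 * (p' * z) = p' * (w0 * z)"
  "w1 * (m * z) = m * (w1 * z)" "w1 * (m' * z) = m' * (w1 * z)"
  by (simp_all only: mult.assoc[symmetric] pp mm bb cc pm pb pc mb mc bc w0p w1m distrib_right left_diff_distrib)

lemmas exchange = pp mm bb cc pm pb pc mb mc bc w0p w1m exch

abbreviation (input) "Lw0m \<equiv> scal (w0 * m) 1 + scal (m * w0) (-1) + scal c (- kp) + scal b km"
abbreviation (input) "Lw0m' \<equiv> scal (w0 * m') 1 + scal (m' * w0) (-1) + scal c' (- kp) + scal b' km"
abbreviation (input) "Lw0b \<equiv> scal (w0 * b) q + scal (b * w0) (- inverse q) + scal p (- kp * t * U) + scal m (kp * t)"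
abbreviation (input) "Lw0b' \<equiv> scal (w0 * b') q + scal (b' * w0) (- inverse q) + scal p' (- kp * t * V) + scal m' (kp * t)"
abbreviation (input) "Lbw1 \<equiv> scal (b * w1) q + scal (w1 * b) (- inverse q) + scal m (- kp * t * U) + scal p (kp * t)"
abbreviation (input) "Lbw1' \<equiv> scal (b' * w1) q + scal (w1 * b') (- inverse q) + scal m' (- kp * t * V) + scal p' (kp * t)"
abbreviation (input) "Lcw0 \<equiv> scal (c * w0) q + scal (w0 * c) (- inverse q) + scal p (- km * t * U) + scal m (km * t)"
abbreviation (input) "Lcw0' \<equiv> scal (c' * w0) q + scal (w0 * c') (- inverse q) + scal p' (- km * t * V) + scal m' (km * t)"
abbreviation (input) "Lw1c \<equiv> scal (w1 * c) q + scal (c * w1) (- inverse q) + scal m (- km * t * U) + scal p (km * t)"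
abbreviation (input) "Lw1c' \<equiv> scal (w1 * c') q + scal (c' * w1) (- inverse q) + scal m' (- km * t * V) + scal p' (km * t)"

text \<open>The vanishing of each of the following elements is certified by an explicit combination of the relations with
  \<open>w0\<close> and \<open>w1\<close>.\<close>

definition "R1 = scal (p * m' - m' * p) (U - V) - scal (b * c' - b' * c) ((q - inverse q) / t)"
definition "Bp = scal (p * b') (U * q) - scal (b' * p) (U * inverse q) - scal (p' * b) (V * q)
  + scal (b * p') (V * inverse q) - scal (m * b' - m' * b) (q - inverse q)"
definition "Bm = scal (b' * m) (U * q) - scal (m * b') (U * inverse q) - scal (b * m') (V * q)
  + scal (m' * b) (V * inverse q) - scal (p * b' - p' * b) (q - inverse q)"
definition "Cp = scal (c' * p) (U * q) - scal (p * c') (U * inverse q) - scal (c * p') (V * q)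
  + scal (p' * c) (V * inverse q) - scal (m * c' - m' * c) (q - inverse q)"
definition "Cm = scal (m * c') (U * q) - scal (c' * m) (U * inverse q) - scal (m' * c) (V * q)
  + scal (c * m') (V * inverse q) - scal (p * c' - p' * c) (q - inverse q)"

text \<open>All words containing \<open>w0\<close> cancel in the combination: those with
  \<open>w0\<close> at an end because \<open>b\<close> and \<open>b'\<close> commute, those with
  \<open>w0\<close> in the middle because the weights q and 1/q match. What remains is quadratic in
  the currents and equals \<open>Bp\<close> up to a factor. The next three lemmas follow the same
  pattern.\<close>

lemma Bp: "Bp = 0"
proof -
  have "scal Bp (kp * t) - scal (b' * Lw0b - b * Lw0b') (inverse q) + scal (Lw0b * b' - Lw0b' * b) q = 0"
    by (simp only: Bp_def scal_nf, simp only: scal_nf exchange, simp only: add.assoc, (rule collect)+,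
      simp_all add: field_simps q t(1) power2_eq_square)
  then show ?thesis
    using w0b k t scal_cancel[of "kp * t" Bp] by (simp only:) simp
qed

lemma Bm: "Bm = 0"
proof -
  have "scal Bm (kp * t) - scal (Lbw1 * b' - Lbw1' * b) (inverse q) + scal (b' * Lbw1 - b * Lbw1') q = 0"
    by (simp only: Bm_def scal_nf, simp only: scal_nf exchange, simp only: add.assoc, (rule collect)+,
      simp_all add: field_simps q t(1) power2_eq_square)
  then show ?thesis
    using bw1 k t scal_cancel[of "kp * t" Bm] by (simp only:) simp
qed

lemma Cp: "Cp = 0"
proof -
  have "scal Cp (km * t) - scal (Lcw0 * c' - Lcw0' * c) (inverse q) + scal (c' * Lcw0 - c * Lcw0') q = 0"
    by (simp only: Cp_def scal_nf, simp only: scal_nf exchange, simp only: add.assoc, (rule collect)+,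
      simp_all add: field_simps q t(1) power2_eq_square)
  then show ?thesis
    using cw0 k t scal_cancel[of "km * t" Cp] by (simp only:) simp
qed

lemma Cm: "Cm = 0"
proof -
  have "scal Cm (km * t) - scal (c' * Lw1c - c * Lw1c') (inverse q) + scal (Lw1c * c' - Lw1c' * c) q = 0"
    by (simp only: Cm_def scal_nf, simp only: scal_nf exchange, simp only: add.assoc, (rule collect)+,
      simp_all add: field_simps q t(1) power2_eq_square)
  then show ?thesis
    using w1c k t scal_cancel[of "km * t" Cm] by (simp only:) simp
qed

text \<open>Here the words with \<open>w0\<close> cancel between its relations with
  \<open>m\<close>, multiplied by \<open>b\<close>, and its relations with \<open>b\<close>,
  multiplied by \<open>m\<close>.\<close>

lemma R1: "R1 = 0"
proof -
  have "scal R1 (kp * t) - (b' * scal Lw0m (inverse q) - b * scal Lw0m' (inverse q) + Lw0b' * m - Lw0b * m' - m * Lw0b' + m' * Lw0b - scal Lw0m q * b' + scal Lw0m' q * b) = 0"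
    by (simp only: R1_def scal_nf, simp only: scal_nf exchange, simp only: add.assoc, (rule collect)+,
      simp_all add: field_simps q t(1) power2_eq_square)
  then show ?thesis
    using w0b w0m k t scal_cancel[of "kp * t" R1] by (simp only:) simp
qed

definition "R0 = scal (b' * c - c * b') (U * inverse q) + scal ((scal p' V - m') * m) (U * t)
   - scal (m * (scal p' V - m')) (U * t * inverse (q^2))
   - (scal (b * c' - c' * b) (V * inverse q) + scal ((scal p U - m) * m') (V * t)
   - scal (m' * (scal p U - m)) (V * t * inverse (q^2)))
   - scal (scal (p * p') (V - U) - p * m' + p' * m) ((1 - inverse (q^2)) * t)"

text \<open>Quadratic combinations do not suffice here; the certificate starts from a q-commutator
  of \<open>w0\<close> with the vanishing element \<open>Bm\<close> and then removes
  \<open>w0\<close> with the linear relations.\<close>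

lemma R0: "R0 = 0"
proof -
  have "scal R0 kp - (w0 * Bm - scal (Bm * w0) (inverse (q^2)) - scal (b' * Lw0m) (U * inverse q) - scal (Lw0b' * m) U - scal (Lw0m' * b) (V * inverse q) + scal (b * Lw0m') (V * inverse q) - scal (m' * Lw0b) (V * inverse (q^2)) + scal (Lw0b * m') V + scal (m * Lw0b') (U * inverse (q^2)) + scal (Lw0m * b') (U * inverse q) + scal (p * Lw0b') ((q - inverse q) * inverse q) - scal (p' * Lw0b) ((q - inverse q) * inverse q)) = 0"
    by (simp only: R0_def Bm_def scal_nf, simp only: scal_nf exchange, simp only: add.assoc, (rule collect)+,
      simp_all add: field_simps q t(1) power2_eq_square)
  then show ?thesis
    using w0b w0m Bm k scal_cancel[of kp R0] by (simp only:) simp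
qed

end

subsection \<open>Operators on tensor powers of the plane\<close>

text \<open>Square matrices over a fixed finite index type form a type of class
  \<open>ring_1\<close>, so long products of noncommuting factors can be rewritten as ring elements.
  For the plane, \<open>False\<close> is the first basis vector.\<close>

typedef ('n, 'a) op = "UNIV :: ('n \<Rightarrow> 'n \<Rightarrow> 'a) set"
  morphisms ent Op ..

setup_lifting type_definition_op

lemma ent_Op [simp]: "ent (Op f) = f"
  by (simp add: Op_inverse)

lemma op_eqI: "(\<And>i j. ent A i j = ent B i j) \<Longrightarrow> A = B"
  by (metis ent_inject ext)

instantiation op :: (finite, ring_1) ring_1
begin
definition "0 = Op (\<lambda>i j. 0)"
definition "1 = Op (\<lambda>i j. if i = j then 1 else 0)"
definition "A + B = Op (\<lambda>i j. ent A i j + ent B i j)"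
definition "A - B = Op (\<lambda>i j. ent A i j - ent B i j)"
definition "- A = Op (\<lambda>i j. - ent A i j)"
definition "A * B = Op (\<lambda>i k. \<Sum>j\<in>UNIV. ent A i j * ent B j k)"
instance
proof
  fix A B C :: "('a, 'b) op"
  show "A * B * C = A * (B * C)"
    by (rule op_eqI) (simp add: times_op_def sum_distrib_left sum_distrib_right mult.assoc, rule sum.swap)
  show "(0 :: ('a, 'b) op) \<noteq> 1"
  proof
    assume "(0 :: ('a, 'b) op) = 1"
    then have "ent (0 :: ('a, 'b) op) undefined undefined = ent 1 undefined undefined"
      by simp
    then show False
      by (simp add: zero_op_def one_op_def)
  qed
qed (rule op_eqI; simp add: zero_op_def one_op_def plus_op_def minus_op_def uminus_op_def times_op_def
      algebra_simps sum.distrib if_distrib[of "\<lambda>x. x * _"] if_distrib[of "\<lambda>x. _ * x"] cong: if_cong)+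
end

lemma ent_0 [simp]: "ent 0 i j = 0"
  and ent_1: "ent 1 i j = (if i = j then 1 else 0)"
  and ent_add [simp]: "ent (A + B) i j = ent A i j + ent B i j"
  and ent_diff [simp]: "ent (A - B) i j = ent A i j - ent B i j"
  and ent_minus [simp]: "ent (- A) i j = - ent A i j"
  and ent_mult: "ent (A * B) i k = (\<Sum>j\<in>UNIV. ent A i j * ent B j k)"
  by (simp_all add: zero_op_def one_op_def plus_op_def minus_op_def uminus_op_def times_op_def)

lemma sum_bool: "(\<Sum>i\<in>UNIV. f i) = f False + f True"
  by (simp add: UNIV_bool)
lemma sum_bool2: "(\<Sum>i\<in>UNIV. f i) = f (False, False) + f (False, True) + f (True, False) + f (True, True)"
  unfolding UNIV_Times_UNIV[symmetric] sum.cartesian_product'[symmetric]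
  by (simp add: UNIV_bool add.assoc)
lemma sum_bool3: "(\<Sum>i\<in>UNIV. f i) =
    f (False, False, False) + f (False, False, True) + f (False, True, False) + f (False, True, True)
  + f (True, False, False) + f (True, False, True) + f (True, True, False) + f (True, True, True)"
  unfolding UNIV_Times_UNIV[symmetric] sum.cartesian_product'[symmetric]
  by (simp add: UNIV_bool add.assoc)

definition lop :: "('n, complex fls) op \<Rightarrow> ('n, 'a::complex_alg_1 fls) op" where
  "lop A = Op (\<lambda>i j. lift_fls (ent A i j))"

lemma ent_lop [simp]: "ent (lop A) i j = lift_fls (ent A i j)"
  by (simp add: lop_def)

lemma lift_sum: "lift_fls (sum f A) = (\<Sum>i\<in>A. lift_fls (f i))"
  by (induction A rule: infinite_finite_induct) (simp_all add: lift_add)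

lemma lop_mult: "lop (A * B) = lop A * lop B"
  by (rule op_eqI) (simp add: ent_mult lift_sum lift_mult)
lemma lop_1 [simp]: "lop 1 = 1"
  by (rule op_eqI) (simp add: ent_1)
lemma lop_diff: "lop (A - B) = lop A - lop B"
  by (rule op_eqI) (simp add: lift_diff)
lemma lop_complex [simp]: "lop A = (A :: ('n, complex fls) op)"
  by (rule op_eqI) simp

definition mk2 :: "'a \<Rightarrow> 'a \<Rightarrow> 'a \<Rightarrow> 'a \<Rightarrow> (bool, 'a) op" where
  "mk2 a b c d = Op (\<lambda>i j. if i then (if j then d else c) else (if j then b else a))"

lemma ent_mk2 [simp]: "ent (mk2 a b c d) False False = a" "ent (mk2 a b c d) False True = b"
  "ent (mk2 a b c d) True False = c" "ent (mk2 a b c d) True True = d"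
  by (simp_all add: mk2_def)

text \<open>The six-vertex R-matrix, with q as an explicit parameter.\<close>

definition Rm :: "complex fls \<Rightarrow> complex fls \<Rightarrow> (bool \<times> bool, complex fls) op" where
  "Rm q x = Op (\<lambda>(i1, i2) (j1, j2).
     if i1 = j1 \<and> i2 = j2 then (if i1 = i2 then cc (x * q) else cc x)
     else if i1 \<noteq> i2 \<and> j1 \<noteq> j2 then cc q else 0)"

definition leg1 :: "(bool, 'a::zero) op \<Rightarrow> (bool \<times> bool, 'a) op" where
  "leg1 A = Op (\<lambda>(i1, i2) (j1, j2). if i2 = j2 then ent A i1 j1 else 0)"
definition leg2 :: "(bool, 'a::zero) op \<Rightarrow> (bool \<times> bool, 'a) op" where
  "leg2 A = Op (\<lambda>(i1, i2) (j1, j2). if i1 = j1 then ent A i2 j2 else 0)"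

definition e12 :: "(bool \<times> bool, 'a::zero) op \<Rightarrow> (bool \<times> bool \<times> bool, 'a) op" where
  "e12 A = Op (\<lambda>(i1, i2, i3) (j1, j2, j3). if i3 = j3 then ent A (i1, i2) (j1, j2) else 0)"
definition e13 :: "(bool \<times> bool, 'a::zero) op \<Rightarrow> (bool \<times> bool \<times> bool, 'a) op" where
  "e13 A = Op (\<lambda>(i1, i2, i3) (j1, j2, j3). if i2 = j2 then ent A (i1, i3) (j1, j3) else 0)"
definition e23 :: "(bool \<times> bool, 'a::zero) op \<Rightarrow> (bool \<times> bool \<times> bool, 'a) op" where
  "e23 A = Op (\<lambda>(i1, i2, i3) (j1, j2, j3). if i1 = j1 then ent A (i2, i3) (j2, j3) else 0)"
definition e1 :: "(bool, 'a::zero) op \<Rightarrow> (bool \<times> bool \<times> bool, 'a) op" where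
  "e1 A = e12 (leg1 A)"
definition e2 :: "(bool, 'a::zero) op \<Rightarrow> (bool \<times> bool \<times> bool, 'a) op" where
  "e2 A = e12 (leg2 A)"
definition e3 :: "(bool, 'a::zero) op \<Rightarrow> (bool \<times> bool \<times> bool, 'a) op" where
  "e3 A = e13 (leg2 A)"

lemma legs:
  "e12 (leg1 A) = e1 A" "e12 (leg2 A) = e2 A" "e13 (leg1 A) = e1 A" "e13 (leg2 A) = e3 A"
  "e23 (leg1 A) = e2 A" "e23 (leg2 A) = e3 A"
  by (auto simp: e1_def e2_def e3_def e12_def e13_def e23_def leg1_def leg2_def intro!: op_eqI)

lemma e_mult:
  fixes A B :: "(bool \<times> bool, 'a::ring_1) op"
  shows "e12 (A * B) = e12 A * e12 B" "e13 (A * B) = e13 A * e13 B" "e23 (A * B) = e23 A * e23 B"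
  by (rule op_eqI; clarsimp simp: ent_mult sum_bool2 sum_bool3 e12_def e13_def e23_def split: bool.splits;
      (auto)?)+

lemma leg_mult:
  fixes A B :: "(bool, 'a::ring_1) op"
  shows "leg1 (A * B) = leg1 A * leg1 B" "leg2 (A * B) = leg2 A * leg2 B"
  by (rule op_eqI; clarsimp simp: ent_mult sum_bool2 sum_bool leg1_def leg2_def)+

lemma e_lop: "e12 (lop A) = lop (e12 A)" "e13 (lop A) = lop (e13 A)" "e23 (lop A) = lop (e23 A)"
  by (rule op_eqI; clarsimp simp: e12_def e13_def e23_def)+
lemma leg_lop: "leg1 (lop A) = lop (leg1 A)" "leg2 (lop A) = lop (leg2 A)"
  by (rule op_eqI; clarsimp simp: leg1_def leg2_def)+

text \<open>Disjoint legs alone would not be enough: the entries of one factor must be scalars,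
  since entries of two operator matrices need not commute.\<close>

lemma e_commute:
  "e1 A * e23 (lop B) = e23 (lop B) * e1 A"
  "e2 A * e13 (lop B) = e13 (lop B) * e2 A"
  "e3 A * e12 (lop B) = e12 (lop B) * e3 A"
  by (rule op_eqI; clarsimp simp: ent_mult sum_bool3 legs[symmetric] e12_def e13_def e23_def leg1_def leg2_def lift_commute)+

lemma yang_baxter_scalar:
  assumes "q \<noteq> 0" "x \<noteq> 0" "y \<noteq> 0"
  shows "e12 (Rm q x) * e13 (Rm q (x * y)) * e23 (Rm q y) = e23 (Rm q y) * e13 (Rm q (x * y)) * e12 (Rm q x)"
  apply (rule op_eqI)
  apply (clarsimp simp: ent_mult sum_bool3 e12_def e13_def e23_def Rm_def)
  using assms apply (auto simp: cc_def field_simps)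
  done

definition refl_eq :: "complex fls \<Rightarrow> complex fls \<Rightarrow> complex fls \<Rightarrow> (bool, 'a::complex_alg_1 fls) op
    \<Rightarrow> (bool, 'a fls) op \<Rightarrow> bool" where
  "refl_eq q x y A B \<longleftrightarrow> lop (Rm q (x / y)) * leg1 A * lop (Rm q (x * y)) * leg2 B
     = leg2 B * lop (Rm q (x * y)) * leg1 A * lop (Rm q (x / y))"

lemmas op_expand = ent_mult sum_bool2 leg1_def leg2_def ent_Op prod.case ent_lop ent_mk2 Rm_def
  simp_thms if_True if_False mult_zero_left mult_zero_right add_0_left add_0_right lift_0

definition Kmat where "Kmat q x p m b c = mk2 (scal p (x * q) + scal m (- inverse (x * q))) b c
   (scal m (x * q) + scal p (- inverse (x * q)))"


context currents
begin

lemma refl_eq: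
  assumes xy: "x \<noteq> 0" "y \<noteq> 0" and U: "U = (q * x\<^sup>2 + inverse (q * x\<^sup>2)) / t"
    and V: "V = (q * y\<^sup>2 + inverse (q * y\<^sup>2)) / t"
  shows "refl_eq q x y (Kmat q x p m b c) (Kmat q y p' m' b' c')"
proof -
  define A where "A = Kmat q x p m b c"
  define B where "B = Kmat q y p' m' b' c'"
  define L where "L = lop (Rm q (x / y)) * leg1 A * lop (Rm q (x * y)) * leg2 B"
  define R where "R = leg2 B * lop (Rm q (x * y)) * leg1 A * lop (Rm q (x / y))"
  have t': "t = (q * q + 1) / q" "q * q + 1 \<noteq> 0"
    using q t by (simp_all add: field_simps)
  note nz = q t'(2) xy
  note ac = mult.assoc mult.commute mult.left_commute add.assoc add.commute add.left_commute
  \<comment> \<open>The element \<open>R0\<close> contains products of \<open>U\<close> and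
    \<open>V\<close>. In the two entries that need it, the denominator \<open>t\<close> is cleared
    first, and the numerators \<open>u\<close> and \<open>v\<close> are expanded only
    afterwards.\<close>
  define u where "u = q * x\<^sup>2 + inverse (q * x\<^sup>2)"
  define v where "v = q * y\<^sup>2 + inverse (q * y\<^sup>2)"
  have Uu: "U = u / t" "V = v / t"
    by (simp_all add: U V u_def v_def)
  \<comment> \<open>During simplification \<open>t\<close> is an independent symbol; these rules
    impose q t = q^2 + 1 once the denominators are gone.\<close>
  have tq: "q * (t * z) = q * (q * z) + z" "q * t = q * q + 1" for z
    using q by (simp_all add: t'(1) field_simps)
  \<comment> \<open>Each entry of the difference of the two sides is an explicit combination of the
    vanishing elements. In the two corner entries it suffices that \<open>b\<close> commutes with
    \<open>b'\<close> and \<open>c\<close> with \<open>c'\<close>.\<close>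
  have "ent L (False, False) (False, False) - ent R (False, False) (False, False) - scal R1 (t * (y / (q * x) - q * x / y)) = 0"
    "ent L (False, False) (False, True) - ent R (False, False) (False, True) - scal Bp (q * x * t) - scal Bm (t / (q * x)) = 0"
    "ent L (False, False) (True, False) - ent R (False, False) (True, False) - scal Bp (- (y * t)) - scal Bm (- (t / y)) = 0"
    "ent L (False, False) (True, True) - ent R (False, False) (True, True) = 0"
    "ent L (False, True) (False, False) - ent R (False, True) (False, False) - scal Cm (- (t / (q * x))) - scal Cp (- (q * x * t)) = 0"
    "ent L (False, True) (False, True) - ent R (False, True) (False, True) - scal R1 (t * (q * x * y - 1 / (q * x * y))) = 0"
    "ent L (False, True) (True, True) - ent R (False, True) (True, True) - scal Bp (t / y) - scal Bm (y * t) = 0"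
    "ent L (True, False) (False, False) - ent R (True, False) (False, False) - scal Cm (t / y) - scal Cp (y * t) = 0"
    "ent L (True, False) (True, False) - ent R (True, False) (True, False) - scal R1 (t * (1 / (q * x * y) - q * x * y)) = 0"
    "ent L (True, False) (True, True) - ent R (True, False) (True, True) - scal Bp (- (t / (q * x))) - scal Bm (- (q * x * t)) = 0"
    "ent L (True, True) (False, False) - ent R (True, True) (False, False) = 0"
    "ent L (True, True) (False, True) - ent R (True, True) (False, True) - scal Cm (- (y * t)) - scal Cp (- (t / y)) = 0"
    "ent L (True, True) (True, False) - ent R (True, True) (True, False) - scal Cm (q * x * t) - scal Cp (t / (q * x)) = 0"
    "ent L (True, True) (True, True) - ent R (True, True) (True, True) - scal R1 (t * (q * x / y - y / (q * x))) = 0"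
    by ((simp only: L_def R_def A_def B_def Kmat_def op_expand, simp only: R1_def Bp_def Bm_def Cp_def Cm_def scal_nf,
        (simp only: scal_nf exchange)?, (simp only: add.assoc)?; (rule collect)+;
        (simp add: U V cc_def field_simps q xy t(1) power2_eq_square)?; (simp only: ac tq distrib_left distrib_right)?)+)
  moreover have "ent L (False, True) (True, False) - ent R (False, True) (True, False) - scal R0 (q * t) = 0"
    "ent L (True, False) (False, True) - ent R (True, False) (False, True) - scal R0 (- (q * t)) = 0"
    by ((simp only: L_def R_def A_def B_def Kmat_def op_expand, simp only: R0_def scal_nf,
        (simp only: scal_nf exchange)?, (simp only: add.assoc)?; (rule collect)+;
        (simp add: Uu field_simps q xy t(1) power2_eq_square)?; (simp only: ac tq distrib_left distrib_right)?;
        (simp add: u_def v_def cc_def field_simps q xy power2_eq_square)?; (simp only: ac tq distrib_left distrib_right)?)+)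
  ultimately have LR: "ent L i j = ent R i j" for i j
    by (cases i; cases j; cases "fst i"; cases "snd i"; cases "fst j"; cases "snd j"; simp add: R1 R0 Bp Bm Cp Cm)
  have "L = R"
    by (rule op_eqI) (rule LR)
  then show ?thesis
    by (simp only: refl_eq_def L_def R_def A_def B_def)
qed
end

section \<open>Antisymmetrizer and degenerate points of the R-matrix\<close>

definition Pm :: "(bool \<times> bool, complex fls) op" where
  "Pm = Op (\<lambda>(i1, i2) (j1, j2). if i1 = i2 \<or> j1 = j2 then 0 else if i1 = j1 then 1/2 else -1/2)"

definition tr :: "('n::finite, 'a::comm_monoid_add) op \<Rightarrow> 'a" where
  "tr A = (\<Sum>i\<in>UNIV. ent A i i)"

text \<open>The element \<open>c\<close> may be noncommuting, so \<open>dg c\<close> is not central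
  in general. It allows a quantum determinant to stand inside a product of operators.\<close>

definition dg :: "'a::zero \<Rightarrow> ('n, 'a) op" where
  "dg c = Op (\<lambda>i j. if i = j then c else 0)"

lemma lop_Pm_square: "Pm * Pm = Pm"
  by (rule op_eqI) (auto simp: ent_mult sum_bool2 Pm_def)

text \<open>The antisymmetrizer has rank one.\<close>

lemma Pm_sandwich: "lop Pm * A * lop Pm = dg (tr (lop Pm * A)) * lop Pm"
  for A :: "(bool \<times> bool, 'a::complex_alg_1 fls) op"
  apply (rule op_eqI)
  apply (clarsimp simp: ent_mult sum_bool2 Pm_def dg_def tr_def split del: if_split)
  subgoal for i1 i2 j1 j2
    by ((cases i1; cases i2; cases j1; cases j2), simp_all add: lift_minus algebra_simps)
  done

text \<open>At this point the R-matrix drops to rank one; this is where quantum determinants come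
  from.\<close>

lemma Rm_inverse_q: "q \<noteq> 0 \<Longrightarrow> Rm q (inverse q) = dg (- 2 * cc q) * Pm"
  apply (rule op_eqI)
  apply (clarsimp simp: ent_mult sum_bool2 Pm_def dg_def Rm_def split del: if_split)
  subgoal for i1 i2 j1 j2
    by (cases i1; cases i2; cases j1; cases j2) (simp_all add: cc_def field_simps)
  done

text \<open>The Yang-Baxter equation for the legs taken in the order 2, 3, 1, combined with the
  symmetry of R under exchange of its legs.\<close>

lemma yb_other:
  assumes "q \<noteq> 0" "x \<noteq> 0" "y \<noteq> 0" "z = x / y"
  shows "e23 (Rm q z) * e12 (Rm q x) * e13 (Rm q y) = e13 (Rm q y) * e12 (Rm q x) * e23 (Rm q z)"
  apply (rule op_eqI)
  apply (clarsimp simp: ent_mult sum_bool3 e12_def e13_def e23_def Rm_def)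
  using assms apply (auto simp: cc_def field_simps)
  done

lemma op_eqI2: "(\<And>i1 i2 j1 j2. ent A (i1, i2) (j1, j2) = ent B (i1, i2) (j1, j2)) \<Longrightarrow> A = B"
  by (rule op_eqI) auto
lemma op_eqI3: "(\<And>i1 i2 i3 j1 j2 j3. ent A (i1, i2, i3) (j1, j2, j3) = ent B (i1, i2, i3) (j1, j2, j3)) \<Longrightarrow> A = B"
  by (rule op_eqI) auto

lemmas e_defs = e12_def e13_def e23_def

text \<open>The quantum determinant of the R-matrix itself: an antisymmetric pair of legs has spin
  0, so its interaction with the third leg is a scalar. The next three lemmas differ only in legs
  and order.\<close>

lemma Pm_12_13:
  assumes "q \<noteq> 0" "x \<noteq> 0"
  shows "e12 Pm * e13 (Rm q x) * e23 (Rm q (x * q)) = dg (cc x * cc (x * q\<^sup>2)) * e12 Pm"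
  apply (rule op_eqI3)
  subgoal for i1 i2 i3 j1 j2 j3
    by ((cases i1; cases i2; cases i3; cases j1; cases j2; cases j3),
      simp_all add: ent_mult sum_bool3 e_defs Rm_def Pm_def dg_def, simp_all add: cc_def field_simps assms power2_eq_square)
  done

lemma Pm_12_23:
  assumes "q \<noteq> 0" "x \<noteq> 0"
  shows "e12 Pm * e23 (Rm q x) * e13 (Rm q (x * q)) = dg (cc x * cc (x * q\<^sup>2)) * e12 Pm"
  apply (rule op_eqI3)
  subgoal for i1 i2 i3 j1 j2 j3
    by ((cases i1; cases i2; cases i3; cases j1; cases j2; cases j3),
      simp_all add: ent_mult sum_bool3 e_defs Rm_def Pm_def dg_def, simp_all add: cc_def field_simps assms power2_eq_square)
  done

lemma Pm_23_12:
  assumes "q \<noteq> 0" "x \<noteq> 0"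
  shows "e23 Pm * e12 (Rm q x) * e13 (Rm q (x * q)) = dg (cc x * cc (x * q\<^sup>2)) * e23 Pm"
  apply (rule op_eqI3)
  subgoal for i1 i2 i3 j1 j2 j3
    by ((cases i1; cases i2; cases i3; cases j1; cases j2; cases j3),
      simp_all add: ent_mult sum_bool3 e_defs Rm_def Pm_def dg_def, simp_all add: cc_def field_simps assms power2_eq_square)
  done

lemma Pm_23_13:
  assumes "q \<noteq> 0" "x \<noteq> 0"
  shows "e23 Pm * e13 (Rm q x) * e12 (Rm q (x * q)) = dg (cc x * cc (x * q\<^sup>2)) * e23 Pm"
  apply (rule op_eqI3)
  subgoal for i1 i2 i3 j1 j2 j3
    by ((cases i1; cases i2; cases i3; cases j1; cases j2; cases j3),
      simp_all add: ent_mult sum_bool3 e_defs Rm_def Pm_def dg_def, simp_all add: cc_def field_simps assms power2_eq_square)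
  done

lemma yb_13_12_23:
  assumes "q \<noteq> 0" "x \<noteq> 0" "y \<noteq> 0" "z = x * y"
  shows "e13 (Rm q x) * e12 (Rm q z) * e23 (Rm q y) = e23 (Rm q y) * e12 (Rm q z) * e13 (Rm q x)"
  apply (rule op_eqI)
  apply (clarsimp simp: ent_mult sum_bool3 e12_def e13_def e23_def Rm_def)
  using assms apply (auto simp: cc_def field_simps)
  done

subsection \<open>Centrality of the quantum determinant\<close>

lemma assoc2: "a * b = c * d \<Longrightarrow> a * (b * z) = c * (d * z)"
  and assoc3: "a * b * c = d * e * f \<Longrightarrow> a * (b * (c * z)) = d * (e * (f * z))"
  and assoc4: "a * b * c * d = e * f * g * h \<Longrightarrow> a * (b * (c * (d * z))) = e * (f * (g * (h * z)))"
  and assoc32: "a * b * c = d * e \<Longrightarrow> a * (b * (c * z)) = d * (e * z)"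
  and assoc42: "a * b * c * d = e * f \<Longrightarrow> a * (b * (c * (d * z))) = e * (f * z)"
  for a b c d e f g h z :: "'a::semigroup_mult"
  by (simp_all only: mult.assoc[symmetric])

lemma dg_mult: "dg a * dg b = (dg (a * b) :: ('n::finite, 'a::ring_1) op)"
  by (rule op_eqI) (auto simp: dg_def ent_mult if_distrib[of "\<lambda>x. x * _"] cong: if_cong)
lemma ent_dg_mult: "ent (dg a * A) i j = a * ent A i j"
  for A :: "('n::finite, 'a::ring_1) op"
  by (simp add: dg_def ent_mult if_distrib[of "\<lambda>x. x * _"] cong: if_cong)
lemma ent_mult_dg: "ent (A * dg a) i j = ent A i j * a"
  for A :: "('n::finite, 'a::ring_1) op"
  by (simp add: dg_def ent_mult if_distrib[of "\<lambda>x. _ * x"] cong: if_cong)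
lemma lop_dg: "lop (dg a) = dg (lift_fls a)"
  by (rule op_eqI) (simp add: dg_def)
lemma dg_lift_commute: "A * dg (lift_fls a) = dg (lift_fls a) * A"
  by (rule op_eqI) (simp add: ent_dg_mult ent_mult_dg lift_commute)
lemma dg_lift_left_commute: "A * (dg (lift_fls a) * B) = dg (lift_fls a) * (A * B)"
  by (rule op_eqI) (simp add: mult.assoc[symmetric] dg_lift_commute)
lemma dg_commute_scalar: "dg a * A = A * dg a" for A :: "('n::finite, complex fls) op"
  using dg_lift_commute[of A a] by simp
lemma e_dg: "e12 (dg a) = dg a" "e13 (dg a) = dg a" "e23 (dg a) = dg a"
  by (rule op_eqI3; auto simp: e_defs dg_def)+
lemma dg_1: "dg 1 = 1"
  by (rule op_eqI) (simp add: dg_def ent_1)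
lemma dg_lift_cancel:
  fixes A B :: "('n::finite, 'a::complex_alg_1 fls) op"
  assumes "c \<noteq> 0" and eq: "dg (lift_fls c) * A = dg (lift_fls c) * B"
  shows "A = B"
proof -
  have c: "dg (lift_fls (inverse c)) * (dg (lift_fls c) * X) = X" for X :: "('n, 'a fls) op"
    using assms(1) by (simp add: mult.assoc[symmetric] dg_mult lift_mult[symmetric] dg_1)
  have "dg (lift_fls (inverse c)) * (dg (lift_fls c) * A) = dg (lift_fls (inverse c)) * (dg (lift_fls c) * B)"
    by (simp only: eq)
  then show ?thesis
    by (simp only: c)
qed

lemma dg_commute_lop: "dg a * lop A = lop A * dg a"
  by (rule op_eqI) (simp add: ent_dg_mult ent_mult_dg lift_commute)

text \<open>The reflection equation of the dressed pair \<open>A\<close>, \<open>B\<close> with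
  \<open>C\<close>. The operator \<open>C\<close> moves to the front through one leg at a time, by
  the reflection equation of that leg, and the Yang-Baxter equation reorders the R-matrices in
  between.\<close>

lemma triple:
  fixes A B C :: "(bool, 'a::complex_alg_1 fls) op"
  assumes q: "q \<noteq> 0" and nz: "x \<noteq> 0" "y \<noteq> 0" "z \<noteq> 0"
    and xz: "refl_eq q x z A C" and yz: "refl_eq q y z B C"
  shows "lop (e13 (Rm q (x / z))) * (lop (e23 (Rm q (y / z))) * (e1 A * (lop (e12 (Rm q (x * y))) * (e2 B *
      (lop (e13 (Rm q (x * z))) * (lop (e23 (Rm q (y * z))) * e3 C)))))) =
    e3 C * (lop (e13 (Rm q (x * z))) * (lop (e23 (Rm q (y * z))) * (e1 A * (lop (e12 (Rm q (x * y))) * (e2 B *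
      (lop (e13 (Rm q (x / z))) * lop (e23 (Rm q (y / z)))))))))"
proof -
  define r13 r23 s12 s13 s23 K1 K2 K3 :: "(bool \<times> bool \<times> bool, 'a fls) op" where
    d: "r13 = lop (e13 (Rm q (x / z)))" "r23 = lop (e23 (Rm q (y / z)))" "s12 = lop (e12 (Rm q (x * y)))"
       "s13 = lop (e13 (Rm q (x * z)))" "s23 = lop (e23 (Rm q (y * z)))" "K1 = e1 A" "K2 = e2 B" "K3 = e3 C"
  note c = e_commute[unfolded e_lop]
  have c2: "K2 * s13 = s13 * K2" "K2 * r13 = r13 * K2" "K3 * s12 = s12 * K3"
     "K1 * r23 = r23 * K1" "K1 * s23 = s23 * K1"
    by (simp_all only: d c)
  have yb1: "r23 * s12 * s13 = s13 * s12 * r23"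
    using yb_other[of q "x * y" "x * z" "y / z"] q nz by (simp add: d lop_mult[symmetric])
  have yb2: "r13 * s12 * s23 = s23 * s12 * r13"
    using yb_13_12_23[of q "x / z" "y * z" "x * y"] q nz by (simp add: d lop_mult[symmetric])
  have r1: "r23 * K2 * s23 * K3 = K3 * s23 * K2 * r23"
    using arg_cong[OF yz[unfolded refl_eq_def], of e23] by (simp add: d e_mult legs e_lop)
  have r2: "r13 * K1 * s13 * K3 = K3 * s13 * K1 * r13"
    using arg_cong[OF xz[unfolded refl_eq_def], of e13] by (simp add: d e_mult legs e_lop)
  note a2 = c2[THEN assoc2] and y1 = yb1[THEN assoc3] and y2 = yb2[THEN assoc3]
    and re2 = r2[THEN assoc4]
  have "r13 * (r23 * (K1 * (s12 * (K2 * (s13 * (s23 * K3)))))) =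
        r13 * (K1 * (r23 * (s12 * (s13 * (K2 * (s23 * K3))))))"
    by (simp only: a2)
  also have "\<dots> = r13 * (K1 * (s13 * (s12 * (r23 * K2 * s23 * K3))))"
    by (simp only: y1 mult.assoc)
  also have "\<dots> = r13 * (K1 * (s13 * (K3 * (s12 * (s23 * (K2 * r23))))))"
    by (simp only: r1[unfolded mult.assoc] mult.assoc a2)
  also have "\<dots> = K3 * (s13 * (K1 * (r13 * (s12 * (s23 * (K2 * r23))))))"
    by (simp only: re2)
  also have "\<dots> = K3 * (s13 * (K1 * (s23 * (s12 * (r13 * (K2 * r23))))))"
    by (simp only: y2)
  also have "\<dots> = K3 * (s13 * (s23 * (K1 * (s12 * (K2 * (r13 * r23))))))"
    by (simp only: a2)
  finally show ?thesis
    by (simp only: d)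
qed

definition qdet :: "complex fls \<Rightarrow> complex fls \<Rightarrow> (bool, 'a::complex_alg_1 fls) op \<Rightarrow> (bool, 'a fls) op \<Rightarrow> 'a fls" where
  "qdet q w A B = tr (lop Pm * (leg1 A * lop (Rm q w) * leg2 B))"

text \<open>At ratio 1/q the outer R-matrices of the reflection equation are multiples of
  \<open>Pm\<close>. So \<open>Pm\<close> passes through the product with its order reversed, hence
  equals its own two-sided compression, which is one-dimensional.\<close>

lemma Pm_qdet:
  fixes A B :: "(bool, 'a::complex_alg_1 fls) op"
  assumes q: "q \<noteq> 0" "cc q \<noteq> 0" "x \<noteq> 0" and re: "refl_eq q x (x * q) A B"
  shows "lop Pm * (leg1 A * lop (Rm q (x * (x * q))) * leg2 B) = dg (qdet q (x * (x * q)) A B) * lop Pm"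
proof -
  define M where "M = leg1 A * lop (Rm q (x * (x * q))) * leg2 B"
  define M' where "M' = leg2 B * lop (Rm q (x * (x * q))) * leg1 A"
  have "x / (x * q) = inverse q"
    using q by (simp add: field_simps)
  then have "dg (lift_fls (- 2 * cc q)) * (lop Pm * M) = dg (lift_fls (- 2 * cc q)) * (M' * lop Pm)"
    using re q by (simp add: refl_eq_def M_def M'_def Rm_inverse_q lop_mult lop_dg mult.assoc dg_lift_left_commute
      del: mult_minus_left)
  then have PM: "lop Pm * M = M' * lop Pm"
    using q dg_lift_cancel[of "- 2 * cc q" "lop Pm * M" "M' * lop Pm"] by simp
  have PP: "lop Pm * lop Pm = (lop Pm :: (bool \<times> bool, 'a fls) op)"
    by (simp add: lop_mult[symmetric] lop_Pm_square)
  have "lop Pm * M = M' * lop Pm * lop Pm"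
    by (simp add: PM mult.assoc PP)
  also have "\<dots> = lop Pm * M * lop Pm"
    by (simp add: PM)
  also have "\<dots> = dg (qdet q (x * (x * q)) A B) * lop Pm"
    by (simp add: Pm_sandwich qdet_def M_def)
  finally show ?thesis
    by (simp add: M_def)
qed

lemma ent_e3_mult: "ent (e3 C * X) (i1, i2, i3) j =
    ent C i3 False * ent X (i1, i2, False) j + ent C i3 True * ent X (i1, i2, True) j"
  for C :: "(bool, 'a::ring_1) op"
  by (cases i1; cases i2; cases i3) (simp_all add: ent_mult sum_bool3 legs(4)[symmetric] e_defs leg2_def)

text \<open>Multiply \<open>triple\<close> by the antisymmetrizer of legs 1 and 2. Every pair of
  R-matrices becomes one of the scalars \<open>D1\<close>, \<open>D2\<close>, the same on both
  sides, and the dressed pair becomes the quantum determinant, once to the left and once to the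
  right of \<open>C\<close>.\<close>

lemma qdet_central:
  fixes A B C :: "(bool, 'a::complex_alg_1 fls) op"
  assumes q: "q \<noteq> 0" "cc q \<noteq> 0" and nz: "x \<noteq> 0" "z \<noteq> 0"
    and xy: "refl_eq q x (x * q) A B" and xz: "refl_eq q x z A C" and yz: "refl_eq q (x * q) z B C"
    and d1: "cc (x / z) * cc (x / z * q\<^sup>2) \<noteq> 0" and d2: "cc (x * z) * cc (x * z * q\<^sup>2) \<noteq> 0"
  shows "qdet q (x * (x * q)) A B * ent C i j = ent C i j * qdet q (x * (x * q)) A B"
proof -
  define y where "y = x * q"
  define \<Gamma> where "\<Gamma> = qdet q (x * (x * q)) A B"
  define P :: "(bool \<times> bool \<times> bool, 'a fls) op" where "P = lop (e12 Pm)"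
  define D1 where "D1 = cc (x / z) * cc (x / z * q\<^sup>2)"
  define D2 where "D2 = cc (x * z) * cc (x * z * q\<^sup>2)"
  define r13 r23 s12 s13 s23 K1 K2 K3 :: "(bool \<times> bool \<times> bool, 'a fls) op" where
    d: "r13 = lop (e13 (Rm q (x / z)))" "r23 = lop (e23 (Rm q (y / z)))" "s12 = lop (e12 (Rm q (x * y)))"
       "s13 = lop (e13 (Rm q (x * z)))" "s23 = lop (e23 (Rm q (y * z)))" "K1 = e1 A" "K2 = e2 B" "K3 = e3 C"
  have y: "y \<noteq> 0" "x * z * q = y * z" "x / z * q = y / z"
    using q nz by (simp_all add: y_def)
  have t: "r13 * (r23 * (K1 * (s12 * (K2 * (s13 * (s23 * K3)))))) =
        K3 * (s13 * (s23 * (K1 * (s12 * (K2 * (r13 * r23))))))"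
    unfolding d by (rule triple) (use q nz y xz yz y_def in auto)
  have Pr: "P * r13 * r23 = dg (lift_fls D1) * P"
    using Pm_12_13[of q "x / z"] q nz
    by (simp only: P_def d lop_mult[symmetric] y(3) D1_def lop_dg[symmetric]) simp
  have Ps: "P * s13 * s23 = dg (lift_fls D2) * P"
    using Pm_12_13[of q "x * z"] q nz
    by (simp only: P_def d lop_mult[symmetric] y(2) D2_def lop_dg[symmetric]) simp
  have PM: "P * K1 * s12 * K2 = dg \<Gamma> * P"
    using arg_cong[OF Pm_qdet[OF q nz(1) xy], of e12]
    by (simp add: P_def d e_mult e_lop e_dg legs \<Gamma>_def y_def mult.assoc)
  have PK: "P * K3 = K3 * P"
    by (simp only: P_def d e_commute[unfolded e_lop])
  note c = dg_lift_left_commute[of P] dg_lift_left_commute[of K3] dg_lift_left_commute[of "dg \<Gamma>"]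
  note aPr = Pr[THEN assoc32] and aPs = Ps[THEN assoc32] and aPM = PM[THEN assoc42] and aPK = PK[THEN assoc2]
  have "P * (r13 * (r23 * (K1 * (s12 * (K2 * (s13 * (s23 * K3))))))) =
      dg (lift_fls D1) * (dg (lift_fls D2) * (dg \<Gamma> * (K3 * P)))"
    by (simp only: aPr aPM aPs PK c)
  moreover have "P * (K3 * (s13 * (s23 * (K1 * (s12 * (K2 * (r13 * r23))))))) =
      dg (lift_fls D1) * (dg (lift_fls D2) * (K3 * (dg \<Gamma> * P)))"
  proof -
    have "P * (K3 * (s13 * (s23 * (K1 * (s12 * (K2 * (r13 * r23))))))) =
       K3 * (dg (lift_fls D2) * (dg \<Gamma> * (P * r13 * r23)))"
      by (simp only: aPM aPs aPK mult.assoc)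
    also have "\<dots> = dg (lift_fls D2) * (dg (lift_fls D1) * (K3 * (dg \<Gamma> * P)))"
      by (simp only: Pr c)
    also have "\<dots> = dg (lift_fls D1) * (dg (lift_fls D2) * (K3 * (dg \<Gamma> * P)))"
      by (rule dg_lift_left_commute)
    finally show ?thesis .
  qed
  ultimately have "dg (lift_fls D1) * (dg (lift_fls D2) * (dg \<Gamma> * (K3 * P))) =
     dg (lift_fls D1) * (dg (lift_fls D2) * (K3 * (dg \<Gamma> * P)))"
    using t by simp
  then have eq: "dg \<Gamma> * (K3 * P) = K3 * (dg \<Gamma> * P)"
    using d1 d2 by (metis D1_def D2_def dg_lift_cancel)
  \<comment> \<open>The diagonal entry of \<open>Pm\<close> at (False, True) is 1/2; comparing these
    entries isolates the entry of \<open>C\<close>, and the factor 1/2 is removed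
    afterwards.\<close>
  have "\<Gamma> * ent C i j * lift_fls (1/2) = ent C i j * \<Gamma> * lift_fls (1/2)"
    using arg_cong[OF eq, of "\<lambda>A. ent A (False, True, i) (False, True, j)"]
    by (cases i; cases j) (simp_all add: ent_dg_mult d ent_e3_mult P_def e12_def Pm_def mult.assoc)
  then have "\<Gamma> * ent C i j * (lift_fls (1/2) * lift_fls 2) = ent C i j * \<Gamma> * (lift_fls (1/2) * lift_fls 2)"
    by (simp only: mult.assoc[symmetric])
  then show ?thesis
    by (simp add: lift_mult[symmetric] \<Gamma>_def)
qed

subsection \<open>Traces\<close>

lemma scal_eqI: "v - w = 0 \<Longrightarrow> v = (w :: 'a::ab_group_add)"
  by simp

definition ptr2 :: "(bool \<times> bool, 'a::plus) op \<Rightarrow> (bool, 'a) op" where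
  "ptr2 W = Op (\<lambda>i j. ent W (i, False) (j, False) + ent W (i, True) (j, True))"
definition ptr3 :: "(bool \<times> bool \<times> bool, 'a::plus) op \<Rightarrow> (bool \<times> bool, 'a) op" where
  "ptr3 W = Op (\<lambda>(i1, i2) (j1, j2). ent W (i1, i2, False) (j1, j2, False) + ent W (i1, i2, True) (j1, j2, True))"

lemma tr_leg1: "tr (leg1 P * W) = tr (P * ptr2 W)" for P :: "(bool, 'a::ring_1) op"
  by (simp add: tr_def ent_mult sum_bool sum_bool2 leg1_def ptr2_def distrib_left add_ac)
lemma tr_e12: "tr (e12 Z * W) = tr (Z * ptr3 W)" for Z :: "(bool \<times> bool, 'a::ring_1) op"
  by (simp add: tr_def ent_mult sum_bool2 sum_bool3 e12_def ptr3_def distrib_left add_ac)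
text \<open>Cyclicity needs the moving factor to be scalar, since entries of two operator matrices
  need not commute.\<close>

lemma tr_cyc: "tr (lop S * A) = tr (A * lop S)" for A :: "('n::finite, 'a::complex_alg_1 fls) op"
  unfolding tr_def ent_mult ent_lop by (subst sum.swap) (simp add: lift_commute)
lemma tr_cyc': "tr (lop S * (A * B)) = tr (A * (B * lop S))" for A :: "('n::finite, 'a::complex_alg_1 fls) op"
  by (simp add: tr_cyc mult.assoc)
lemma tr_dg: "tr (dg a * A) = a * tr A" "tr (A * dg a) = tr A * a" for A :: "('n::finite, 'a::ring_1) op"
  by (simp_all add: tr_def ent_dg_mult ent_mult_dg sum_distrib_left sum_distrib_right)
lemma tr_lop: "tr (lop A) = lift_fls (tr A)"
  by (simp add: tr_def lift_sum)
lemma tr_diff: "tr (A - B) = tr A - tr B" for A :: "('n::finite, 'a::ring_1) op"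
  by (simp add: tr_def sum_subtractf)

definition cross :: "complex fls \<Rightarrow> complex fls \<Rightarrow> complex fls" where
  "cross q w = cc (w * q\<^sup>2) * cc (inverse w)"

text \<open>Crossing unitarity: under the partial trace the R-matrices at w and 1/(w q^2) annihilate
  each other up to the factor \<open>cross q w\<close>. The normalization of the dual K-matrices is
  a product of such factors.\<close>

lemma ptr2_cross:
  fixes Q :: "(bool, 'a::complex_alg_1 fls) op"
  assumes nz: "q \<noteq> 0" "w \<noteq> 0" and w': "w' = inverse (w * q\<^sup>2)"
  shows "ptr2 (lop (Rm q w) * leg2 Q * lop (Rm q w')) = dg (lift_fls (cross q w) * tr Q)"
proof (rule op_eqI)
  fix i j
  show "ent (ptr2 (lop (Rm q w) * leg2 Q * lop (Rm q w'))) i j = ent (dg (lift_fls (cross q w) * tr Q)) i j"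
    by (cases i; cases j; simp add: ptr2_def ent_mult sum_bool2 leg2_def Rm_def dg_def tr_def sum_bool;
      (simp only: scal_nf)?; rule scal_eqI; simp only: scal_nf diff_zero add.assoc; ((rule collect)+)?;
      (simp add: w' cc_def cross_def field_simps nz power2_eq_square)?)
qed

lemma ptr3_cross:
  fixes Y :: "(bool \<times> bool, 'a::complex_alg_1 fls) op"
  assumes nz: "q \<noteq> 0" "w \<noteq> 0" and w': "w' = inverse (w * q\<^sup>2)"
  shows "ptr3 (lop (e13 (Rm q w)) * e23 Y * lop (e13 (Rm q w'))) = dg (lift_fls (cross q w)) * ptr3 (e23 Y)"
proof (rule op_eqI2)
  fix i1 i2 j1 j2
  show "ent (ptr3 (lop (e13 (Rm q w)) * e23 Y * lop (e13 (Rm q w')))) (i1, i2) (j1, j2) =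
    ent (dg (lift_fls (cross q w)) * ptr3 (e23 Y)) (i1, i2) (j1, j2)"
    by (simp only: ent_dg_mult; cases i1; cases i2; cases j1; cases j2;
      simp add: ptr3_def ent_mult sum_bool3 e_defs Rm_def;
      (simp only: scal_nf)?; rule scal_eqI; simp only: scal_nf diff_zero add.assoc; ((rule collect)+)?;
      (simp add: w' cc_def cross_def field_simps nz power2_eq_square)?)
qed

lemma ptr3_e23: "ptr3 (e23 (W :: (bool \<times> bool, 'a::ring_1) op)) = leg2 (ptr2 W)"
  by (rule op_eqI2) (simp add: ptr3_def e23_def leg2_def ptr2_def)

lemma leg2_dg: "leg2 (dg a) = dg a"
  by (rule op_eqI2) (auto simp: leg2_def dg_def)

lemma tr_two:
  fixes P Q :: "(bool, 'a::complex_alg_1 fls) op"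
  assumes nz: "q \<noteq> 0" "w \<noteq> 0" and w': "w' = inverse (w * q\<^sup>2)"
  shows "tr (leg1 P * (lop (Rm q w) * (leg2 Q * lop (Rm q w')))) = lift_fls (cross q w) * (tr P * tr Q)"
proof -
  have "tr (leg1 P * (lop (Rm q w) * (leg2 Q * lop (Rm q w')))) = tr (leg1 P * (lop (Rm q w) * leg2 Q * lop (Rm q w')))"
    by (simp only: mult.assoc)
  also have "\<dots> = tr P * (lift_fls (cross q w) * tr Q)"
    by (simp only: tr_leg1 ptr2_cross[OF assms] tr_dg)
  also have "\<dots> = lift_fls (cross q w) * (tr P * tr Q)"
    by (simp only: mult.assoc[symmetric] lift_commute[of _ "tr P"])
  finally show ?thesis .
qed

lemma tr_three:
  fixes Z :: "(bool \<times> bool, 'a::complex_alg_1 fls) op" and Q :: "(bool, 'a fls) op"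
  assumes nz: "q \<noteq> 0" "v \<noteq> 0" "w \<noteq> 0" and v': "v' = inverse (v * q\<^sup>2)" and w': "w' = inverse (w * q\<^sup>2)"
  shows "tr (e12 Z * (lop (e13 (Rm q v)) * (e23 (lop (Rm q w) * leg2 Q * lop (Rm q w')) * lop (e13 (Rm q v'))))) =
    lift_fls (cross q v * cross q w) * (tr Z * tr Q)"
proof -
  let ?W = "lop (Rm q w) * leg2 Q * lop (Rm q w')"
  have "tr (e12 Z * (lop (e13 (Rm q v)) * (e23 ?W * lop (e13 (Rm q v'))))) =
     tr (e12 Z * (lop (e13 (Rm q v)) * e23 ?W * lop (e13 (Rm q v'))))"
    by (simp only: mult.assoc)
  also have "\<dots> = tr (Z * (dg (lift_fls (cross q v)) * dg (lift_fls (cross q w) * tr Q)))"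
    by (simp only: tr_e12 ptr3_cross[OF nz(1,2) v'] ptr3_e23 ptr2_cross[OF nz(1,3) w'] leg2_dg)
  also have "\<dots> = tr Z * (lift_fls (cross q v * cross q w) * tr Q)"
    by (simp only: dg_mult tr_dg lift_mult mult.assoc)
  also have "\<dots> = lift_fls (cross q v * cross q w) * (tr Z * tr Q)"
    by (simp only: mult.assoc[symmetric] lift_commute[of _ "tr Z"])
  finally show ?thesis .
qed

section \<open>Symmetrizers, reversal of legs and transposition\<close>

definition wt2 :: "bool \<times> bool \<Rightarrow> nat" where "wt2 = (\<lambda>(i1, i2). of_bool i1 + of_bool i2)"
definition wt3 :: "bool \<times> bool \<times> bool \<Rightarrow> nat" where
  "wt3 = (\<lambda>(i1, i2, i3). of_bool i1 + of_bool i2 + of_bool i3)"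
text \<open>On each weight space a multiple of the projection to symmetric tensors, with 1/2 giving
  the symmetrizer itself. Up to scalars, R(q) and the products E F, E E^t and F^t F of the fusion
  maps all have this shape.\<close>

definition D2 :: "complex fls \<Rightarrow> (bool \<times> bool, complex fls) op" where
  "D2 c = Op (\<lambda>i j. if wt2 i = wt2 j then (if wt2 i = 1 then c else 1) else 0)"
definition D3 :: "complex fls \<Rightarrow> (bool \<times> bool \<times> bool, complex fls) op" where
  "D3 c = Op (\<lambda>i j. if wt3 i = wt3 j then (if wt3 i = 1 \<or> wt3 i = 2 then c else 1) else 0)"

lemma D2_mult: "D2 a * D2 b = D2 (2 * a * b)"
  by (rule op_eqI2, case_tac i1; case_tac i2; case_tac j1; case_tac j2; simp add: ent_mult sum_bool2 D2_def wt2_def)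
lemma D3_mult: "D3 a * D3 b = D3 (3 * a * b)"
  by (rule op_eqI3, case_tac i1; case_tac i2; case_tac i3; case_tac j1; case_tac j2; case_tac j3;
      simp add: ent_mult sum_bool3 D3_def wt3_def)

text \<open>Transposition reverses a product of K- and R-matrices; reversing the legs restores the
  order. On symmetric tensors the reversal is invisible, so \<open>D2\<close> absorbs it.\<close>

definition Pi2 :: "(bool \<times> bool, complex fls) op" where
  "Pi2 = Op (\<lambda>(i1, i2) (j1, j2). if i1 = j2 \<and> i2 = j1 then 1 else 0)"
definition Pi3 :: "(bool \<times> bool \<times> bool, complex fls) op" where
  "Pi3 = Op (\<lambda>(i1, i2, i3) (j1, j2, j3). if i1 = j3 \<and> i2 = j2 \<and> i3 = j1 then 1 else 0)"

lemma ent_Pi2: "ent (Pi2 * A) (i1, i2) j = ent A (i2, i1) j" "ent (A * Pi2) i (j1, j2) = ent A i (j2, j1)"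
  by (cases i1; cases i2; simp add: ent_mult sum_bool2 Pi2_def)
    (cases j1; cases j2; simp add: ent_mult sum_bool2 Pi2_def)
lemma ent_Pi3: "ent (Pi3 * A) (i1, i2, i3) j = ent A (i3, i2, i1) j" "ent (A * Pi3) i (j1, j2, j3) = ent A i (j3, j2, j1)"
  by (cases i1; cases i2; cases i3; simp add: ent_mult sum_bool3 Pi3_def)
    (cases j1; cases j2; cases j3; simp add: ent_mult sum_bool3 Pi3_def)

lemma Pi2: "Pi2 * Pi2 = 1" "D2 a * Pi2 = D2 a" "Pi2 * D2 a = D2 a" "Pi2 * leg1 A = leg2 A * Pi2"
  "Pi2 * leg2 A = leg1 A * Pi2" "Pi2 * Rm q x = Rm q x * Pi2" "Pi2 * Pm = Pm * Pi2"
  by (rule op_eqI2; simp only: ent_Pi2; auto simp: D2_def wt2_def Pi2_def ent_1 leg1_def leg2_def Rm_def Pm_def)+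

lemma Pi3: "Pi3 * Pi3 = 1" "D3 a * Pi3 = D3 a" "Pi3 * D3 a = D3 a" "Pi3 * e12 (leg1 A) = e23 (leg2 A) * Pi3"
  "Pi3 * e23 (leg2 A) = e12 (leg1 A) * Pi3" "Pi3 * e12 (leg2 A) = e12 (leg2 A) * Pi3"
  "Pi3 * e12 (Rm q x) = e23 (Rm q x) * Pi3" "Pi3 * e13 (Rm q x) = e13 (Rm q x) * Pi3"
  "Pi3 * e23 (Rm q x) = e12 (Rm q x) * Pi3"
  by (rule op_eqI3; simp only: ent_Pi3; auto simp: D3_def wt3_def Pi3_def ent_1 leg1_def leg2_def e_defs Rm_def)+

definition tp :: "('n, 'a) op \<Rightarrow> ('n, 'a) op" where "tp A = Op (\<lambda>i j. ent A j i)"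
lemma tp_mult: "tp (A * B) = tp B * tp A" for A :: "('n::finite, 'a::comm_ring_1) op"
  by (rule op_eqI) (simp add: tp_def ent_mult mult.commute)
lemma tp_tp [simp]: "tp (tp A) = A"
  by (rule op_eqI) (simp add: tp_def)
lemma tp_legs: "tp (leg1 A) = leg1 (tp A)" "tp (leg2 A) = leg2 (tp A)" "tp (Rm q x) = Rm q x"
  by (rule op_eqI2; auto simp: tp_def leg1_def leg2_def Rm_def)+
lemma tp_e: "tp (e12 B) = e12 (tp B)" "tp (e13 B) = e13 (tp B)" "tp (e23 B) = e23 (tp B)"
  by (rule op_eqI3; auto simp: tp_def e_defs)+

lemma Rm_q:
  assumes "q \<noteq> 0" "q + inverse q \<noteq> 0"
  shows "Rm q q = dg (cc (q\<^sup>2)) * D2 (inverse (q + inverse q))"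
proof -
  have c2: "cc (q\<^sup>2) = cc q * (q + inverse q)"
    using assms(1) by (simp add: cc_def field_simps power2_eq_square)
  have "cc (q * q) * inverse (q + inverse q) = cc q"
    using assms(2) by (simp add: c2[unfolded power2_eq_square])
  then show ?thesis
    by (intro op_eqI2) (auto simp: ent_dg_mult Rm_def D2_def wt2_def power2_eq_square)
qed

text \<open>The quantum integer [3] at q.\<close>

definition q3 :: "complex fls \<Rightarrow> complex fls" where "q3 q = q\<^sup>2 + 1 + inverse (q\<^sup>2)"

text \<open>The three-leg form of \<open>Rm_q\<close>: at these ratios the product of the R-matrices
  degenerates to an operator on symmetric tensors, and [3] is the weight that also appears in the
  spin 3/2 fusion map.\<close>

lemma Rm_q3:
  assumes "q \<noteq> 0" "q3 q \<noteq> 0"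
  shows "e12 (Rm q q) * e13 (Rm q (q\<^sup>2)) * e23 (Rm q q) = dg (cc (q\<^sup>2) * cc (q\<^sup>2) * cc (q^3)) * D3 (inverse (q3 q))"
    (is "_ = dg ?w * _")
proof -
  have c3: "cc (q^3) = cc q * q3 q"
    using assms(1) by (simp add: cc_def q3_def field_simps power2_eq_square power3_eq_cube)
  have w: "?w * inverse (q3 q) = cc (q\<^sup>2) * cc (q\<^sup>2) * cc q"
    using assms(2) by (simp add: c3)
  have "e12 (Rm q q) * e13 (Rm q (q\<^sup>2)) * e23 (Rm q q) = Op (\<lambda>i j. if wt3 i = wt3 j then
      (if wt3 i = 1 \<or> wt3 i = 2 then cc (q\<^sup>2) * cc (q\<^sup>2) * cc q else ?w) else 0)"
    apply (rule op_eqI3)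
    subgoal for i1 i2 i3 j1 j2 j3
      by ((cases i1; cases i2; cases i3; cases j1; cases j2; cases j3),
        simp_all add: ent_mult sum_bool3 e_defs Rm_def wt3_def,
        simp_all add: cc_def assms(1) field_simps power2_eq_square power3_eq_cube)
    done
  also have "\<dots> = dg ?w * D3 (inverse (q3 q))"
    by (rule op_eqI) (simp add: ent_dg_mult D3_def w)
  finally show ?thesis .
qed

lemma e123_mult: "e1 (A * B) = e1 A * e1 B" "e2 (A * B) = e2 A * e2 B" "e3 (A * B) = e3 A * e3 B"
  for A B :: "(bool, 'a::ring_1) op"
  by (simp_all add: legs[symmetric] e_mult leg_mult)
lemma e123_lop: "e1 (lop A) = lop (e1 A)" "e2 (lop A) = lop (e2 A)" "e3 (lop A) = lop (e3 A)"
  by (simp_all add: legs[symmetric] e_lop leg_lop)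

lemma D2_half: "D2 (1/2) + Pm = 1"
  by (rule op_eqI2, case_tac i1; case_tac i2; case_tac j1; case_tac j2; simp add: ent_1 D2_def wt2_def Pm_def)

text \<open>As permutation operators, \<open>V12\<close> is 1 + ((1 2)(2 3) + (2 3))/3 and
  \<open>V23\<close> is 2(1 + (1 2))/3. They come from writing 1 minus the symmetrizer, in the group
  algebra of S_3, as a combination of terms ending in 1 - (1 2) or 1 - (2 3).\<close>

definition V12 :: "(bool \<times> bool \<times> bool, complex fls) op" where
  "V12 = Op (\<lambda>(i1, i2, i3) (j1, j2, j3). (3 * of_bool (i1 = j1 \<and> i2 = j2 \<and> i3 = j3) +
     of_bool (i1 = j1 \<and> i2 = j3 \<and> i3 = j2) + of_bool (i2 = j1 \<and> i1 = j3 \<and> i3 = j2)) / 3)"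
definition V23 :: "(bool \<times> bool \<times> bool, complex fls) op" where
  "V23 = Op (\<lambda>(i1, i2, i3) (j1, j2, j3). (2 * of_bool (i1 = j1 \<and> i2 = j2 \<and> i3 = j3) +
     2 * of_bool (i1 = j2 \<and> i2 = j1 \<and> i3 = j3)) / 3)"

lemma D3_third: "D3 (1/3) + V12 * e12 Pm + V23 * e23 Pm = 1"
  by (rule op_eqI3, case_tac i1; case_tac i2; case_tac i3; case_tac j1; case_tac j2; case_tac j3;
      simp add: ent_1 ent_mult sum_bool3 D3_def wt3_def Pm_def V12_def V23_def e_defs)

lemma tr_e3: "tr (lop A * e3 G) = (\<Sum>i\<in>UNIV. \<Sum>j\<in>UNIV.
    lift_fls (ent A (False, False, i) (False, False, j) + ent A (False, True, i) (False, True, j)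
     + ent A (True, False, i) (True, False, j) + ent A (True, True, i) (True, True, j)) * ent G j i)"
  by (simp add: tr_def ent_mult sum_bool3 sum_bool legs(4)[symmetric] e13_def leg2_def lift_add distrib_right add_ac)
lemma tr_e1: "tr (lop A * e1 G) = (\<Sum>i\<in>UNIV. \<Sum>j\<in>UNIV.
    lift_fls (ent A (i, False, False) (j, False, False) + ent A (i, False, True) (j, False, True)
     + ent A (i, True, False) (j, True, False) + ent A (i, True, True) (j, True, True)) * ent G j i)"
  by (simp add: tr_def ent_mult sum_bool3 sum_bool legs(3)[symmetric] e13_def leg1_def lift_add distrib_right add_ac)

text \<open>The partial trace of \<open>e12 Pm * V12\<close> over the antisymmetrized legs is the
  identity of the third leg. With its companion for \<open>V23\<close>, this gives both quantum
  determinant terms the coefficient 1.\<close>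

lemma tr_Pm_V12: "tr (lop (e12 Pm * V12) * e3 G) = tr G"
  unfolding tr_e3 by (simp add: sum_bool ent_mult sum_bool3 e12_def Pm_def V12_def tr_def)
lemma tr_Pm_V23: "tr (lop (e23 Pm * V23) * e1 G) = tr G"
  unfolding tr_e1 by (simp add: sum_bool ent_mult sum_bool3 e23_def Pm_def V23_def tr_def)

section \<open>Trace formulas with two and three legs\<close>

lemma two_trace:
  fixes A B :: "(bool, 'a::complex_alg_1 fls) op" and kA kB :: "(bool, complex fls) op"
  assumes "q \<noteq> 0" "w \<noteq> 0" "w' = inverse (w * q\<^sup>2)"
  shows "tr (lop (leg2 kB * (Rm q w' * leg1 kA)) * (leg1 A * (lop (Rm q w) * leg2 B))) =
    lift_fls (cross q w) * (tr (lop kA * A) * tr (lop kB * B))"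
proof -
  have "tr (lop (leg2 kB * (Rm q w' * leg1 kA)) * (leg1 A * (lop (Rm q w) * leg2 B))) =
      tr (lop (leg2 kB * Rm q w') * (leg1 (lop kA * A) * (lop (Rm q w) * leg2 B)))"
    by (simp only: lop_mult leg_mult leg_lop mult.assoc)
  \<comment> \<open>Carrying the scalar factor to the end puts the two R-matrices around leg 2, the
    form required by crossing.\<close>
  also have "\<dots> = tr (leg1 (lop kA * A) * (lop (Rm q w) * (leg2 (B * lop kB) * lop (Rm q w'))))"
    by (simp only: tr_cyc[of "leg2 kB * Rm q w'"]) (simp only: lop_mult leg_mult leg_lop mult.assoc)
  also have "\<dots> = lift_fls (cross q w) * (tr (lop kA * A) * tr (B * lop kB))"
    using assms by (rule tr_two)
  finally show ?thesis by (simp only: tr_cyc)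
qed

lemma tp_e123: "tp (e1 A) = e1 (tp A)" "tp (e2 A) = e2 (tp A)" "tp (e3 A) = e3 (tp A)"
  by (simp_all add: legs[symmetric] tp_e tp_legs)

text \<open>The reflection equation of the scalar matrices at ratio q, where R is a multiple of the
  first weight, changes the transposed product into \<open>X\<close> followed by the weights, and
  these multiply to 1 - \<open>Pm\<close>. The identity gives the product of traces;
  \<open>Pm\<close> gives the determinants.\<close>

lemma two_leg:
  fixes A B :: "(bool, 'a::complex_alg_1 fls) op" and kA kB :: "(bool, complex fls) op"
  assumes q: "q \<noteq> 0" "cc q \<noteq> 0" "cc (q\<^sup>2) \<noteq> 0" "q + inverse q \<noteq> 0" and nz: "a \<noteq> 0" "b' \<noteq> 0"
    and b: "b = a * q" and a': "a' = b' * q" and hat: "a' * b' = inverse (a * b * q\<^sup>2)"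
    and re: "refl_eq q a b A B" and re': "refl_eq q a' b' kA kB"
  defines "X \<equiv> leg2 kB * Rm q (a' * b') * leg1 kA"
  shows "tr (lop (D2 (inverse (q + inverse q)) * tp (leg1 (tp kB) * Rm q (a' * b') * leg2 (tp kA)) * D2 ((q + inverse q) / 4))
      * (leg1 A * lop (Rm q (a * b)) * leg2 B)) =
    lift_fls (cross q (a * b)) * (tr (lop kA * A) * tr (lop kB * B))
    - lift_fls (tr (X * Pm)) * qdet q (a * b) A B"
proof -
  define t where "t = q + inverse q"
  define R where "R = Rm q (a' * b')"
  define M where "M = leg1 A * lop (Rm q (a * b)) * leg2 B"
  have ratio: "a' / b' = q" using nz a' by simp
  have eq: "dg (cc (q\<^sup>2)) * (D2 (inverse t) * (leg1 kA * (R * leg2 kB))) = dg (cc (q\<^sup>2)) * (X * D2 (inverse t))"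
  proof -
    have "Rm q q * leg1 kA * R * leg2 kB = X * Rm q q"
      using re' by (simp add: refl_eq_def ratio R_def X_def)
    then show ?thesis
      by (simp only: Rm_q[OF q(1,4)] t_def[symmetric] mult.assoc)
        (simp only: mult.assoc[symmetric] dg_commute_scalar[of _ X])
  qed
  then have eq: "D2 (inverse t) * (leg1 kA * (R * leg2 kB)) = X * D2 (inverse t)"
    using dg_lift_cancel[of "cc (q\<^sup>2)" "D2 (inverse t) * (leg1 kA * (R * leg2 kB))" "X * D2 (inverse t)"] q by simp
  \<comment> \<open>The first \<open>D2\<close> supplies a flip, which moves each scalar matrix to
    the leg of its partner; the second \<open>D2\<close> absorbs the flip again.\<close>
  have "D2 (inverse t) * tp (leg1 (tp kB) * R * leg2 (tp kA)) * D2 (t / 4)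
      = D2 (inverse t) * (Pi2 * (leg2 kA * (R * leg1 kB))) * D2 (t / 4)"
    by (simp add: tp_mult tp_legs R_def mult.assoc[symmetric] Pi2(2))
  also have "\<dots> = D2 (inverse t) * (leg1 kA * (R * leg2 kB)) * (Pi2 * D2 (t / 4))"
    by (simp only: R_def Pi2(4-6) Pi2(4-6)[THEN assoc2] mult.assoc)
  also have "\<dots> = X * (D2 (inverse t) * D2 (t / 4))"
    by (simp only: eq Pi2(3) mult.assoc)
  also have "D2 (inverse t) * D2 (t / 4) = 1 - Pm"
    using q(4) D2_half by (simp add: D2_mult t_def eq_diff_eq)
  finally have D: "D2 (inverse t) * tp (leg1 (tp kB) * R * leg2 (tp kA)) * D2 (t / 4) = X - X * Pm"
    by (simp add: right_diff_distrib)
  have 1: "tr (lop X * M) = lift_fls (cross q (a * b)) * (tr (lop kA * A) * tr (lop kB * B))"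
    using two_trace[of q "a * b" "a' * b'" kB kA A B] q nz b hat by (simp add: X_def M_def mult.assoc)
  have PM: "lop Pm * M = dg (qdet q (a * b) A B) * lop Pm"
    using Pm_qdet[OF q(1,2) nz(1), of A B] re by (simp add: M_def b)
  have 2: "tr (lop (X * Pm) * M) = lift_fls (tr (X * Pm)) * qdet q (a * b) A B"
    by (simp only: lop_mult mult.assoc PM dg_commute_lop) (simp only: mult.assoc[symmetric] tr_dg lop_mult[symmetric] tr_lop)
  show ?thesis
    using 1 2 by (simp only: D[unfolded t_def R_def] lop_diff left_diff_distrib tr_diff M_def)
qed

text \<open>As for two legs, but the symmetrizer leaves two antisymmetric terms, one for each
  neighbouring pair. In each of them the antisymmetrizer collapses both the operator product and the
  scalar product to a quantum determinant and a spin 1/2 trace over the remaining leg.\<close>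

lemma three_leg:
  fixes A B C :: "(bool, 'a::complex_alg_1 fls) op" and kA kB kC :: "(bool, complex fls) op"
  assumes q: "q \<noteq> 0" "cc q \<noteq> 0" "cc (q\<^sup>2) \<noteq> 0" "cc (q^3) \<noteq> 0" "q3 q \<noteq> 0" and nz: "a \<noteq> 0" "c' \<noteq> 0"
    and b: "b = a * q" "c = b * q" and b': "b' = c' * q" "a' = b' * q"
    and hat: "a' * b' = inverse (a * b * q\<^sup>2)" "b' * c' = inverse (b * c * q\<^sup>2)" "a' * c' = inverse (a * c * q\<^sup>2)"
    and re: "refl_eq q a b A B" "refl_eq q b c B C"
    and re': "refl_eq q a' b' kA kB" "refl_eq q a' c' kA kC" "refl_eq q b' c' kB kC"
       "refl_eq q b' a' kB kA" "refl_eq q c' b' kC kB"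
  shows "tr (lop (D3 (inverse (q3 q)) * tp (e1 (tp kC) * (e12 (Rm q (b' * c')) * (e2 (tp kB) *
       (e13 (Rm q (a' * c')) * (e23 (Rm q (a' * b')) * e3 (tp kA)))))) * D3 (q3 q / 9))
      * (e1 A * (lop (e12 (Rm q (a * b))) * (e2 B * (lop (e13 (Rm q (a * c))) * (lop (e23 (Rm q (b * c))) * e3 C)))))) =
    lift_fls (cross q (a * b) * (cross q (a * c) * cross q (b * c))) * (tr (lop kA * A) * (tr (lop kB * B) * tr (lop kC * C)))
    - lift_fls (cc (b' * c') * cc (b' * c' * q\<^sup>2) * (cc (a * c) * cc (a * c * q\<^sup>2))
        * tr (leg2 kB * Rm q (a' * b') * leg1 kA * Pm)) * (qdet q (a * b) A B * tr (lop kC * C))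
    - lift_fls (cc (a' * c') * cc (a' * c' * q\<^sup>2) * (cc (a * b) * cc (a * b * q\<^sup>2))
        * tr (leg2 kC * Rm q (b' * c') * leg1 kB * Pm)) * (tr (lop kA * A) * qdet q (b * c) B C)"
proof -
  define k1 k2 k3 u12 u13 u23 r12 r13 r23 :: "(bool \<times> bool \<times> bool, complex fls) op" where
    u: "k1 = e1 kA" "k2 = e2 kB" "k3 = e3 kC" "u12 = e12 (Rm q (a' * b'))" "u13 = e13 (Rm q (a' * c'))"
      "u23 = e23 (Rm q (b' * c'))" "r12 = e12 (Rm q q)" "r13 = e13 (Rm q (q\<^sup>2))" "r23 = e23 (Rm q q)"
  define K1 K2 K3 s12 s13 s23 P12 P23 :: "(bool \<times> bool \<times> bool, 'a fls) op" where
    d: "K1 = e1 A" "K2 = e2 B" "K3 = e3 C" "s12 = lop (e12 (Rm q (a * b)))" "s13 = lop (e13 (Rm q (a * c)))"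
      "s23 = lop (e23 (Rm q (b * c)))" "P12 = lop (e12 Pm)" "P23 = lop (e23 Pm)"
  define XX where "XX = k3 * (u23 * (u13 * (k2 * (u12 * k1))))"
  define Mt where "Mt = K1 * (s12 * (K2 * (s13 * (s23 * K3))))"
  define mh where "mh = k1 * (u12 * (k2 * (u13 * (u23 * k3))))"
  define mt where "mt = e1 (tp kC) * (e12 (Rm q (b' * c')) * (e2 (tp kB) *
       (e13 (Rm q (a' * c')) * (e23 (Rm q (a' * b')) * e3 (tp kA)))))"
  define i3 where "i3 = inverse (q3 q)"
  have nz': "a' \<noteq> 0" "b' \<noteq> 0" "b \<noteq> 0" "c \<noteq> 0"
    using nz q b b' by auto
  have rat: "a' / b' = q" "b' / c' = q" "a' / c' = q\<^sup>2" "a' * c' = q * (b' * c')"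
    "a' * c' = b' * c' * q" "a' * b' = a' * c' * q" "b * c = a * c * q" "a * c = a * b * q"
    using nz nz' q by (simp_all add: b b' power2_eq_square)
  note cs = e_commute[where 'a = complex, unfolded lop_complex]
  note cl = e_commute[unfolded e_lop]
  have c2: "k3 * r12 = r12 * k3" "k2 * u13 = u13 * k2"
    by (simp_all only: u cs)
  have C2: "K2 * s13 = s13 * K2" "K3 * P12 = P12 * K3" "K1 * P23 = P23 * K1"
    by (simp_all only: d cl)
  \<comment> \<open>The factors R13(q^2) R23(q) bring the matrix on leg 3 to the front by
    \<open>triple\<close>; then R12(q) reverses the remaining pair by its own reflection
    equation.\<close>
  have intertwine: "D3 i3 * mh = XX * D3 i3"
  proof -
    have t: "r13 * (r23 * mh) = k3 * (u13 * (u23 * (k1 * (u12 * (k2 * (r13 * r23))))))"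
      using triple[of q a' b' c' kA kC kB] q nz nz' re' by (simp only: u rat mh_def lop_complex) simp
    have yb: "r12 * u13 * u23 = u23 * u13 * r12"
      using yang_baxter_scalar[of q q "b' * c'"] q nz nz' by (simp add: u rat(4))
    have re: "r12 * k1 * u12 * k2 = k2 * u12 * k1 * r12"
      using arg_cong[OF re'(1)[unfolded refl_eq_def], of e12] by (simp add: u e_mult legs rat)
    have "r12 * (r13 * (r23 * mh)) = k3 * (r12 * (u13 * (u23 * (k1 * (u12 * (k2 * (r13 * r23)))))))"
      by (simp only: t c2 c2[THEN assoc2])
    also have "\<dots> = k3 * (u23 * (u13 * (r12 * (k1 * (u12 * (k2 * (r13 * r23)))))))"
      by (simp only: yb[THEN assoc3])
    also have "\<dots> = XX * (r12 * (r13 * r23))"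
      by (simp only: re[THEN assoc4] XX_def mult.assoc)
    finally have "(r12 * r13 * r23) * mh = XX * (r12 * r13 * r23)"
      by (simp only: mult.assoc)
    then have "dg (cc (q\<^sup>2) * cc (q\<^sup>2) * cc (q^3)) * D3 i3 * mh = XX * (dg (cc (q\<^sup>2) * cc (q\<^sup>2) * cc (q^3)) * D3 i3)"
      by (simp only: u Rm_q3[OF q(1,5)] i3_def)
    then have "dg (cc (q\<^sup>2) * cc (q\<^sup>2) * cc (q^3)) * (D3 i3 * mh) = dg (cc (q\<^sup>2) * cc (q\<^sup>2) * cc (q^3)) * (XX * D3 i3)"
      by (simp only: mult.assoc[symmetric] dg_commute_scalar[of _ XX])
    then show ?thesis
      using dg_lift_cancel[of "cc (q\<^sup>2) * cc (q\<^sup>2) * cc (q^3)" "D3 i3 * mh" "XX * D3 i3"] q by simp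
  qed
  have D: "D3 i3 * tp mt * D3 (q3 q / 9) = XX - XX * (V12 * e12 Pm) - XX * (V23 * e23 Pm)"
  proof -
    have tpm: "tp mt = e3 kA * (e23 (Rm q (a' * b')) * (e13 (Rm q (a' * c')) * (e2 kB * (e12 (Rm q (b' * c')) * e1 kC))))"
      by (simp add: mt_def tp_mult tp_e tp_legs tp_e123 mult.assoc)
    note p = Pi3(4-9)[unfolded legs]
    \<comment> \<open>As for two legs, the weight supplies the reversal of the legs, and the other
      weight swallows it at the end.\<close>
    have "D3 i3 * tp mt * D3 (q3 q / 9) = D3 i3 * (Pi3 * (tp mt * D3 (q3 q / 9)))"
      by (simp only: mult.assoc[symmetric] Pi3(2))
    also have "\<dots> = D3 i3 * (e1 kA * (e12 (Rm q (a' * b')) * (e13 (Rm q (a' * c')) * (e2 kB * (e23 (Rm q (b' * c')) * (e3 kC *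
        (Pi3 * D3 (q3 q / 9))))))))"
      by (simp only: tpm p p[THEN assoc2] mult.assoc)
    also have "\<dots> = D3 i3 * (mh * D3 (q3 q / 9))"
      by (simp only: mh_def Pi3(3) u[symmetric] c2[THEN assoc2] mult.assoc)
    also have "\<dots> = XX * (D3 i3 * D3 (q3 q / 9))"
      by (simp only: mult.assoc[symmetric] intertwine)
    also have "D3 i3 * D3 (q3 q / 9) = D3 (1/3)"
      using q(5) by (simp add: D3_mult i3_def)
    also have "D3 (1/3) = 1 - V12 * e12 Pm - V23 * e23 Pm"
      using D3_third by (simp add: algebra_simps)
    finally show ?thesis
      by (simp add: right_diff_distrib)
  qed
  note ac = mult.assoc mult.commute mult.left_commute
  have lift_left: "lift_fls v * (lift_fls w * z) = lift_fls (w * v) * z" for v w and z :: "'a fls"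
    by (simp only: mult.assoc[symmetric] lift_mult[symmetric] mult.commute[of v w])
  have T0: "tr (lop XX * Mt) = lift_fls (cross q (a * b) * (cross q (a * c) * cross q (b * c))) *
      (tr (lop kA * A) * (tr (lop kB * B) * tr (lop kC * C)))"
  proof -
    define Z where "Z = lop (leg2 kB * (Rm q (a' * b') * leg1 kA)) * (leg1 A * (lop (Rm q (a * b)) * leg2 B))"
    have "tr (lop XX * Mt) = tr (lop (k3 * (u23 * u13)) * (e12 Z * (s13 * (s23 * K3))))"
      by (simp only: XX_def Mt_def Z_def u d lop_mult e_mult e_lop legs mult.assoc e123_lop)
    also have "\<dots> = tr (e12 Z * (s13 * (e23 (lop (Rm q (b * c)) * leg2 (C * lop kC) * lop (Rm q (b' * c'))) * lop u13)))"
      by (simp only: tr_cyc[of "k3 * (u23 * u13)"])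
        (simp only: u d lop_mult e_mult leg_mult leg_lop e_lop legs mult.assoc e123_lop e123_mult)
    also have "\<dots> = lift_fls (cross q (a * c) * cross q (b * c)) * (tr Z * tr (C * lop kC))"
      unfolding d u by (rule tr_three) (use q nz nz' hat in auto)
    also have "tr Z = lift_fls (cross q (a * b)) * (tr (lop kA * A) * tr (lop kB * B))"
      unfolding Z_def by (rule two_trace) (use q nz nz' hat in auto)
    finally show ?thesis
      by (simp only: tr_cyc[of kC C] lift_left mult.assoc)
  qed
  define G1 where "G1 = qdet q (a * b) A B"
  define G2 where "G2 = qdet q (b * c) B C"
  define g1 where "g1 = tr (leg2 kB * Rm q (a' * b') * leg1 kA * Pm)"
  define g2 where "g2 = tr (leg2 kC * Rm q (b' * c') * leg1 kB * Pm)"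
  \<comment> \<open>The determinant formula with legs 1 and 2 exchanged, obtained by conjugation
    with the flip. Since \<open>Pm\<close> has trace 1, the coefficient can be read off as a
    trace.\<close>
  have scalar_qdet: "Pm * (leg2 y * Rm q (v * w) * leg1 x) = dg (tr (leg2 y * Rm q (v * w) * leg1 x * Pm)) * Pm"
    if re: "refl_eq q w v y x" and v: "v = w * q" "w \<noteq> 0" for x y :: "(bool, complex fls) op" and v w
  proof -
    have p: "lop Pm * (leg1 y * lop (Rm q (w * (w * q))) * leg2 x) = dg (qdet q (w * (w * q)) y x) * lop Pm"
      using Pm_qdet[OF q(1,2) v(2), of y x] re v by simp
    have PiPi: "Pi2 * (Pi2 * Y) = Y" for Y
      by (simp only: mult.assoc[symmetric] Pi2(1) mult_1)
    have flip: "Pi2 * (leg1 y * Rm q (v * w) * leg2 x) * Pi2 = leg2 y * Rm q (v * w) * leg1 x"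
      by (simp only: Pi2(4-6) Pi2(4-6)[THEN assoc2] mult.assoc Pi2(1)) simp
    have "Pi2 * (Pm * (leg1 y * Rm q (v * w) * leg2 x)) * Pi2 = Pm * (leg2 y * Rm q (v * w) * leg1 x)"
      by (simp only: Pi2(7) Pi2(7)[THEN assoc2] mult.assoc flip[unfolded mult.assoc])
    moreover have "Pi2 * (dg (qdet q (w * (w * q)) y x) * Pm) * Pi2 = dg (qdet q (w * (w * q)) y x) * Pm"
      by (simp only: dg_commute_scalar[of _ Pi2, symmetric] mult.assoc[symmetric])
        (simp only: mult.assoc Pi2(7) Pi2(7)[THEN assoc2] PiPi dg_commute_scalar)
    ultimately have eq: "Pm * (leg2 y * Rm q (v * w) * leg1 x) = dg (qdet q (w * (w * q)) y x) * Pm"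
      using p v by (simp add: mult.commute)
    have "tr (leg2 y * Rm q (v * w) * leg1 x * Pm) = tr (Pm * (leg2 y * Rm q (v * w) * leg1 x))"
      using tr_cyc[of Pm "leg2 y * Rm q (v * w) * leg1 x"] by simp
    also have "\<dots> = qdet q (w * (w * q)) y x * tr Pm"
      by (simp add: eq tr_dg)
    also have "tr Pm = 1"
      by (simp add: tr_def sum_bool2 Pm_def)
    finally show ?thesis
      using eq by simp
  qed
  define f1 where "f1 = cc (b' * c') * cc (b' * c' * q\<^sup>2)"
  define f1' where "f1' = cc (a * c) * cc (a * c * q\<^sup>2)"
  define f2 where "f2 = cc (a' * c') * cc (a' * c' * q\<^sup>2)"
  define f2' where "f2' = cc (a * b) * cc (a * b * q\<^sup>2)"
  have gl: "lop S * (dg g * z) = dg g * (lop S * z)" for g and S and z :: "(bool \<times> bool \<times> bool, 'a fls) op"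
    by (simp only: mult.assoc[symmetric] dg_commute_lop)
  have T1: "tr (lop (XX * (V12 * e12 Pm)) * Mt) = lift_fls (f1 * f1' * g1) * (G1 * tr (lop kC * C))"
  proof -
    have PM: "P12 * K1 * s12 * K2 = dg G1 * P12"
      using arg_cong[OF Pm_qdet[OF q(1,2) nz(1), of A B], of e12] re b
      by (simp add: d e_mult e_lop e_dg legs G1_def mult.assoc)
    have Ps: "P12 * s13 * s23 = dg (lift_fls f1') * P12"
      using Pm_12_13[of q "a * c"] q nz nz'
      by (simp only: d lop_mult[symmetric] rat(7) f1'_def lop_dg[symmetric]) simp
    have PMt: "P12 * Mt = dg G1 * (dg (lift_fls f1') * (K3 * P12))"
      by (simp only: Mt_def PM[THEN assoc42] Ps[THEN assoc32] C2)
    have px: "e12 Pm * XX = k3 * (dg f1 * (dg g1 * e12 Pm))"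
    proof -
      have 1: "e12 Pm * k3 = k3 * e12 Pm" by (simp only: u cs)
      have 2: "e12 Pm * u23 * u13 = dg f1 * e12 Pm"
        using Pm_12_23[of q "b' * c'"] q nz nz' by (simp add: u f1_def rat(5))
      have 3: "e12 Pm * k2 * u12 * k1 = dg g1 * e12 Pm"
        using arg_cong[OF scalar_qdet[OF re'(4)], of e12] b' nz' by (simp add: u e_mult legs e_dg g1_def mult.assoc)
      show ?thesis
        by (simp only: XX_def 1[THEN assoc2] 2[THEN assoc32] 3[unfolded mult.assoc])
    qed
    have "tr (lop (XX * (V12 * e12 Pm)) * Mt) = tr (lop XX * (lop V12 * (P12 * Mt)))"
      by (simp only: lop_mult mult.assoc d)
    \<comment> \<open>The antisymmetrizer is scalar, so it may travel round the trace to the front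
      of \<open>XX\<close>, where \<open>px\<close> turns the pair of scalar matrices into a
      determinant. Only a trace over leg 3 survives.\<close>
    also have "\<dots> = tr ((lop XX * (lop V12 * (dg G1 * (dg (lift_fls f1') * K3)))) * lop (e12 Pm))"
      by (simp only: PMt mult.assoc d(7)[symmetric])
    also have "\<dots> = tr (lop (e12 Pm * XX) * (lop V12 * (dg G1 * (dg (lift_fls f1') * K3))))"
      by (subst tr_cyc[symmetric]) (simp only: lop_mult mult.assoc)
    also have "\<dots> = tr (dg (lift_fls f1) * (dg (lift_fls g1) * (dg (lift_fls f1') * (dg G1 *
        (lop k3 * (lop (e12 Pm * V12) * K3))))))"
      by (simp only: px lop_mult lop_dg mult.assoc gl dg_lift_left_commute[of "dg G1"])
    also have "\<dots> = lift_fls f1 * (lift_fls g1 * (lift_fls f1' * (G1 * tr (lop k3 * (lop (e12 Pm * V12) * K3)))))"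
      by (simp only: tr_dg)
    also have "tr (lop k3 * (lop (e12 Pm * V12) * K3)) = tr (lop (e12 Pm * V12) * e3 (C * lop kC))"
      by (simp only: tr_cyc' e123_mult e123_lop d u)
    also have "\<dots> = tr (lop kC * C)"
      by (subst tr_Pm_V12) (rule tr_cyc[symmetric])
    finally show ?thesis
      by (simp only: lift_left mult.assoc) (simp only: ac)?
  qed
  \<comment> \<open>The operator on leg 1 stands before the antisymmetrized pair, so
    \<open>G2\<close> comes out to the right of the spin 1/2 trace. This order makes centrality
    necessary.\<close>
  have T2: "tr (lop (XX * (V23 * e23 Pm)) * Mt) = lift_fls (f2 * f2' * g2) * (tr (lop kA * A) * G2)"
  proof -
    have PM: "P23 * K2 * s23 * K3 = dg G2 * P23"
      using arg_cong[OF Pm_qdet[OF q(1,2) nz'(3), of B C], of e23] re b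
      by (simp add: d e_mult e_lop e_dg legs G2_def mult.assoc)
    have Ps: "P23 * s12 * s13 = dg (lift_fls f2') * P23"
      using Pm_23_12[of q "a * b"] q nz nz'
      by (simp only: d lop_mult[symmetric] rat(8) f2'_def lop_dg[symmetric]) simp
    have PMt: "P23 * Mt = K1 * (dg (lift_fls f2') * (dg G2 * P23))"
      by (simp only: Mt_def C2(1)[THEN assoc2] C2(3)[symmetric, THEN assoc2] Ps[THEN assoc32] PM[unfolded mult.assoc])
    have px: "e23 Pm * XX = dg g2 * (dg f2 * (k1 * e23 Pm))"
    proof -
      have 1: "e23 Pm * k1 = k1 * e23 Pm" by (simp only: u cs)
      have 2: "e23 Pm * u13 * u12 = dg f2 * e23 Pm"
        using Pm_23_13[of q "a' * c'"] q nz nz' by (simp add: u f2_def rat(6))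
      have 3: "e23 Pm * k3 * u23 * k2 = dg g2 * e23 Pm"
        using arg_cong[OF scalar_qdet[OF re'(5)], of e23] b' nz by (simp add: u e_mult legs e_dg g2_def mult.assoc)
      show ?thesis
        by (simp only: XX_def c2(2)[symmetric, THEN assoc2] 3[THEN assoc42] 2[THEN assoc32] 1)
    qed
    have "tr (lop (XX * (V23 * e23 Pm)) * Mt) = tr (lop XX * (lop V23 * (P23 * Mt)))"
      by (simp only: lop_mult mult.assoc d)
    also have "\<dots> = tr ((lop XX * (lop V23 * (K1 * (dg (lift_fls f2') * dg G2)))) * lop (e23 Pm))"
      by (simp only: PMt mult.assoc d(8)[symmetric])
    also have "\<dots> = tr (lop (e23 Pm * XX) * (lop V23 * (K1 * (dg (lift_fls f2') * dg G2))))"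
      by (subst tr_cyc[symmetric]) (simp only: lop_mult mult.assoc)
    also have "\<dots> = tr (dg (lift_fls g2) * (dg (lift_fls f2) * (dg (lift_fls f2') *
        ((lop k1 * (lop (e23 Pm * V23) * K1)) * dg G2))))"
      by (simp only: px lop_mult lop_dg mult.assoc gl dg_lift_left_commute[of K1])
    also have "\<dots> = lift_fls g2 * (lift_fls f2 * (lift_fls f2' * (tr (lop k1 * (lop (e23 Pm * V23) * K1)) * G2)))"
      by (simp only: tr_dg)
    also have "tr (lop k1 * (lop (e23 Pm * V23) * K1)) = tr (lop (e23 Pm * V23) * e1 (A * lop kA))"
      by (simp only: tr_cyc' e123_mult e123_lop d u)
    also have "\<dots> = tr (lop kA * A)"
      by (subst tr_Pm_V23) (rule tr_cyc[symmetric])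
    finally show ?thesis
      by (simp only: lift_left mult.assoc) (simp only: ac)?
  qed
  show ?thesis
    using T0 T1 T2 unfolding D[unfolded mt_def i3_def] lop_diff left_diff_distrib tr_diff
      d[symmetric] Mt_def[symmetric] G1_def g1_def f1_def f1'_def G2_def g2_def f2_def f2'_def by simp
qed

subsection \<open>Matrices as operators\<close>

definition cop :: "('n, complex) op \<Rightarrow> ('n, complex fls) op" where
  "cop A = Op (\<lambda>i j. fls_const (ent A i j))"

lemma fls_const_sum: "fls_const (sum f A) = (\<Sum>i\<in>A. fls_const (f i))"
  by (induction A rule: infinite_finite_induct) (simp_all add: fls_plus_const[symmetric])
lemma ent_cop [simp]: "ent (cop A) i j = fls_const (ent A i j)"
  by (simp add: cop_def)
lemma cop_mult: "cop (A * B) = cop A * cop B"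
  by (rule op_eqI) (simp add: ent_mult fls_const_sum fls_const_mult_const)

text \<open>\<open>v\<close> selects the indices in use and \<open>d\<close> numbers them: this places the spaces of spin \<open>1\<close> and \<open>3/2\<close> inside the
  tensor powers of \<open>\<complex>\<^sup>2\<close>, so that all fused operators live on the same index types.\<close>

definition emb :: "('n \<Rightarrow> bool) \<Rightarrow> ('n \<Rightarrow> nat) \<Rightarrow> ('n \<Rightarrow> bool) \<Rightarrow> ('n \<Rightarrow> nat) \<Rightarrow> 'a::zero mat \<Rightarrow> ('n, 'a) op" where
  "emb v d v' d' M = Op (\<lambda>i j. if v i \<and> v' j then M $$ (d i, d' j) else 0)"

text \<open>Only the middle numbering has to be a bijection, so that the sum over all indices
  reduces to the matrix sum; the outer ones need only stay in range.\<close>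

lemma emb_mult:
  fixes A B :: "'a::ring_1 mat" and d :: "'n::finite \<Rightarrow> nat"
  assumes A: "A \<in> carrier_mat r m" and B: "B \<in> carrier_mat m c"
    and bij: "bij_betw d (Collect v) {..<m}"
    and d0: "\<And>i. v0 i \<Longrightarrow> d0 i < r" and d2: "\<And>i. v2 i \<Longrightarrow> d2 i < c"
  shows "emb v0 d0 v2 d2 (A * B) = emb v0 d0 v d A * emb v d v2 d2 B"
proof (rule op_eqI)
  fix i j
  show "ent (emb v0 d0 v2 d2 (A * B)) i j = ent (emb v0 d0 v d A * emb v d v2 d2 B) i j"
  proof (cases "v0 i \<and> v2 j")
    case True
    have "(\<Sum>k\<in>UNIV. (if v k then A $$ (d0 i, d k) else 0) * (if v k then B $$ (d k, d2 j) else 0)) =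
       (\<Sum>k\<in>Collect v. A $$ (d0 i, d k) * B $$ (d k, d2 j))"
      by (intro sum.mono_neutral_cong_right) auto
    also have "\<dots> = (\<Sum>l<m. A $$ (d0 i, l) * B $$ (l, d2 j))"
      by (rule sum.reindex_bij_betw[OF bij])
    finally show ?thesis
      using True A B d0[of i] d2[of j]
      by (simp add: emb_def ent_mult scalar_prod_def lessThan_atLeast0)
  next
    case False
    then show ?thesis
      by (auto simp: emb_def ent_mult)
  qed
qed

definition all_idx :: "'n \<Rightarrow> bool" where "all_idx i = True"
definition i1 :: "bool \<Rightarrow> nat" where "i1 = of_bool"
definition i2 :: "bool \<times> bool \<Rightarrow> nat" where "i2 = (\<lambda>(a, b). 2 * of_bool a + of_bool b)"
text \<open>The admissible indices are the nondecreasing tuples, one for each weight, so the weight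
  itself numbers them. In \<open>v6\<close> the first leg is free and the last two form a spin 1
  space.\<close>

definition v3 :: "bool \<times> bool \<Rightarrow> bool" where "v3 = (\<lambda>(a, b). a \<longrightarrow> b)"
definition v6 :: "bool \<times> bool \<times> bool \<Rightarrow> bool" where "v6 = (\<lambda>(a, b, c). b \<longrightarrow> c)"
definition i6 :: "bool \<times> bool \<times> bool \<Rightarrow> nat" where "i6 = (\<lambda>(a, b, c). 3 * of_bool a + of_bool b + of_bool c)"
definition v4 :: "bool \<times> bool \<times> bool \<Rightarrow> bool" where "v4 = (\<lambda>(a, b, c). (a \<longrightarrow> b) \<and> (b \<longrightarrow> c))"

lemmas idx_defs = all_idx_def i1_def i2_def v3_def v6_def i6_def v4_def wt2_def wt3_def

lemma bij_i2: "bij_betw i2 (Collect all_idx) {..<4}"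
proof (rule bij_betwI')
  fix y :: nat assume "y \<in> {..<4}"
  then have "y = i2 (False, False) \<or> y = i2 (False, True) \<or> y = i2 (True, False) \<or> y = i2 (True, True)"
    by (auto simp: i2_def)
  then show "\<exists>x\<in>Collect all_idx. y = i2 x"
    by (elim disjE) (rule bexI, assumption, simp add: all_idx_def)+
qed (auto simp: idx_defs split: prod.splits)
lemma bij_wt2: "bij_betw wt2 (Collect v3) {..<3}"
proof (rule bij_betwI')
  fix y :: nat assume "y \<in> {..<3}"
  then have "y = wt2 (False, False) \<or> y = wt2 (False, True) \<or> y = wt2 (True, True)"
    by (auto simp: wt2_def)
  then show "\<exists>x\<in>Collect v3. y = wt2 x"
    by (elim disjE) (rule bexI, assumption, simp add: v3_def)+
qed (auto simp: idx_defs split: prod.splits)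
lemma bij_i6: "bij_betw i6 (Collect v6) {..<6}"
proof (rule bij_betwI')
  fix y :: nat assume "y \<in> {..<6}"
  then have "y = i6 (False, False, False) \<or> y = i6 (False, False, True) \<or> y = i6 (False, True, True) \<or>
     y = i6 (True, False, False) \<or> y = i6 (True, False, True) \<or> y = i6 (True, True, True)"
    by (auto simp: i6_def)
  then show "\<exists>x\<in>Collect v6. y = i6 x"
    by (elim disjE) (rule bexI, assumption, simp add: v6_def)+
qed (auto simp: i6_def v6_def split: prod.splits)
lemma bij_wt3: "bij_betw wt3 (Collect v4) {..<4}"
proof (rule bij_betwI')
  fix y :: nat assume "y \<in> {..<4}"
  then have "y = wt3 (False, False, False) \<or> y = wt3 (False, False, True) \<or> y = wt3 (False, True, True) \<or>
     y = wt3 (True, True, True)"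
    by (auto simp: wt3_def)
  then show "\<exists>x\<in>Collect v4. y = wt3 x"
    by (elim disjE) (rule bexI, assumption, simp add: v4_def)+
qed (auto simp: idx_defs split: prod.splits)

lemma emb_lift: "M \<in> carrier_mat r c \<Longrightarrow> (\<And>i. v i \<Longrightarrow> d i < r) \<Longrightarrow> (\<And>i. v' i \<Longrightarrow> d' i < c) \<Longrightarrow>
    emb v d v' d' (lift_mat M) = lop (emb v d v' d' M)"
  by (rule op_eqI) (auto simp: emb_def)
lemma emb_const: "M \<in> carrier_mat r c \<Longrightarrow> (\<And>i. v i \<Longrightarrow> d i < r) \<Longrightarrow> (\<And>i. v' i \<Longrightarrow> d' i < c) \<Longrightarrow>
    emb v d v' d' (const_mat M) = cop (emb v d v' d' M)"
  by (rule op_eqI) (auto simp: emb_def)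

lemma idx_less: "i1 a < 2" "i2 b < 4" "v3 b \<Longrightarrow> wt2 b < 3" "v6 c \<Longrightarrow> i6 c < 6" "v4 c \<Longrightarrow> wt3 c < 4"
  by (auto simp: idx_defs split: prod.splits)

section \<open>Fusion maps and R-matrices in coordinates\<close>

locale qroot =
  fixes s qc :: complex
  assumes s: "s\<^sup>2 = qc" and qc0: "qc \<noteq> 0" and root: "\<And>m::nat. m > 0 \<Longrightarrow> qc ^ m \<noteq> 1"
begin
lemma s0: "s \<noteq> 0" using s qc0 by auto
definition "two = qc + inverse qc"
definition "three = qc\<^sup>2 + 1 + inverse (qc\<^sup>2)"
definition "r = csqrt two"
definition "z = csqrt three"
definition "bb = csqrt (two * two)"
lemma qc: "qc \<noteq> 0" "qc - inverse qc \<noteq> 0" "qc * qc \<noteq> 1"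
proof -
  show "qc \<noteq> 0" using qc0 by simp
  have "qc ^ 2 \<noteq> 1" using root[of 2] by simp
  then show *: "qc * qc \<noteq> 1" by (simp add: power2_eq_square)
  then show "qc - inverse qc \<noteq> 0" using qc0 by (simp add: field_simps)
qed
lemma qint: "qint qc 1 = 1" "qint qc (Suc 0) = 1" "qint qc 2 = two" "qint qc 3 = three"
proof -
  have i: "qc * inverse qc = 1" using qc by simp
  show "qint qc 1 = 1" using qc by (simp add: qint_def power_int_minus)
  then show "qint qc (Suc 0) = 1" by simp
  have "qc\<^sup>2 - (inverse qc)\<^sup>2 = two * (qc - inverse qc)"
    by (simp add: two_def algebra_simps power2_eq_square)
  then show "qint qc 2 = two" using qc by (simp add: qint_def power_int_minus power_inverse)
  have "qc^3 - (inverse qc)^3 = three * (qc - inverse qc)"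
    using qc(1) by (simp add: three_def field_simps power2_eq_square power3_eq_cube)
  then show "qint qc 3 = three" using qc by (simp add: qint_def power_int_minus power_inverse)
qed
lemma nz: "two \<noteq> 0" "three \<noteq> 0"
proof -
  have i: "qc * inverse qc = 1" using qc by simp
  have 4: "qc ^ 4 \<noteq> 1" and 6: "qc ^ 6 \<noteq> 1" using root[of 4] root[of 6] by simp_all
  have "qc ^ 4 - 1 = two * qc * (qc ^ 2 - 1)" using i unfolding two_def by (simp add: algebra_simps power2_eq_square power4_eq_xxxx)
  then show "two \<noteq> 0" using 4 by auto
  have "qc ^ 6 - 1 = three * qc ^ 2 * (qc ^ 2 - 1)" using qc(1) by (simp add: three_def field_simps eval_nat_numeral)
  then show "three \<noteq> 0" using 6 by auto
qed
lemma roots: "r * r = two" "z * z = three" "bb * bb = two * two" "r \<noteq> 0" "z \<noteq> 0" "bb \<noteq> 0"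
proof -
  show "r * r = two" "z * z = three" "bb * bb = two * two"
    using power2_csqrt[of two] power2_csqrt[of three] power2_csqrt[of "two * two"]
    by (simp_all add: r_def z_def bb_def power2_eq_square)
  then show "r \<noteq> 0" "z \<noteq> 0" "bb \<noteq> 0" using nz by auto
qed
lemma Bq: "Bq qc 1 1 = 1" "Bq qc 2 2 = r" "Bq qc 2 0 = r" "Bq qc 3 3 = z" "Bq qc 3 1 = bb" "Bq qc 3 (-1) = z"
  by (simp_all add: Bq_def qint r_def z_def bb_def)

text \<open>The coefficient B for spins 3/2 and 1/2 is the principal root of [2]^2, hence equal to
  [2] only up to a sign. This is that sign; it cancels in all products that enter a trace.\<close>

definition sg where "sg = two / bb"
lemma sg: "sg * sg = 1" "sg \<noteq> 0"
  using roots nz by (simp_all add: sg_def)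

definition E2 :: "(bool \<times> bool, complex) op" where
  "E2 = emb all_idx i2 v3 wt2 (E_mat qc 2)"
definition F2 :: "(bool \<times> bool, complex) op" where
  "F2 = emb v3 wt2 all_idx i2 (F_mat qc 2)"
definition E3 :: "(bool \<times> bool \<times> bool, complex) op" where
  "E3 = emb v6 i6 v4 wt3 (E_mat qc 3)"
definition F3 :: "(bool \<times> bool \<times> bool, complex) op" where
  "F3 = emb v4 wt3 v6 i6 (F_mat qc 3)"

lemma E_diag: "E_diag qc n (Suc 0) = 1" "E_diag qc n 1 = 1" "E_diag qc 2 2 = 1 / r"
   "E_diag qc 3 2 = r / z" "E_diag qc 3 3 = sg / z"
  using roots by (simp_all add: E_diag_def Bq lessThan_Suc sg_def numeral_2_eq_2)

lemmas E_simps = nz numeral_2_eq_2[symmetric] numeral_3_eq_3[symmetric] emb_def E_mat_def F_mat_def mat1_def idx_defs E_entry_def E_diag qint Bq roots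

lemma E2: "E2 = Op (\<lambda>(a, b) (c, d). if \<not> a \<and> \<not> b \<and> \<not> c \<and> \<not> d \<or> a \<and> b \<and> c \<and> d then 1
   else if a \<noteq> b \<and> \<not> c \<and> d then 1 / r else 0)"
  apply (rule op_eqI2)
  subgoal for a b c d
    by (cases a; cases b; cases c; cases d;
       simp add: E2_def E_simps; (simp add: field_simps roots)?)
  done

lemma F2: "F2 = Op (\<lambda>(a, b) (c, d). if \<not> a \<and> \<not> b \<and> \<not> c \<and> \<not> d \<or> a \<and> b \<and> c \<and> d then 1
   else if \<not> a \<and> b \<and> c \<noteq> d then r / 2 else 0)"
  apply (rule op_eqI2)
  subgoal for a b c d
    by (cases a; cases b; cases c; cases d;
       simp add: F2_def F_off_def E_simps; (simp add: field_simps roots power2_eq_square nz)?; (simp add: nz)?)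
  done

lemma E3: "E3 = Op (\<lambda>(a, b, c) (d, e, f). if \<not> a \<and> \<not> b \<and> \<not> c \<and> \<not> d \<and> \<not> e \<and> \<not> f then 1
   else if \<not> a \<and> \<not> b \<and> c \<and> \<not> d \<and> \<not> e \<and> f then r / z
   else if a \<and> \<not> b \<and> \<not> c \<and> \<not> d \<and> \<not> e \<and> f then 1 / z
   else if \<not> a \<and> b \<and> c \<and> \<not> d \<and> e \<and> f then sg / z
   else if a \<and> \<not> b \<and> c \<and> \<not> d \<and> e \<and> f then sg * r / z
   else if a \<and> b \<and> c \<and> d \<and> e \<and> f then sg else 0)"
  apply (rule op_eqI3)
  subgoal for a b c d e f
    by (cases a; cases b; cases c; cases d; cases e; cases f;
       simp add: E3_def E_simps; (simp add: sg_def field_simps roots)?)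
  done

text \<open>The identity of the spin 3/2 space, which the embedding turns into a projection.\<close>

definition J4 :: "(bool \<times> bool \<times> bool, complex) op" where
  "J4 = Op (\<lambda>i j. if i = j \<and> v4 i then 1 else 0)"

lemma F3_E3: "F3 * E3 = J4"
  unfolding E3
  apply (rule op_eqI3)
  subgoal for a b c d e f
    by (cases a; cases b; cases c; cases d; cases e; cases f;
       simp add: ent_mult sum_bool3 F3_def J4_def E_simps sg nz; (simp add: sg_def field_simps roots nz)?)
  done

text \<open>The iterated fusion map from spin 3/2 into three planes. Its image consists of the
  symmetric tensors.\<close>

definition E8 :: "(bool \<times> bool \<times> bool, complex) op" where
  "E8 = Op (\<lambda>i j. if v4 j \<and> wt3 i = wt3 j then (if wt3 j = 0 then 1 else if wt3 j = 1 then 1 / z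
     else if wt3 j = 2 then sg / z else sg) else 0)"
text \<open>The left inverse of \<open>E8\<close> that is constant on weight spaces, so that
  \<open>E8 * F8\<close> is the symmetrizer. It is not \<open>F3 * e23 F2\<close>, which treats leg
  1 differently from the other two.\<close>

definition F8 :: "(bool \<times> bool \<times> bool, complex) op" where
  "F8 = Op (\<lambda>i j. if v4 i \<and> wt3 i = wt3 j then (if wt3 i = 0 then 1 else if wt3 i = 1 then z / 3
     else if wt3 i = 2 then sg * z / 3 else sg) else 0)"

lemma E8: "e23 E2 * E3 = E8"
  unfolding E2 E3 E8_def
  apply (rule op_eqI3)
  subgoal for a b c d e f
  by (cases a; cases b; cases c; cases d; cases e; cases f;
       simp add: ent_mult sum_bool3 e23_def idx_defs roots)
  done

definition D3c :: "complex \<Rightarrow> (bool \<times> bool \<times> bool, complex) op" where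
  "D3c c = Op (\<lambda>i j. if wt3 i = wt3 j then (if wt3 i = 1 \<or> wt3 i = 2 then c else 1) else 0)"
definition D2c :: "complex \<Rightarrow> (bool \<times> bool, complex) op" where
  "D2c c = Op (\<lambda>i j. if wt2 i = wt2 j then (if wt2 i = 1 then c else 1) else 0)"
lemma cop_D: "cop (D2c c) = D2 (fls_const c)" "cop (D3c c) = D3 (fls_const c)"
  by (rule op_eqI; simp add: D2_def D2c_def D3_def D3c_def)+
definition J3 :: "(bool \<times> bool, complex) op" where
  "J3 = Op (\<lambda>i j. if i = j \<and> v3 i then 1 else 0)"

text \<open>These products are all that the traces see of the fusion maps; the square root
  \<open>z\<close> and the sign \<open>sg\<close> disappear from them.\<close>

lemma F8_E8: "F8 * E8 = J4" "E8 * F8 = D3c (1/3)" "E8 * tp E8 = D3c (1 / three)" "tp F8 * F8 = D3c (three / 9)"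
   "J4 * F8 = F8"
proof -
  have zz: "z / 3 * (1 / z) = 1 / 3" "sg * z / 3 * (sg / z) = 1 / 3" "sg / z * (sg / z) = 1 / three"
    "1 / z * (1 / z) = 1 / three" "z / 3 * (z / 3) = three / 9" "sg * z / 3 * (sg * z / 3) = three / 9"
    "1 / z * (z / 3) = 1 / 3" "sg / z * (sg * z / 3) = 1 / 3"
    using sg roots by (simp_all add: field_simps)
  show "F8 * E8 = J4" "E8 * F8 = D3c (1/3)" "E8 * tp E8 = D3c (1 / three)" "tp F8 * F8 = D3c (three / 9)"
     "J4 * F8 = F8"
    unfolding F8_def E8_def J4_def D3c_def tp_def
    by (rule op_eqI3; rename_tac a b c d e f; case_tac a; case_tac b; case_tac c; case_tac d; case_tac e; case_tac f;
       simp add: ent_mult sum_bool3 idx_defs del: times_divide_eq_left times_divide_eq_right times_divide_times_eq;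
       (simp add: sg zz del: times_divide_eq_left times_divide_eq_right times_divide_times_eq)?; simp?)+
qed

lemma F2_E2: "F2 * E2 = J3" "E2 * F2 = D2c (1/2)" "E2 * tp E2 = D2c (1 / two)" "tp F2 * F2 = D2c (two / 4)"
proof -
  have rr: "r / 2 * (1 / r) = 1 / 2" "1 / r * (r / 2) = 1 / 2" "1 / r * (1 / r) = 1 / two" "r / 2 * (r / 2) = two / 4"
    using roots by (simp_all add: field_simps)
  show "F2 * E2 = J3" "E2 * F2 = D2c (1/2)" "E2 * tp E2 = D2c (1 / two)" "tp F2 * F2 = D2c (two / 4)"
    unfolding F2 E2 J3_def D2c_def tp_def
    by (rule op_eqI2; rename_tac a b c d; case_tac a; case_tac b; case_tac c; case_tac d;
       simp add: ent_mult sum_bool2 idx_defs del: times_divide_eq_left times_divide_eq_right times_divide_times_eq;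
       (simp add: rr del: times_divide_eq_left times_divide_eq_right times_divide_times_eq)?; simp?)+
qed

definition q where "q = qpw s 2"
lemma q: "q = fls_const qc" "q \<noteq> 0"
  using s qc0 by (simp_all add: q_def qpw_def)
lemma R1: "emb all_idx i2 all_idx i2 (R_mat s 1 x) = Rm q x"
  apply (rule op_eqI2)
  subgoal for a b c d
    by (cases a; cases b; cases c; cases d;
      simp add: emb_def idx_defs R_mat_def Let_def S_minus_def S_plus_def S_3_def mat1_def kron_def sigma_plus_def
        sigma_minus_def sigma_z_def mat_of_rows_list_def qpw_diag_def Rm_def cc_def s qint Bq Bq[simplified] numeral_2_eq_2[symmetric] numeral_3_eq_3[symmetric]
        qpw_def q fls_inverse_const power_int_minus fls_minus_const)
  done

definition S where "S = qpw s 1"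
definition \<rho> where "\<rho> = fls_const r"
lemma S: "S \<noteq> 0" "q = S * S" "\<rho> * \<rho> = q + inverse q" "\<rho> \<noteq> 0"
  using s s0 roots qc0 by (simp_all add: S_def q qpw_def \<rho>_def two_def fls_inverse_const fls_plus_const power2_eq_square)
lemma qpw: "qpw s 0 = 1" "qpw s 1 = S" "qpw s (-1) = inverse S" "qpw s 3 = S * S * S" "qpw s (-3) = inverse (S * S * S)" "qpw s 2 = q" "qpw s (-2) = inverse q"
  using s0 by (simp_all add: S_def q_def qpw_def fls_inverse_const power_int_minus power3_eq_cube)

lemma R2: "emb v6 i6 v6 i6 (R_mat s 2 x) = dg (cc (x * S)) * Op (\<lambda>(a, b, c) (a', b', c').
   if \<not> v6 (a, b, c) \<or> \<not> v6 (a', b', c') then 0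
   else if a = a' \<and> b = b' \<and> c = c' then
     (if a = b \<and> b = c then x * (S * S * S) - inverse x * inverse (S * S * S)
      else if b \<noteq> c then x * S - inverse x * inverse S else x * inverse S - inverse x * S)
   else if a \<noteq> a' \<and> ((\<not> a \<and> wt2 (b, c) = wt2 (b', c') + 1) \<or> (a \<and> wt2 (b, c) + 1 = wt2 (b', c'))) then cc q * \<rho> else 0)"
  apply (rule op_eqI3)
  subgoal for a b c d e f
    by (cases a; cases b; cases c; cases d; cases e; cases f;
      simp add: emb_def idx_defs R_mat_def Let_def S_minus_def S_plus_def S_3_def mat1_def kron_def sigma_plus_def
        sigma_minus_def sigma_z_def mat_of_rows_list_def qpw_diag_def ent_dg_mult cc_def s qint Bq qpw;
      (simp add: q \<rho>_def fls_inverse_const fls_minus_const)?)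
  done
end

lemma lop_0: "lop 0 = 0"
  by (rule op_eqI) simp

lemma assoc21: "a * b = c \<Longrightarrow> a * (b * z) = c * z" for a b c z :: "'a::semigroup_mult"
  by (simp only: mult.assoc[symmetric])

lemma emb5:
  fixes A1 A2 A3 A4 A5 :: "'a::ring_1 mat" and d :: "'n::finite \<Rightarrow> nat"
  assumes "A1 \<in> carrier_mat r m" "A2 \<in> carrier_mat m m" "A3 \<in> carrier_mat m m" "A4 \<in> carrier_mat m m"
    "A5 \<in> carrier_mat m r" and bij: "bij_betw d (Collect v) {..<m}" and d0: "\<And>i. v0 i \<Longrightarrow> d0 i < r"
  shows "emb v0 d0 v0 d0 (A1 * A2 * A3 * A4 * A5) =
    emb v0 d0 v d A1 * emb v d v d A2 * emb v d v d A3 * emb v d v d A4 * emb v d v0 d0 A5"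
proof -
  have d: "v i \<Longrightarrow> d i < m" for i
    using bij by (auto simp: bij_betw_def)
  have "emb v0 d0 v0 d0 (A1 * A2 * A3 * A4 * A5) = emb v0 d0 v d (A1 * A2 * A3 * A4) * emb v d v0 d0 A5"
    by (rule emb_mult[where r = r and m = m and c = r]) (use assms d in auto)
  also have "emb v0 d0 v d (A1 * A2 * A3 * A4) = emb v0 d0 v d (A1 * A2 * A3) * emb v d v d A4"
    by (rule emb_mult[where r = r and m = m and c = m]) (use assms d in auto)
  also have "emb v0 d0 v d (A1 * A2 * A3) = emb v0 d0 v d (A1 * A2) * emb v d v d A3"
    by (rule emb_mult[where r = r and m = m and c = m]) (use assms d in auto)
  also have "emb v0 d0 v d (A1 * A2) = emb v0 d0 v d A1 * emb v d v d A2"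
    by (rule emb_mult[where r = r and m = m and c = m]) (use assms d in auto)
  finally show ?thesis .
qed

lemma mtrace_emb:
  fixes d :: "'n::finite \<Rightarrow> nat"
  assumes w: "w \<in> carrier_mat n n" and W: "W \<in> carrier_mat n n" and bij: "bij_betw d (Collect v) {..<n}"
  shows "mtrace (lift_mat (c \<cdot>\<^sub>m transpose_mat w) * W) = lift_fls c * tr (lop (tp (emb v d v d w)) * emb v d v d W)"
proof -
  have "mtrace (lift_mat (c \<cdot>\<^sub>m transpose_mat w) * W) = (\<Sum>i<n. \<Sum>k<n. lift_fls (c * w $$ (k, i)) * W $$ (k, i))"
    using w W by (simp add: mtrace_def scalar_prod_def lessThan_atLeast0)
  also have "\<dots> = (\<Sum>i\<in>Collect v. \<Sum>k\<in>Collect v. lift_fls (c * w $$ (d k, d i)) * W $$ (d k, d i))"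
    by (simp only: sum.reindex_bij_betw[OF bij, symmetric])
  also have "\<dots> = (\<Sum>i\<in>UNIV. \<Sum>k\<in>UNIV. lift_fls c * (ent (lop (tp (emb v d v d w))) i k * ent (emb v d v d W) k i))"
  proof (rule sum.mono_neutral_cong_left)
    show "\<forall>i\<in>UNIV - Collect v. (\<Sum>k\<in>UNIV. lift_fls c * (ent (lop (tp (emb v d v d w))) i k * ent (emb v d v d W) k i)) = 0"
      by (simp add: emb_def tp_def)
    show "(\<Sum>k\<in>Collect v. lift_fls (c * w $$ (d k, d i)) * W $$ (d k, d i)) =
       (\<Sum>k\<in>UNIV. lift_fls c * (ent (lop (tp (emb v d v d w))) i k * ent (emb v d v d W) k i))" if "i \<in> Collect v" for i
      by (rule sum.mono_neutral_cong_left) (use that in \<open>auto simp: emb_def tp_def lift_mult mult.assoc\<close>)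
  qed auto
  also have "\<dots> = lift_fls c * tr (lop (tp (emb v d v d w)) * emb v d v d W)"
    by (simp add: tr_def ent_mult sum_distrib_left)
  finally show ?thesis .
qed

lemma kron_carrier: "A \<in> carrier_mat a b \<Longrightarrow> B \<in> carrier_mat c d \<Longrightarrow> A \<otimes>\<^sub>K B \<in> carrier_mat (a * c) (b * d)"
  by (intro carrier_matI) (simp_all add: kron_def)
lemma R_mat_carrier: "R_mat s n x \<in> carrier_mat (2 * (n + 1)) (2 * (n + 1))"
proof -
  have "sigma_z \<otimes>\<^sub>K S_3 n \<in> carrier_mat (2 * (n + 1)) (2 * (n + 1))"
    by (intro kron_carrier carrier_matI) (simp_all add: sigma_z_def mat_of_rows_list_def S_3_def mat1_def)
  then show ?thesis
    by (intro carrier_matI) (simp_all add: R_mat_def Let_def qpw_diag_def)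
qed
lemma R_mat_carriers: "R_mat s 1 x \<in> carrier_mat 4 4" "R_mat s 2 x \<in> carrier_mat 6 6"
  using R_mat_carrier[of s 1 x] R_mat_carrier[of s 2 x] by simp_all
lemma EF_carriers: "E_mat p 2 \<in> carrier_mat 4 3" "F_mat p 2 \<in> carrier_mat 3 4" "E_mat p 3 \<in> carrier_mat 6 4"
  "F_mat p 3 \<in> carrier_mat 4 6"
  by (simp_all add: E_mat_def F_mat_def mat1_def)

lemma fused_carrier: "fused_K s K n x \<in> carrier_mat (Suc n) (Suc n)"
  by (cases n) (auto simp: F_mat_def E_mat_def mat1_def)

definition kop :: "'a::zero mat \<Rightarrow> (bool, 'a) op" where
  "kop M = emb all_idx i1 all_idx i1 M"

lemma emb_kron:
  fixes M :: "'a::ring_1 mat"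
  shows "M \<in> carrier_mat 2 2 \<Longrightarrow> emb all_idx i2 all_idx i2 (M \<otimes>\<^sub>K 1\<^sub>m 2) = leg1 (kop M)"
    "M \<in> carrier_mat 2 2 \<Longrightarrow> emb all_idx i2 all_idx i2 (1\<^sub>m 2 \<otimes>\<^sub>K M) = leg2 (kop M)"
    by (rule op_eqI2; auto simp: emb_def idx_defs kron_def kop_def leg1_def leg2_def)+

lemma emb_kron3:
  fixes M N :: "'a::ring_1 mat"
  shows "M \<in> carrier_mat 2 2 \<Longrightarrow> emb v6 i6 v6 i6 (M \<otimes>\<^sub>K 1\<^sub>m 3) = e1 (kop M) * e23 (emb v3 wt2 v3 wt2 (1\<^sub>m 3))"
    "N \<in> carrier_mat 3 3 \<Longrightarrow> emb v6 i6 v6 i6 (1\<^sub>m 2 \<otimes>\<^sub>K N) = e23 (emb v3 wt2 v3 wt2 N)"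
proof -
  show "emb v6 i6 v6 i6 (M \<otimes>\<^sub>K 1\<^sub>m 3) = e1 (kop M) * e23 (emb v3 wt2 v3 wt2 (1\<^sub>m 3))" if "M \<in> carrier_mat 2 2"
    apply (rule op_eqI3)
    subgoal for a b c d e f
    using that by (cases a; cases b; cases c; cases d; cases e; cases f;
       simp add: emb_def idx_defs kron_def kop_def legs(1)[symmetric] leg1_def e_defs ent_mult sum_bool3)
    done
  show "emb v6 i6 v6 i6 (1\<^sub>m 2 \<otimes>\<^sub>K N) = e23 (emb v3 wt2 v3 wt2 N)" if "N \<in> carrier_mat 3 3"
    apply (rule op_eqI3)
    subgoal for a b c d e f
    using that by (cases a; cases b; cases c; cases d; cases e; cases f;
       simp add: emb_def idx_defs kron_def e_defs numeral_2_eq_2[symmetric])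
    done
qed

section \<open>Fused operators as compressions of spin 1/2 products\<close>

context qroot
begin
definition R2hat where "R2hat x = emb v6 i6 v6 i6 (R_mat s 2 x)"

lemma cE2: "cop E2 = Op (\<lambda>(a, b) (c, d). if \<not> a \<and> \<not> b \<and> \<not> c \<and> \<not> d \<or> a \<and> b \<and> c \<and> d then 1
   else if a \<noteq> b \<and> \<not> c \<and> d then inverse \<rho> else 0)"
  by (rule op_eqI2) (simp add: E2 \<rho>_def fls_inverse_const divide_inverse)

lemma ent_R2hat: "ent (R2hat x) (a, b, c) (a', b', c') = cc (x * S) * (
   if \<not> v6 (a, b, c) \<or> \<not> v6 (a', b', c') then 0
   else if a = a' \<and> b = b' \<and> c = c' then
     (if a = b \<and> b = c then x * (S * S * S) - inverse x * inverse (S * S * S)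
      else if b \<noteq> c then x * S - inverse x * inverse S else x * inverse S - inverse x * S)
   else if a \<noteq> a' \<and> ((\<not> a \<and> wt2 (b, c) = wt2 (b', c') + 1) \<or> (a \<and> wt2 (b, c) + 1 = wt2 (b', c'))) then cc q * \<rho> else 0)"
  by (simp only: R2hat_def R2 ent_dg_mult ent_Op prod.case)

text \<open>Fusion of the R-matrix: on symmetric tensors of legs 2 and 3, R12 R13 at parameters with
  ratio q is the spin 1 R-matrix. Its prefactor makes this exact, without a further scalar.\<close>

lemma R12_13:
  assumes x: "x \<noteq> 0"
  shows "e23 (cop E2) * R2hat x = e12 (Rm q (x * inverse S)) * (e13 (Rm q (x * S)) * e23 (cop E2))"
proof -
  have \<rho>\<rho>: "\<rho> * \<rho> = (S * S * S * S + 1) / (S * S)" "\<rho> * (\<rho> * y) = (S * S * S * S + 1) / (S * S) * y" for y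
    using S by (simp_all add: field_simps)
  show ?thesis
  apply (rule op_eqI3)
  subgoal for a b c d e f
    by ((cases a; cases b; cases c; cases d; cases e; cases f),
      simp_all add: ent_mult sum_bool3 ent_R2hat cE2 e_defs Rm_def idx_defs, simp_all add: cc_def field_simps x S(1,2,4),
      (simp_all add: \<rho>\<rho>)?, (simp_all add: field_simps x S(1,4))?)
  done
qed

lemma fused1:
  assumes "K x \<in> carrier_mat 2 2"
  shows "fused_K s K 1 x = K x"
proof -
  have F: "F_mat qc 1 = 1\<^sub>m 2" "E_mat qc 1 = 1\<^sub>m 2"
    by (rule eq_matI; auto simp: F_mat_def E_mat_def mat1_def E_entry_def E_diag_def less_Suc_eq numeral_2_eq_2 qint
         Bq Bq[simplified])+
  have k: "K x \<otimes>\<^sub>K 1\<^sub>m (Suc 0) = K x" "(1\<^sub>m 2 :: 'a fls mat) \<otimes>\<^sub>K 1\<^sub>m 1 = 1\<^sub>m 2"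
    using assms by (auto intro!: eq_matI simp: kron_def)
  have l: "lift_mat (const_mat (1\<^sub>m 2)) = (1\<^sub>m 2 :: 'a fls mat)" "lift_mat (1\<^sub>m 2) = (1\<^sub>m 2 :: 'a fls mat)"
    by (auto intro!: eq_matI)
  show ?thesis
    using assms by (simp add: s F k l R_mat_def qpw(1)) (simp add: F[simplified] k[simplified] l)
qed

lemma fused2:
  fixes K :: "complex fls \<Rightarrow> 'a::complex_alg_1 fls mat"
  assumes K: "\<And>y. K y \<in> carrier_mat 2 2"
  shows "emb v3 wt2 v3 wt2 (fused_K s K 2 x) = lop (cop F2) * leg1 (kop (K (x * qpw s (-1)))) * lop (Rm q (x\<^sup>2))
    * leg2 (kop (K (x * qpw s 1))) * lop (cop E2)"
proof -
  have "fused_K s K 2 x = lift_mat (const_mat (F_mat qc 2)) * (K (x * qpw s (-1)) \<otimes>\<^sub>K 1\<^sub>m 2) * lift_mat (R_mat s 1 (x\<^sup>2))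
      * (1\<^sub>m 2 \<otimes>\<^sub>K K (x * qpw s 1)) * lift_mat (const_mat (E_mat qc 2))"
  proof -
    have "fused_K s K (Suc 1) x = lift_mat (const_mat (F_mat (s\<^sup>2) (Suc 1))) * (K (x * qpw s (- int 1)) \<otimes>\<^sub>K 1\<^sub>m (Suc 1))
      * lift_mat (R_mat s 1 (x\<^sup>2 * qpw s (1 - int 1))) * (1\<^sub>m 2 \<otimes>\<^sub>K K (x * qpw s 1)) * lift_mat (const_mat (E_mat (s\<^sup>2) (Suc 1)))"
      by (simp only: fused_K.simps(2) fused1[OF K])
    then show ?thesis
      by (simp only: s Suc_1 of_nat_1 diff_self qpw(1) mult_1_right)
  qed
  also have "emb v3 wt2 v3 wt2 \<dots> = emb v3 wt2 all_idx i2 (lift_mat (const_mat (F_mat qc 2)))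
     * emb all_idx i2 all_idx i2 (K (x * qpw s (-1)) \<otimes>\<^sub>K 1\<^sub>m 2) * emb all_idx i2 all_idx i2 (lift_mat (R_mat s 1 (x\<^sup>2)))
     * emb all_idx i2 all_idx i2 (1\<^sub>m 2 \<otimes>\<^sub>K K (x * qpw s 1)) * emb all_idx i2 v3 wt2 (lift_mat (const_mat (E_mat qc 2)))"
    using kron_carrier[OF K one_carrier_mat, of "x * qpw s (-1)" 2] kron_carrier[OF one_carrier_mat[of 2] K, of "x * qpw s 1"]
    by (intro emb5[where m = 4 and r = 3]) (simp_all add: EF_carriers R_mat_carriers bij_i2 idx_less del: One_nat_def)
  also have "emb v3 wt2 all_idx i2 (lift_mat (const_mat (F_mat qc 2))) = lop (cop F2)"
    unfolding F2_def by (simp add: emb_lift[where r = 3 and c = 4] emb_const[where r = 3 and c = 4] EF_carriers idx_less)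
  also have "emb all_idx i2 v3 wt2 (lift_mat (const_mat (E_mat qc 2))) = lop (cop E2)"
    unfolding E2_def by (simp add: emb_lift[where r = 4 and c = 3] emb_const[where r = 4 and c = 3] EF_carriers idx_less)
  also have "emb all_idx i2 all_idx i2 (lift_mat (R_mat s 1 (x\<^sup>2))) = lop (Rm q (x\<^sup>2))"
    by (simp add: emb_lift[where r = 4 and c = 4] R1[symmetric] R_mat_carriers idx_less del: One_nat_def)
  finally show ?thesis
    by (simp add: emb_kron K)
qed

lemma fused3:
  fixes K :: "complex fls \<Rightarrow> 'a::complex_alg_1 fls mat"
  assumes K: "\<And>y. K y \<in> carrier_mat 2 2"
  shows "emb v4 wt3 v4 wt3 (fused_K s K 3 x) = lop (cop F3) * (e1 (kop (K (x * qpw s (-2)))) * e23 (lop (cop J3)))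
    * lop (R2hat (x\<^sup>2 * qpw s (-1))) * e23 (emb v3 wt2 v3 wt2 (fused_K s K 2 (x * qpw s 1))) * lop (cop E3)"
proof -
  have "fused_K s K 3 x = lift_mat (const_mat (F_mat qc 3)) * (K (x * qpw s (-2)) \<otimes>\<^sub>K 1\<^sub>m 3) * lift_mat (R_mat s 2 (x\<^sup>2 * qpw s (-1)))
      * (1\<^sub>m 2 \<otimes>\<^sub>K fused_K s K 2 (x * qpw s 1)) * lift_mat (const_mat (E_mat qc 3))"
  proof -
    have "fused_K s K (Suc 2) x = lift_mat (const_mat (F_mat (s\<^sup>2) (Suc 2))) * (K (x * qpw s (- int 2)) \<otimes>\<^sub>K 1\<^sub>m (Suc 2))
      * lift_mat (R_mat s 2 (x\<^sup>2 * qpw s (1 - int 2))) * (1\<^sub>m 2 \<otimes>\<^sub>K fused_K s K 2 (x * qpw s 1)) * lift_mat (const_mat (E_mat (s\<^sup>2) (Suc 2)))"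
      by (simp only: fused_K.simps(2))
    moreover have "Suc 2 = 3" "1 - int 2 = -1" "- int 2 = -2" by simp_all
    ultimately show ?thesis
      by (simp only: s)
  qed
  also have "emb v4 wt3 v4 wt3 \<dots> = emb v4 wt3 v6 i6 (lift_mat (const_mat (F_mat qc 3)))
     * emb v6 i6 v6 i6 (K (x * qpw s (-2)) \<otimes>\<^sub>K 1\<^sub>m 3) * emb v6 i6 v6 i6 (lift_mat (R_mat s 2 (x\<^sup>2 * qpw s (-1))))
     * emb v6 i6 v6 i6 (1\<^sub>m 2 \<otimes>\<^sub>K fused_K s K 2 (x * qpw s 1)) * emb v6 i6 v4 wt3 (lift_mat (const_mat (E_mat qc 3)))"
    using kron_carrier[OF K one_carrier_mat, of "x * qpw s (-2)" 3] kron_carrier[OF one_carrier_mat[of 2] fused_carrier, of s K 2 "x * qpw s 1"]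
    by (intro emb5[where m = 6 and r = 4]) (simp_all add: EF_carriers R_mat_carriers bij_i6 idx_less)
  also have "emb v4 wt3 v6 i6 (lift_mat (const_mat (F_mat qc 3))) = lop (cop F3)"
    unfolding F3_def by (simp add: emb_lift[where r = 4 and c = 6] emb_const[where r = 4 and c = 6] EF_carriers idx_less)
  also have "emb v6 i6 v4 wt3 (lift_mat (const_mat (E_mat qc 3))) = lop (cop E3)"
    unfolding E3_def by (simp add: emb_lift[where r = 6 and c = 4] emb_const[where r = 6 and c = 4] EF_carriers idx_less)
  also have "emb v6 i6 v6 i6 (lift_mat (R_mat s 2 (x\<^sup>2 * qpw s (-1)))) = lop (R2hat (x\<^sup>2 * qpw s (-1)))"
    unfolding R2hat_def by (simp add: emb_lift[where r = 6 and c = 6] R_mat_carriers idx_less)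
  also have "emb v6 i6 v6 i6 (1\<^sub>m 2 \<otimes>\<^sub>K fused_K s K 2 (x * qpw s 1)) = e23 (emb v3 wt2 v3 wt2 (fused_K s K 2 (x * qpw s 1)))"
    using fused_carrier[of s K 2] by (intro emb_kron3) (simp add: numeral_3_eq_3 numeral_2_eq_2)
  also have "emb v6 i6 v6 i6 (K (x * qpw s (-2)) \<otimes>\<^sub>K 1\<^sub>m 3) = e1 (kop (K (x * qpw s (-2)))) * e23 (emb v3 wt2 v3 wt2 (1\<^sub>m 3))"
    using K by (intro emb_kron3)
  also have "emb v3 wt2 v3 wt2 (1\<^sub>m 3 :: 'a fls mat) = lop (cop J3)"
    by (rule op_eqI2) (auto simp: emb_def J3_def idx_defs split: if_splits)
  finally show ?thesis .
qed

lemma q_facts: "cc q \<noteq> 0" "cc (q\<^sup>2) \<noteq> 0" "cc (q^3) \<noteq> 0" "q + inverse q \<noteq> 0" "q3 q \<noteq> 0"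
  "q + inverse q = fls_const two" "q3 q = fls_const three"
proof -
  have nc: "fls_const a \<noteq> (0 :: complex fls)" if "a \<noteq> 0" for a :: complex
    using that by simp
  have ccq: "cc (q ^ m) \<noteq> 0" if "m > 0" for m :: nat
  proof
    assume "cc (q ^ m) = 0"
    then have "q ^ m * q ^ m = 1"
      using q(2) by (simp add: cc_def field_simps)
    then have "fls_const (qc ^ (2 * m)) = fls_const 1"
      by (simp add: q(1) fls_const_power[symmetric] mult_2 power_add)
    then have "qc ^ (2 * m) = 1"
      using arg_cong[of _ _ "\<lambda>f. fls_nth f 0"] by fastforce
    then show False
      using root[of "2 * m"] that by simp
  qed
  show "cc q \<noteq> 0" "cc (q\<^sup>2) \<noteq> 0" "cc (q^3) \<noteq> 0"
    using ccq[of 1] ccq[of 2] ccq[of 3] by simp_all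
  show t: "q + inverse q = fls_const two" "q3 q = fls_const three"
    by (simp_all add: q(1) q3_def two_def three_def fls_inverse_const fls_const_power[symmetric] fls_plus_const[symmetric] del: fls_const_power)
  show "q + inverse q \<noteq> 0" "q3 q \<noteq> 0"
    unfolding t using nz nc by blast+
qed

lemma cop_Ds: "cop (D2c (1/2)) = D2 (1/2)" "cop (D3c (1/3)) = D3 (1/3)" "cop (D2c (1 / two)) = D2 (inverse (q + inverse q))"
  "cop (D2c (two / 4)) = D2 ((q + inverse q) / 4)" "cop (D3c (1 / three)) = D3 (inverse (q3 q))"
  "cop (D3c (three / 9)) = D3 (q3 q / 9)"
  by (simp_all add: cop_D q_facts fls_const_divide_const[symmetric] fls_inverse_const inverse_eq_divide[of three] inverse_eq_divide[of two])

lemma cop_tp: "cop (tp A) = tp (cop A)"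
  by (rule op_eqI) (simp add: tp_def)

lemma Pm_E2: "Pm * cop E2 = 0"
  unfolding cE2 by (rule op_eqI2, case_tac i1; case_tac i2; case_tac j1; case_tac j2; simp add: ent_mult sum_bool2 Pm_def)

lemma P_E8: "e12 Pm * cop E8 = 0" "e23 Pm * cop E8 = 0"
  by (rule op_eqI3, case_tac i1; case_tac i2; case_tac i3; case_tac j1; case_tac j2; case_tac j3;
    simp add: ent_mult sum_bool3 Pm_def e_defs E8_def idx_defs)+

text \<open>The product \<open>M\<close> preserves the image of the fusion map: E F is 1 -
  \<open>Pm\<close>, and \<open>Pm * M\<close> is a multiple of \<open>Pm\<close>, which vanishes on
  that image.\<close>

lemma E2_fused2:
  fixes K :: "complex fls \<Rightarrow> 'a::complex_alg_1 fls mat"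
  assumes K: "\<And>y. K y \<in> carrier_mat 2 2" and x: "x \<noteq> 0"
    and re: "refl_eq q (x * qpw s (-1)) (x * qpw s 1) (kop (K (x * qpw s (-1)))) (kop (K (x * qpw s 1)))"
  shows "lop (cop E2) * emb v3 wt2 v3 wt2 (fused_K s K 2 x) =
    leg1 (kop (K (x * qpw s (-1)))) * lop (Rm q (x\<^sup>2)) * leg2 (kop (K (x * qpw s 1))) * lop (cop E2)"
proof -
  define M where "M = leg1 (kop (K (x * qpw s (-1)))) * lop (Rm q (x\<^sup>2)) * leg2 (kop (K (x * qpw s 1)))"
  have y: "x * qpw s 1 = x * qpw s (-1) * q" "x\<^sup>2 = x * qpw s (-1) * (x * qpw s (-1) * q)"
    using S(1) by (simp_all add: qpw S(2) power2_eq_square field_simps)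
  have PM: "lop Pm * M = dg (qdet q (x\<^sup>2) (kop (K (x * qpw s (-1)))) (kop (K (x * qpw s 1)))) * lop Pm"
    unfolding M_def y(2) using Pm_qdet[OF q(2) q_facts(1) _ re[unfolded y(1)]] x S
    by (simp add: qpw y(1)[unfolded qpw])
  have "lop (cop E2) * emb v3 wt2 v3 wt2 (fused_K s K 2 x) = lop (cop (E2 * F2)) * (M * lop (cop E2))"
    by (simp only: fused2[OF K] M_def lop_mult cop_mult mult.assoc)
  also have "cop (E2 * F2) = 1 - Pm"
    using D2_half by (simp add: F2_E2 cop_Ds eq_diff_eq)
  also have "lop (1 - Pm) * (M * lop (cop E2)) = M * lop (cop E2) - (lop Pm * M) * lop (cop E2)"
    by (simp add: lop_diff left_diff_distrib mult.assoc)
  also have "(lop Pm * M) * lop (cop E2) = 0"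
    by (simp only: PM mult.assoc lop_mult[symmetric] Pm_E2 lop_0 mult_zero_right)
  finally show ?thesis
    by (simp add: M_def)
qed

definition mono3 where "mono3 a b c A B C = e1 A * (lop (e12 (Rm q (a * b))) * (e2 B * (lop (e13 (Rm q (a * c))) * (lop (e23 (Rm q (b * c))) * e3 C))))"

text \<open>The recursion uses \<open>F3\<close> and \<open>F2\<close>, whereas the trace needs the
  symmetric left inverse \<open>F8\<close>. Both give the same compression because the ordered
  product maps symmetric tensors to symmetric tensors.\<close>

lemma fused3_mono:
  fixes K :: "complex fls \<Rightarrow> 'a::complex_alg_1 fls mat"
  assumes K: "\<And>y. K y \<in> carrier_mat 2 2" and x: "x \<noteq> 0"
  defines "a \<equiv> x * qpw s (-2)" and "b \<equiv> x" and "c \<equiv> x * qpw s 2"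
  assumes re: "refl_eq q a b (kop (K a)) (kop (K b))" "refl_eq q b c (kop (K b)) (kop (K c))"
  shows "emb v4 wt3 v4 wt3 (fused_K s K 3 x) = lop (cop F8) * (mono3 a b c (kop (K a)) (kop (K b)) (kop (K c)) * lop (cop E8))"
proof -
  define K1 K2 K3 s12 s13 s23 P12 P23 EE T3 R Mt E8' F8' F3' J6 J4' N:: "(bool \<times> bool \<times> bool, 'a fls) op" where
    d: "K1 = e1 (kop (K a))" "K2 = e2 (kop (K b))" "K3 = e3 (kop (K c))" "s12 = lop (e12 (Rm q (a * b)))"
      "s13 = lop (e13 (Rm q (a * c)))" "s23 = lop (e23 (Rm q (b * c)))" "P12 = lop (e12 Pm)" "P23 = lop (e23 Pm)"
      "EE = lop (e23 (cop E2))" "T3 = lop (cop E3)" "R = lop (R2hat (x\<^sup>2 * qpw s (-1)))"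
      "Mt = mono3 a b c (kop (K a)) (kop (K b)) (kop (K c))" "E8' = lop (cop E8)" "F8' = lop (cop F8)" "F3' = lop (cop F3)"
      "J6 = e23 (lop (cop J3))" "J4' = lop (cop J4)" "N = e23 (emb v3 wt2 v3 wt2 (fused_K s K 2 (x * qpw s 1)))"
  have e23_cop: "e23 (cop A) = cop (e23 A)" for A
    by (rule op_eqI3) (simp add: e_defs)
  have bq: "b = a * q" "c = b * q" "a \<noteq> 0" "b \<noteq> 0"
    using S(1) x by (simp_all add: a_def b_def c_def qpw S(2) field_simps)
  have ab: "a * b = x\<^sup>2 * qpw s (-1) * inverse S" "a * c = x\<^sup>2 * qpw s (-1) * S" "b * c = (x * qpw s 1)\<^sup>2"
    "x * qpw s 1 * qpw s (-1) = b" "x * qpw s 1 * qpw s 1 = c"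
    using S(1) by (simp_all add: a_def b_def c_def qpw S(2) power2_eq_square field_simps)
  have f3: "emb v4 wt3 v4 wt3 (fused_K s K 3 x) = F3' * (K1 * J6) * R * N * T3"
    by (simp only: fused3[OF K] d a_def)
  have E8: "E8' = EE * T3"
    by (simp only: d lop_mult[symmetric] e23_cop cop_mult[symmetric] E8)
  have JEE: "EE * J6 = EE" "J6 * R = R"
  proof -
    have "E2 * J3 = E2"
      unfolding E2 J3_def by (rule op_eqI2, case_tac i1; case_tac i2; case_tac j1; case_tac j2; simp add: ent_mult sum_bool2 idx_defs)
    then show "EE * J6 = EE"
      by (simp only: d e_lop lop_mult[symmetric] e_mult[symmetric] cop_mult[symmetric])
    have "e23 J3 = Op (\<lambda>i j. if i = j \<and> v6 i then 1 else 0)"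
      by (rule op_eqI3) (auto simp: e_defs J3_def idx_defs)
    then have "cop (e23 J3) * R2hat w = R2hat w" for w
      by (intro op_eqI) (auto simp: R2hat_def emb_def ent_mult if_distrib[of "\<lambda>x. x * _"] if_distrib[of fls_const] cong: if_cong)
    then show "J6 * R = R"
      by (simp only: d e_lop lop_mult[symmetric] e23_cop)
  qed
  have K1c: "K1 * EE = EE * K1" "K1 * J6 = J6 * K1" "K2 * s13 = s13 * K2"
    by (simp_all only: d e_commute e_commute[unfolded e_lop])
  have RR: "EE * R = s12 * s13 * EE"
    using R12_13[of "x\<^sup>2 * qpw s (-1)"] x S by (simp add: d lop_mult[symmetric] ab qpw mult.assoc)
  have EN: "EE * N = K2 * s23 * K3 * EE"
  proof -
    have x1: "x * qpw s 1 \<noteq> 0"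
      using x S(1) by (simp add: qpw)
    have "refl_eq q (x * qpw s 1 * qpw s (-1)) (x * qpw s 1 * qpw s 1)
        (kop (K (x * qpw s 1 * qpw s (-1)))) (kop (K (x * qpw s 1 * qpw s 1)))"
      by (simp only: ab(4,5) re(2))
    from E2_fused2[OF K x1 this]
    have "lop (cop E2) * emb v3 wt2 v3 wt2 (fused_K s K 2 (x * qpw s 1)) =
        leg1 (kop (K b)) * lop (Rm q (b * c)) * leg2 (kop (K c)) * lop (cop E2)"
      by (simp only: ab(4,5) ab(3)[symmetric])
    from arg_cong[OF this, of e23] show ?thesis
      by (simp only: d e_mult e_lop legs mult.assoc)
  qed
  \<comment> \<open>Moving the spin 1 fusion map of legs 2 and 3 from left to right replaces every
    spin 1 factor by its two spin 1/2 factors.\<close>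
  have EZ: "EE * (K1 * J6 * R * N) = Mt * EE"
  proof -
    have "EE * (K1 * J6 * R * N) = K1 * (EE * R * N)"
      by (simp only: mult.assoc JEE K1c(1)[symmetric, THEN assoc2] JEE[THEN assoc21])
    also have "\<dots> = K1 * (s12 * (s13 * (EE * N)))"
      by (simp only: RR mult.assoc)
    also have "\<dots> = Mt * EE"
      by (simp only: EN mult.assoc d(12) mono3_def d(1-6)[symmetric] K1c(3)[symmetric, THEN assoc2])
    finally show ?thesis .
  qed
  have S3: "E8' * F8' = 1 - lop V12 * P12 - lop V23 * P23"
  proof -
    have "cop (E8 * F8) = 1 - V12 * e12 Pm - V23 * e23 Pm"
      using D3_third by (simp add: F8_E8 cop_Ds algebra_simps)
    then show ?thesis
      by (simp only: d lop_mult[symmetric] cop_mult[symmetric] lop_diff lop_1)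
  qed
  have P12Mt: "P12 * Mt = dg (qdet q (a * b) (kop (K a)) (kop (K b))) * (lop (dg (cc (a * c) * cc (a * c * q\<^sup>2))) * (K3 * P12))"
  proof -
    have PM: "P12 * K1 * s12 * K2 = dg (qdet q (a * b) (kop (K a)) (kop (K b))) * P12"
      using arg_cong[OF Pm_qdet[OF q(2) q_facts(1) bq(3)], of "kop (K a)" "kop (K b)" e12] re bq
      by (simp add: d e_mult e_lop e_dg legs mult.assoc)
    have Ps: "P12 * s13 * s23 = lop (dg (cc (a * c) * cc (a * c * q\<^sup>2))) * P12"
    proof -
      have "b * c = a * c * q" "a * c \<noteq> 0" using bq q(2) by simp_all
      then show ?thesis
        using Pm_12_13[of q "a * c"] q(2) by (simp only: d lop_mult[symmetric]) simp
    qed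
    have c: "P12 * K3 = K3 * P12"
      by (simp only: d e_commute[unfolded e_lop])
    show ?thesis
      by (simp only: d(12) mono3_def d(1-6)[symmetric] PM[THEN assoc42] Ps[THEN assoc32] c)
  qed
  have P23Mt: "P23 * Mt = K1 * (lop (dg (cc (a * b) * cc (a * b * q\<^sup>2))) * (dg (qdet q (b * c) (kop (K b)) (kop (K c))) * P23))"
  proof -
    have PM: "P23 * K2 * s23 * K3 = dg (qdet q (b * c) (kop (K b)) (kop (K c))) * P23"
      using arg_cong[OF Pm_qdet[OF q(2) q_facts(1) bq(4)], of "kop (K b)" "kop (K c)" e23] re bq
      by (simp add: d e_mult e_lop e_dg legs mult.assoc)
    have Ps: "P23 * s12 * s13 = lop (dg (cc (a * b) * cc (a * b * q\<^sup>2))) * P23"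
    proof -
      have "a * c = a * b * q" "a * b \<noteq> 0" using bq q(2) by simp_all
      then show ?thesis
        using Pm_23_12[of q "a * b"] q(2) by (simp only: d lop_mult[symmetric]) simp
    qed
    have c: "P23 * K1 = K1 * P23"
      by (simp only: d e_commute[unfolded e_lop])
    show ?thesis
      by (simp only: d(12) mono3_def d(1-6)[symmetric] K1c(3)[THEN assoc2] c[THEN assoc2] Ps[THEN assoc32] PM[unfolded mult.assoc])
  qed
  have z: "P12 * E8' = 0" "P23 * E8' = 0"
    by (simp_all only: d lop_mult[symmetric] P_E8 lop_0)
  \<comment> \<open>This is the claimed compression. As \<open>E8' * F8'\<close> is the symmetrizer
    and both antisymmetrizers annihilate \<open>Mt * E8'\<close>, applying \<open>E8'\<close> to it
    recovers \<open>Mt * E8'\<close>.\<close>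
  define Y :: "(bool \<times> bool \<times> bool, 'a fls) op" where "Y = F8' * (Mt * E8')"
  have ME: "Mt * E8' = E8' * Y"
  proof -
    have "E8' * Y = (E8' * F8') * Mt * E8'"
      by (simp only: Y_def mult.assoc)
    also have "\<dots> = Mt * E8' - lop V12 * (P12 * Mt * E8') - lop V23 * (P23 * Mt * E8')"
      by (simp only: S3 left_diff_distrib mult.assoc mult_1)
    also have "P12 * Mt * E8' = 0" by (simp only: P12Mt mult.assoc z mult_zero_right)
    also have "P23 * Mt * E8' = 0" by (simp only: P23Mt mult.assoc z mult_zero_right)
    finally show ?thesis by simp
  qed
  define FE :: "(bool \<times> bool \<times> bool, 'a fls) op" where "FE = lop (e23 (cop F2))"
  have FE: "FE * EE = J6"
    by (simp only: FE_def d e_lop lop_mult[symmetric] e_mult[symmetric] cop_mult[symmetric] F2_E2)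
  have JT: "J6 * T3 = T3"
  proof -
    have "e23 J3 * E3 = E3"
      unfolding E3 J3_def by (rule op_eqI3, case_tac i1; case_tac i2; case_tac i3; case_tac j1; case_tac j2; case_tac j3;
        simp add: ent_mult sum_bool3 idx_defs e_defs)
    then show ?thesis
      by (simp only: d e_lop lop_mult[symmetric] e23_cop cop_mult[symmetric])
  qed
  \<comment> \<open>The left inverse \<open>FE\<close> strips the spin 1 fusion map again, leaving
    only the outer map \<open>T3\<close>, which \<open>F3'\<close> can invert.\<close>
  have "J6 * (K1 * J6 * R * N * T3) = T3 * Y"
  proof -
    have "J6 * (K1 * J6 * R * N * T3) = FE * (EE * (K1 * J6 * R * N)) * T3"
      by (simp only: FE[symmetric] mult.assoc)
    also have "\<dots> = FE * (Mt * EE) * T3"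
      by (simp only: EZ)
    also have "\<dots> = FE * (Mt * E8')"
      by (simp only: E8 mult.assoc)
    also have "\<dots> = FE * (E8' * Y)"
      by (simp only: ME)
    also have "\<dots> = (FE * EE) * T3 * Y"
      by (simp only: E8 mult.assoc)
    finally show ?thesis by (simp only: FE JT)
  qed
  moreover have "J6 * (K1 * J6 * R * N * T3) = K1 * J6 * R * N * T3"
  proof -
    have JJ: "J6 * J6 = J6"
    proof -
      have "J3 * J3 = J3"
        unfolding J3_def by (rule op_eqI2, case_tac i1; case_tac i2; case_tac j1; case_tac j2; simp add: ent_mult sum_bool2 idx_defs)
      then show ?thesis by (simp only: d lop_mult[symmetric] e_mult[symmetric] cop_mult[symmetric])
    qed
    show ?thesis
      by (simp only: mult.assoc K1c(2)[THEN assoc2] JJ[THEN assoc21])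
  qed
  ultimately have ZT: "K1 * J6 * R * N * T3 = T3 * Y" by simp
  have "F3' * (K1 * J6) * R * N * T3 = (F3' * T3) * Y"
    using ZT by (simp only: mult.assoc)
  also have "F3' * T3 = J4'"
    by (simp only: d lop_mult[symmetric] cop_mult[symmetric] F3_E3)
  also have "J4' * Y = Y"
    by (simp only: Y_def mult.assoc[symmetric] d lop_mult[symmetric] cop_mult[symmetric] F8_E8(5))
  finally show ?thesis
    by (simp only: f3 Y_def d)
qed
end

lemma mtrace_tr:
  fixes d :: "'n::finite \<Rightarrow> nat"
  assumes "M \<in> carrier_mat n n" "bij_betw d (Collect v) {..<n}"
  shows "mtrace M = tr (emb v d v d M)"
proof -
  have "mtrace M = (\<Sum>i\<in>Collect v. M $$ (d i, d i))"
    using assms(1) by (simp add: mtrace_def sum.reindex_bij_betw[OF assms(2), symmetric])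
  also have "\<dots> = tr (emb v d v d M)"
    unfolding tr_def by (rule sum.mono_neutral_cong_left) (auto simp: emb_def)
  finally show ?thesis .
qed

lemma bij_i1: "bij_betw i1 (Collect all_idx) {..<2}"
proof (rule bij_betwI')
  fix y :: nat assume "y \<in> {..<2}"
  then have "y = i1 False \<or> y = i1 True"
    by (auto simp: i1_def)
  then show "\<exists>x\<in>Collect all_idx. y = i1 x"
    by (elim disjE) (rule bexI, assumption, simp add: all_idx_def)+
qed (auto simp: idx_defs)

lemma kop_mat: "kop (mat_of_rows_list 2 [[a, b], [c, d]]) = mk2 a b c d"
  by (rule op_eqI) (auto simp: kop_def emb_def idx_defs mat_of_rows_list_def mk2_def)
lemma tp_mk2: "tp (mk2 a b c d) = mk2 a c b d"
  by (rule op_eqI) (auto simp: tp_def mk2_def)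
lemma tp_kop: "tp (kop (K_scal s e e' h h' x)) = kop (K_scal s e e' h' h x)"
  by (simp add: K_scal_def Let_def kop_mat tp_mk2)
lemma K_scal_carrier: "K_scal s e e' h h' x \<in> carrier_mat 2 2"
  by (intro carrier_matI) (simp_all add: K_scal_def Let_def mat_of_rows_list_def)

lemma f_norm_1: "f_norm s 1 x = 1"
  by (simp add: f_norm_def)

context qroot
begin

lemma refl_eq_K_scal:
  assumes "x \<noteq> 0" "y \<noteq> 0"
  shows "refl_eq q x y (kop (K_scal s e e' h h' x)) (kop (K_scal s e e' h h' y) :: (bool, complex fls) op)"
proof -
  define v where "v = q - inverse q"
  have v: "v \<noteq> 0" "q - inverse q = v" using q_facts(1) by (simp_all add: cc_def v_def)
  \<comment> \<open>The symbol \<open>v\<close> is both \<open>cc q\<close> and a denominator, so it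
    is kept; powers of q are reduced by q^2 = q v + 1.\<close>
  have vq: "q * (q * w) = q * (v * w) + w" "q * q = q * v + 1" for w
    using q(2) by (simp_all add: v_def field_simps)
  note ac = mult.assoc mult.commute mult.left_commute add.assoc add.commute add.left_commute
  define d1 where "d1 = cc (x\<^sup>2) / v"
  define d2 where "d2 = cc (y\<^sup>2) / v"
  have cd: "cc q = v" "cc (x\<^sup>2) = d1 * v" "cc (y\<^sup>2) = d2 * v"
    using v by (simp_all add: d1_def d2_def cc_def)
  have K: "kop (K_scal s e e' h h' x) = mk2 (x * fls_const e + inverse x * fls_const e') (fls_const h * d1)
      (fls_const h' * d1) (x * fls_const e' + inverse x * fls_const e)"
    "kop (K_scal s e e' h h' y) = mk2 (y * fls_const e + inverse y * fls_const e') (fls_const h * d2)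
      (fls_const h' * d2) (y * fls_const e' + inverse y * fls_const e)"
    by (simp_all add: K_scal_def Let_def kop_mat qpw v d1_def d2_def)
  define E E' H H' where "E = fls_const e" "E' = fls_const e'" "H = fls_const h" "H' = fls_const h'"
  show ?thesis
    unfolding refl_eq_def lop_complex K E_E'_H_H'_def[symmetric]
    apply (rule op_eqI2)
    subgoal for a b c d
      by ((cases a; cases b; cases c; cases d), simp_all add: ent_mult sum_bool2 leg1_def leg2_def Rm_def cd(1),
        simp_all add: d1_def d2_def cc_def field_simps assms q(2) v(1) power2_eq_square,
        (simp_all only: ac vq distrib_left distrib_right mult_1_left mult_1_right)?)
    done
qed

text \<open>Identifies the closed formula for \<open>Gamma_plus\<close> with the quantum determinant
  of the dual K-matrix, in the form in which the antisymmetric terms produce it.\<close>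

lemma Gamma_plus_eq:
  assumes a: "a \<noteq> 0" and a': "a' = inverse a * inverse q" and b': "b' = inverse a * inverse q * inverse q"
  shows "tr (leg2 (kop (K_scal s em ep (- hp) (- hm) b')) * Rm q (a' * b') * leg1 (kop (K_scal s em ep (- hp) (- hm) a')) * Pm)
    = Gamma_plus s ep em hp hm a"
proof -
  define v where "v = q - inverse q"
  have v: "v \<noteq> 0" "q - inverse q = v" using q_facts(1) by (simp_all add: cc_def v_def)
  have vq: "q * (q * w) = q * (v * w) + w" "q * q = q * v + 1" for w
    using q(2) by (simp_all add: v_def field_simps)
  note ac = mult.assoc mult.commute mult.left_commute add.assoc add.commute add.left_commute
  have qm: "qpw s 4 = q * q" "qpw s (-4) = inverse (q * q)" "qpw s (-8) = inverse (q * q * q * q)"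
    using s0 by (simp_all add: q_def qpw_def fls_inverse_const power_int_minus power_add[symmetric])
  define E E' H H' where "E = fls_const ep" "E' = fls_const em" "H = fls_const hp" "H' = fls_const hm"
  have sq: "fls_const (ep\<^sup>2 + em\<^sup>2) = E * E + E' * E'" "fls_const (ep * em) = E * E'" "fls_const (hp * hm) = H * H'"
    by (simp_all add: E_E'_H_H'_def power2_eq_square fls_plus_const[symmetric])
  show ?thesis
    unfolding K_scal_def Gamma_plus_def Let_def kop_mat tr_def sum_bool2 sq qm qpw v a' b' fls_const_uminus E_E'_H_H'_def[symmetric]
    by (simp add: ent_mult sum_bool2 leg1_def leg2_def Rm_def Pm_def,
      simp add: cc_def field_simps a q(2) v(1) power2_eq_square,
      (simp only: ac vq distrib_left distrib_right mult_1_left mult_1_right)?)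
qed
end

subsection \<open>Recursions for the traces\<close>

text \<open>The origin of the weights: F^t F arises where the transposed compression meets the other
  one, E E^t where the trace closes.\<close>

lemma tr_sandwich:
  fixes M :: "('n::finite, 'a::complex_alg_1 fls) op"
  shows "tr (lop (tp (F * (m * E))) * (lop F * (M * lop E))) = tr (lop ((E * tp E) * tp m * (tp F * F)) * M)"
proof -
  have "tr (lop (tp (F * (m * E))) * (lop F * (M * lop E))) = tr ((lop (tp E * tp m * tp F) * (lop F * M)) * lop E)"
    by (simp only: tp_mult mult.assoc)
  also have "\<dots> = tr (lop E * (lop (tp E * tp m * tp F) * (lop F * M)))"
    by (rule tr_cyc[symmetric])
  also have "\<dots> = tr (lop ((E * tp E) * tp m * (tp F * F)) * M)"
    by (simp only: lop_mult mult.assoc)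
  finally show ?thesis .
qed

lemma lift_cancel: "c \<noteq> 0 \<Longrightarrow> lift_fls (1 / c) * (lift_fls (c * d) * z) = lift_fls d * z"
  and lift_divide: "lift_fls (1 / c) * (lift_fls d * z) = lift_fls (d / c) * z"
  by (simp_all add: mult.assoc[symmetric] lift_mult[symmetric])

context qroot
begin

context
  fixes K :: "complex fls \<Rightarrow> 'a::complex_alg_1 fls mat" and k :: "complex fls \<Rightarrow> complex fls mat"
  assumes K: "\<And>y. K y \<in> carrier_mat 2 2" and k: "\<And>y. k y \<in> carrier_mat 2 2"
    and rk': "\<forall>x y. x \<noteq> 0 \<longrightarrow> y \<noteq> 0 \<longrightarrow> refl_eq q x y (kop (k x)) (kop (k y))"
    and rkt': "\<forall>x y. x \<noteq> 0 \<longrightarrow> y \<noteq> 0 \<longrightarrow> refl_eq q x y (tp (kop (k x))) (tp (kop (k y)))"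
begin

lemmas rk = rk'[rule_format] and rkt = rkt'[rule_format]

definition kap where "kap x = tp (kop (k (inverse x * inverse q)))"
definition T where "T n x = mtrace (lift_mat ((1 / f_norm s n x) \<cdot>\<^sub>m transpose_mat (fused_K s k n (inverse x * qpw s (-2)))) * fused_K s K n x)"
definition gam where "gam x = tr (leg2 (kap (x * q)) * Rm q (inverse x * inverse q * (inverse x * inverse q * inverse q)) * leg1 (kap x) * Pm)"
definition Gam where "Gam x = qdet q (x * (x * q)) (kop (K x)) (kop (K (x * q)))"

lemma T0: "T 0 x = 1"
  by (simp add: T_def f_norm_def mtrace_def scalar_prod_def)

lemma T1: "T 1 x = tr (lop (kap x) * kop (K x))"
proof -
  have "T 1 x = mtrace (lift_mat (1 \<cdot>\<^sub>m transpose_mat (k (inverse x * qpw s (-2)))) * K x)"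
    by (simp only: T_def f_norm_1 fused1[OF K] fused1[OF k] div_by_1)
  also have "\<dots> = lift_fls 1 * tr (lop (tp (kop (k (inverse x * qpw s (-2))))) * kop (K x))"
    unfolding kop_def by (rule mtrace_emb[OF k K bij_i1])
  finally show ?thesis
    by (simp add: kap_def qpw)
qed

lemma T2:
  assumes x: "x \<noteq> 0" and re: "refl_eq q (x * inverse S) (x * S) (kop (K (x * inverse S))) (kop (K (x * S)))"
    and cr: "cross q (x\<^sup>2) \<noteq> 0"
  shows "T 2 x = T 1 (x * inverse S) * T 1 (x * S)
    - lift_fls (gam (x * inverse S) / cross q (x\<^sup>2)) * Gam (x * inverse S)"
proof -
  define a where "a = x * inverse S"
  define b where "b = x * S"
  define x' where "x' = inverse x * qpw s (-2)"
  define a' where "a' = inverse a * inverse q"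
  define b' where "b' = inverse b * inverse q"
  define m where "m = leg1 (kop (k b')) * Rm q (x'\<^sup>2) * leg2 (kop (k a'))"
  define M where "M = leg1 (kop (K a)) * lop (Rm q (x\<^sup>2)) * leg2 (kop (K b))"
  note Sx = S(1) x
  \<comment> \<open>Inversion reverses the order of the parameters: the dual product fused at
    \<open>x'\<close> has \<open>b'\<close> on leg 1 and \<open>a'\<close> on leg 2.\<close>
  have par: "b = a * q" "a \<noteq> 0" "b' \<noteq> 0" "a' = b' * q" "a' * b' = inverse (a * b * q\<^sup>2)" "a * b = x\<^sup>2" "x'\<^sup>2 = a' * b'"
    "x' * qpw s (-1) = b'" "x' * qpw s 1 = a'" "x * qpw s (-1) = a" "x * qpw s 1 = b"
    "inverse a * inverse q * (inverse a * inverse q * inverse q) = a' * b'" "a' \<noteq> 0"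
    using Sx by (simp_all add: a_def b_def a'_def b'_def x'_def qpw S(2) field_simps power2_eq_square)
  have f: "f_norm s 2 x = cross q (x\<^sup>2)"
  proof -
    have "f_norm s 2 x = cc (x\<^sup>2 * qpw s (2 * (1 + 1 + 2 - 2))) * cc (inverse (x\<^sup>2) * qpw s (2 * (-1 - 1 + 2)))"
      by (simp add: f_norm_def)
    moreover have "qpw s 4 = q * q"
      using s0 by (simp add: q_def qpw_def power_int_add[symmetric])
    ultimately show ?thesis
      by (simp add: cross_def qpw power2_eq_square)
  qed
  have em: "emb v3 wt2 v3 wt2 (fused_K s k 2 x') = cop F2 * (m * cop E2)"
    using fused2[where K = k and x = x', OF k] by (simp only: lop_complex par(8,9)) (simp only: m_def mult.assoc)
  have eM: "emb v3 wt2 v3 wt2 (fused_K s K 2 x) = lop (cop F2) * (M * lop (cop E2))"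
    using fused2[where K = K and x = x, OF K] by (simp only: par(10,11)) (simp only: M_def mult.assoc)
  have c3: "fused_K s K' 2 y \<in> carrier_mat 3 3" for K' y
    using fused_carrier[of s K' 2 y] by simp
  have "T 2 x = lift_fls (1 / f_norm s 2 x) * tr (lop (tp (cop F2 * (m * cop E2))) * (lop (cop F2) * (M * lop (cop E2))))"
    unfolding T_def x'_def[symmetric] by (subst mtrace_emb[OF _ _ bij_wt2]) (rule c3 c3 | simp only: em eM)+
  also have "tr (lop (tp (cop F2 * (m * cop E2))) * (lop (cop F2) * (M * lop (cop E2)))) =
      tr (lop (D2 (inverse (q + inverse q)) * tp m * D2 ((q + inverse q) / 4)) * M)"
    by (simp only: tr_sandwich cop_tp[symmetric] cop_mult[symmetric] F2_E2 cop_Ds)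
  also have "\<dots> = lift_fls (cross q (a * b)) * (tr (lop (kap a) * kop (K a)) * tr (lop (kap b) * kop (K b)))
     - lift_fls (tr (leg2 (kap b) * Rm q (a' * b') * leg1 (kap a) * Pm)) * qdet q (a * b) (kop (K a)) (kop (K b))"
  proof -
    have kt: "tp (kap a) = kop (k a')" "tp (kap b) = kop (k b')"
      by (simp_all add: kap_def a'_def b'_def)
    have mm: "m = leg1 (tp (kap b)) * Rm q (a' * b') * leg2 (tp (kap a))"
      by (simp only: m_def kt par(7))
    have re1: "refl_eq q a b (kop (K a)) (kop (K b))"
      using re by (simp only: a_def b_def)
    have re2: "refl_eq q a' b' (kap a) (kap b)"
      unfolding kap_def a'_def[symmetric] b'_def[symmetric] by (rule rkt) (rule par)+
    show ?thesis
      unfolding mm M_def par(6)[symmetric]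
      by (rule two_leg[OF q(2) q_facts(1,2,4) par(2,3,1,4,5) re1 re2])
  qed
  also have "tr (leg2 (kap b) * Rm q (a' * b') * leg1 (kap a) * Pm) = gam a"
    by (simp only: gam_def par(12) par(1)[symmetric])
  also have "qdet q (a * b) (kop (K a)) (kop (K b)) = Gam a"
    by (simp only: Gam_def par(1)[symmetric])
  also have "lift_fls (1 / f_norm s 2 x) * (lift_fls (cross q (a * b)) * (tr (lop (kap a) * kop (K a)) * tr (lop (kap b) * kop (K b)))
      - lift_fls (gam a) * Gam a) = T 1 a * T 1 b - lift_fls (gam a / cross q (x\<^sup>2)) * Gam a"
    by (simp only: right_diff_distrib f par(6) T1 lift_divide divide_self[OF cr] lift_1 mult_1)
  finally show ?thesis
    by (simp only: a_def b_def)
qed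

lemma cc_inverse: "cc (inverse y) = - cc y"
  by (simp add: cc_def)

lemma T3:
  assumes x: "x \<noteq> 0"
  defines "a \<equiv> x * inverse q" and "b \<equiv> x" and "c \<equiv> x * q"
  assumes re: "refl_eq q a b (kop (K a)) (kop (K b))" "refl_eq q b c (kop (K b)) (kop (K c))"
    and cr: "cross q (a * b) \<noteq> 0" "cross q (a * c) \<noteq> 0" "cross q (b * c) \<noteq> 0"
  shows "T 3 x = T 1 a * (T 1 b * T 1 c) - lift_fls (gam a / cross q (a * b)) * (Gam a * T 1 c)
    - lift_fls (gam b / cross q (b * c)) * (T 1 a * Gam b)"
proof -
  define x' where "x' = inverse x * qpw s (-2)"
  define a' where "a' = inverse a * inverse q"
  define b' where "b' = inverse b * inverse q"
  define c' where "c' = inverse c * inverse q"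
  define m where "m = mono3 c' b' a' (kop (k c')) (kop (k b')) (kop (k a'))"
  define M where "M = mono3 a b c (kop (K a)) (kop (K b)) (kop (K c))"
  note Sx = q(2) x
  have par: "b = a * q" "c = b * q" "b' = c' * q" "a' = b' * q"
    "a' * b' = inverse (a * b * q\<^sup>2)" "b' * c' = inverse (b * c * q\<^sup>2)" "a' * c' = inverse (a * c * q\<^sup>2)"
    "inverse a * inverse q * (inverse a * inverse q * inverse q) = a' * b'"
    "inverse b * inverse q * (inverse b * inverse q * inverse q) = b' * c'"
    "x' * qpw s (-2) = c'" "x' = b'" "x' * qpw s 2 = a'" "x * qpw s (-2) = a" "x * qpw s 2 = c"
    using Sx by (simp_all add: a_def b_def c_def a'_def b'_def c'_def x'_def qpw field_simps power2_eq_square)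
  have nz': "a \<noteq> 0" "b \<noteq> 0" "c \<noteq> 0" "a' \<noteq> 0" "b' \<noteq> 0" "c' \<noteq> 0" "x' \<noteq> 0"
    using Sx by (simp_all add: a_def b_def c_def a'_def b'_def c'_def x'_def qpw)
  \<comment> \<open>The normalization is exactly the product of the three crossing factors that
    appear when the full trace factorizes.\<close>
  have f: "f_norm s 3 x = cross q (a * b) * (cross q (a * c) * cross q (b * c))"
  proof -
    have q46: "qpw s 4 = q * q" "qpw s 6 = q * q * q"
      using s0 by (simp_all add: q_def qpw_def power_int_add[symmetric])
    have "f_norm s 3 x = (cc (x\<^sup>2 * qpw s 2) * cc (inverse (x\<^sup>2) * qpw s 2)) *
       ((cc (x\<^sup>2 * qpw s 4) * cc (inverse (x\<^sup>2) * qpw s 0)) * (cc (x\<^sup>2 * qpw s 6) * cc (inverse (x\<^sup>2) * qpw s (-2))))"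
    proof -
      have "{1..3 - 1 :: nat} = {1, 2}" "{1..1::nat} = {1}" "{1..2::nat} = {1, 2}" by auto
      then show ?thesis by (simp add: f_norm_def)
    qed
    also have "\<dots> = cross q (a * b) * (cross q (a * c) * cross q (b * c))"
      using Sx by (simp add: cross_def qpw q46 a_def b_def c_def power2_eq_square mult.assoc mult.commute mult.left_commute)
    finally show ?thesis .
  qed
  have em: "emb v4 wt3 v4 wt3 (fused_K s k 3 x') = cop F8 * (m * cop E8)"
  proof -
    have r1: "refl_eq q (x' * qpw s (-2)) x' (kop (k (x' * qpw s (-2)))) (kop (k x'))"
      unfolding par(10) by (rule rk) (rule nz')+
    have r2: "refl_eq q x' (x' * qpw s 2) (kop (k x')) (kop (k (x' * qpw s 2)))"
      unfolding par(12) by (rule rk) (rule nz')+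
    show ?thesis
      using fused3_mono[where K = k and x = x', OF k nz'(7) r1 r2]
      by (simp only: lop_complex par(10,12)) (simp only: par(11) m_def)
  qed
  have eM: "emb v4 wt3 v4 wt3 (fused_K s K 3 x) = lop (cop F8) * (M * lop (cop E8))"
    using fused3_mono[where K = K and x = x, OF K x] re by (simp only: par(13,14) b_def M_def)
  have c3: "fused_K s K' 3 y \<in> carrier_mat 4 4" for K' y
    using fused_carrier[of s K' 3 y] by simp
  have "T 3 x = lift_fls (1 / f_norm s 3 x) * tr (lop (tp (cop F8 * (m * cop E8))) * (lop (cop F8) * (M * lop (cop E8))))"
    unfolding T_def x'_def[symmetric] by (subst mtrace_emb[OF _ _ bij_wt3]) (rule c3 c3 | simp only: em eM)+
  also have "tr (lop (tp (cop F8 * (m * cop E8))) * (lop (cop F8) * (M * lop (cop E8)))) =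
      tr (lop (D3 (inverse (q3 q)) * tp m * D3 (q3 q / 9)) * M)"
    by (simp only: tr_sandwich cop_tp[symmetric] cop_mult[symmetric] F8_E8 cop_Ds)
  also have "\<dots> = lift_fls (cross q (a * b) * (cross q (a * c) * cross q (b * c))) * (T 1 a * (T 1 b * T 1 c))
    - lift_fls (cc (b' * c') * cc (b' * c' * q\<^sup>2) * (cc (a * c) * cc (a * c * q\<^sup>2)) * gam a) * (Gam a * T 1 c)
    - lift_fls (cc (a' * c') * cc (a' * c' * q\<^sup>2) * (cc (a * b) * cc (a * b * q\<^sup>2)) * gam b) * (T 1 a * Gam b)"
  proof -
    have g: "gam a = tr (leg2 (kap b) * Rm q (a' * b') * leg1 (kap a) * Pm)"
      "gam b = tr (leg2 (kap c) * Rm q (b' * c') * leg1 (kap b) * Pm)"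
      by (simp_all only: gam_def par(8,9) par(1,2)[symmetric])
    have G: "Gam a = qdet q (a * b) (kop (K a)) (kop (K b))" "Gam b = qdet q (b * c) (kop (K b)) (kop (K c))"
      by (simp_all only: Gam_def par(1,2)[symmetric])
    have kt: "tp (kap a) = kop (k a')" "tp (kap b) = kop (k b')" "tp (kap c) = kop (k c')"
      by (simp_all add: kap_def a'_def b'_def c'_def)
    have r: "refl_eq q a' b' (kap a) (kap b)" "refl_eq q a' c' (kap a) (kap c)" "refl_eq q b' c' (kap b) (kap c)"
       "refl_eq q b' a' (kap b) (kap a)" "refl_eq q c' b' (kap c) (kap b)"
      unfolding kap_def a'_def[symmetric] b'_def[symmetric] c'_def[symmetric] using nz' by (auto intro: rkt)
    have mm: "m = e1 (tp (kap c)) * (e12 (Rm q (b' * c')) * (e2 (tp (kap b)) *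
       (e13 (Rm q (a' * c')) * (e23 (Rm q (a' * b')) * e3 (tp (kap a))))))"
      by (simp only: m_def mono3_def lop_complex kt mult.commute[of c' b'] mult.commute[of c' a'] mult.commute[of b' a'])
    show ?thesis
      unfolding mm M_def mono3_def g G T1
      by (rule three_leg) (use q(2) q_facts nz' par(1-7) re r in simp_all)
  qed
  also have "\<dots> = lift_fls (cross q (a * b) * (cross q (a * c) * cross q (b * c))) * (T 1 a * (T 1 b * T 1 c))
    - lift_fls (cross q (a * b) * (cross q (a * c) * cross q (b * c)) * (gam a / cross q (a * b))) * (Gam a * T 1 c)
    - lift_fls (cross q (a * b) * (cross q (a * c) * cross q (b * c)) * (gam b / cross q (b * c))) * (T 1 a * Gam b)"
  proof -
    have "cc (b' * c') * cc (b' * c' * q\<^sup>2) * (cc (a * c) * cc (a * c * q\<^sup>2)) * gam a =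
      cross q (a * b) * (cross q (a * c) * cross q (b * c)) * (gam a / cross q (a * b))"
    and "cc (a' * c') * cc (a' * c' * q\<^sup>2) * (cc (a * b) * cc (a * b * q\<^sup>2)) * gam b =
      cross q (a * b) * (cross q (a * c) * cross q (b * c)) * (gam b / cross q (b * c))"
    proof -
    \<comment> \<open>Both scalars left by an antisymmetrized pair are crossing factors up to sign,
      and the signs cancel. Two of the three factors in the normalization are thereby used up; the
      third remains as a denominator.\<close>
    have e: "cc (y * w) * cc (y * w * q\<^sup>2) = - cross q v" if "y * w = inverse (v * q\<^sup>2)" for y w v
      using q(2) that by (simp add: cross_def cc_inverse[of "v * q\<^sup>2", simplified] ) (simp add: cc_def field_simps)
    have e': "cc (y * w) * cc (y * w * q\<^sup>2) = - cross q (y * w)" for y w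
      by (simp add: cross_def cc_inverse del: inverse_mult_distrib)
    show "cc (b' * c') * cc (b' * c' * q\<^sup>2) * (cc (a * c) * cc (a * c * q\<^sup>2)) * gam a =
        cross q (a * b) * (cross q (a * c) * cross q (b * c)) * (gam a / cross q (a * b))"
      using cr by (simp add: e[OF par(6)] e'[of a c])
    show "cc (a' * c') * cc (a' * c' * q\<^sup>2) * (cc (a * b) * cc (a * b * q\<^sup>2)) * gam b =
        cross q (a * b) * (cross q (a * c) * cross q (b * c)) * (gam b / cross q (b * c))"
      using cr by (simp add: e[OF par(7)] e'[of a b])
  qed
    note this
    then show ?thesis
      by (simp only:)
  qed
  also have "lift_fls (1 / f_norm s 3 x) * (lift_fls (cross q (a * b) * (cross q (a * c) * cross q (b * c))) * (T 1 a * (T 1 b * T 1 c))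
    - lift_fls (cross q (a * b) * (cross q (a * c) * cross q (b * c)) * (gam a / cross q (a * b))) * (Gam a * T 1 c)
    - lift_fls (cross q (a * b) * (cross q (a * c) * cross q (b * c)) * (gam b / cross q (b * c))) * (T 1 a * Gam b)) =
    T 1 a * (T 1 b * T 1 c) - lift_fls (gam a / cross q (a * b)) * (Gam a * T 1 c) - lift_fls (gam b / cross q (b * c)) * (T 1 a * Gam b)"
  proof -
    have nzf: "cross q (a * b) * (cross q (a * c) * cross q (b * c)) \<noteq> 0" using cr by simp
    note lc = lift_cancel[OF nzf] lift_cancel[OF nzf, of 1, unfolded mult_1_right lift_1 mult_1]
    show ?thesis by (simp only: right_diff_distrib f lc)
  qed
  finally show ?thesis .
qed
end
end

subsection \<open>Generating series\<close>

definition gser :: "complex fps \<Rightarrow> (nat \<Rightarrow> 'a::complex_alg_1) \<Rightarrow> 'a fps" where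
  "gser v a = Abs_fps (\<lambda>m. \<Sum>k\<le>m. of_cplx ((v ^ Suc k) $ m) * a k)"

lemma of_cplx_scal_mult: "of_cplx c * a * (of_cplx d * b) = of_cplx (c * d) * (a * b)"
proof -
  have "of_cplx c * a * (of_cplx d * b) = of_cplx c * (a * of_cplx d) * b"
    by (simp only: mult.assoc)
  also have "\<dots> = of_cplx c * (of_cplx d * a) * b"
    by (simp only: of_cplx_central)
  finally show ?thesis
    by (simp only: mult.assoc of_cplx_mult)
qed

text \<open>Scalars are central, so in each coefficient they collect in front of the assumed
  combination of commutators, even though the two series have different arguments \<open>v\<close>
  and \<open>w\<close>.\<close>

lemma gser_exchange:
  fixes a b c d :: "nat \<Rightarrow> 'a::complex_alg_1"
  assumes "\<And>k l. a k * b l - b l * a k + (c k * d l - d l * c k) = 0"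
  shows "gser v a * gser w b - gser w b * gser v a + (gser v c * gser w d - gser w d * gser v c) = 0"
proof (rule fps_ext)
  fix n
  have p: "(\<Sum>i=0..n. gser w g $ i * gser v f $ (n - i)) = (\<Sum>i=0..n. gser w g $ (n - i) * gser v f $ i)"
    for f g :: "nat \<Rightarrow> 'a"
    by (rule sum.reindex_bij_witness[of _ "\<lambda>i. n - i" "\<lambda>i. n - i"]) auto
  have "gser v a $ i * gser w b $ j - gser w b $ j * gser v a $ i
      + (gser v c $ i * gser w d $ j - gser w d $ j * gser v c $ i) = 0" for i j
  proof -
    have "gser v a $ i * gser w b $ j - gser w b $ j * gser v a $ i
        + (gser v c $ i * gser w d $ j - gser w d $ j * gser v c $ i) =
      (\<Sum>k\<le>i. \<Sum>l\<le>j. of_cplx ((v ^ Suc k) $ i * (w ^ Suc l) $ j) *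
        (a k * b l - b l * a k + (c k * d l - d l * c k)))"
      unfolding gser_def fps_nth_Abs_fps
      by (simp only: sum_product of_cplx_scal_mult sum_subtractf[symmetric] sum.distrib[symmetric]
         sum.swap[of _ "{..j}" "{..i}"] mult.commute[of "(w ^ _) $ _"] distrib_left right_diff_distrib)
    then show ?thesis
      by (simp add: assms)
  qed
  then have "(\<Sum>i=0..n. gser v a $ i * gser w b $ (n - i) - gser w b $ (n - i) * gser v a $ i
      + (gser v c $ i * gser w d $ (n - i) - gser w d $ (n - i) * gser v c $ i)) = 0"
    by simp
  then show "(gser v a * gser w b - gser w b * gser v a + (gser v c * gser w d - gser w d * gser v c)) $ n = 0 $ n"
    by (simp add: fps_mult_nth p sum_subtractf sum.distrib)
qed

lemma gser_shift:
  fixes v :: "complex fps" and a :: "nat \<Rightarrow> 'a::complex_alg_1"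
  assumes v0: "v $ 0 = 0"
  shows "Abs_fps (\<lambda>m. of_cplx (v $ m)) * gser v (\<lambda>k. a (Suc k)) = gser v a - Abs_fps (\<lambda>m. of_cplx (v $ m)) * fps_const (a 0)"
proof (rule fps_ext)
  fix n
  have z: "(v ^ k) $ m = 0" if "m < k" for k m
    using startsby_zero_power_prefix[OF v0] that by blast
  have "(Abs_fps (\<lambda>m. of_cplx (v $ m)) * gser v (\<lambda>k. a (Suc k))) $ n =
      (\<Sum>i=0..n. \<Sum>k\<le>n - i. of_cplx (v $ i * (v ^ Suc k) $ (n - i)) * a (Suc k))"
    by (simp add: fps_mult_nth gser_def sum_distrib_left of_cplx_mult mult.assoc del: power_Suc)
  \<comment> \<open>Summation ranges can be extended and cut because the k-th power of
    \<open>v\<close> has no coefficient below k.\<close>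
  also have "\<dots> = (\<Sum>i=0..n. \<Sum>k\<le>n. of_cplx (v $ i * (v ^ Suc k) $ (n - i)) * a (Suc k))"
    by (intro sum.cong refl sum.mono_neutral_left) (auto simp: z of_cplx_0 simp del: power_Suc)
  also have "\<dots> = (\<Sum>k\<le>n. of_cplx ((v ^ Suc (Suc k)) $ n) * a (Suc k))"
    by (subst sum.swap) (simp only: power_Suc[of v "Suc _"] fps_mult_nth of_cplx_sum sum_distrib_right)
  also have "\<dots> = (\<Sum>k<n. of_cplx ((v ^ Suc (Suc k)) $ n) * a (Suc k))"
    by (intro sum.mono_neutral_right) (auto simp: z of_cplx_0 not_less simp del: power_Suc)
  also have "\<dots> = (\<Sum>k\<le>n. of_cplx ((v ^ Suc k) $ n) * a k) - of_cplx (v $ n) * a 0"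
    by (simp only: sum.atMost_shift) simp
  finally show "(Abs_fps (\<lambda>m. of_cplx (v $ m)) * gser v (\<lambda>k. a (Suc k))) $ n =
      (gser v a - Abs_fps (\<lambda>m. of_cplx (v $ m)) * fps_const (a 0)) $ n"
    by (simp add: gser_def)
qed

lemma gen_ser_conv:
  assumes "inverse (U_ser s x) = fps_to_fls v"
  shows "gen_ser s a x = fps_to_fls (gser v a)"
proof -
  have "fls_nth (inverse (U_ser s x) ^ (k + 1)) (int m) = (v ^ Suc k) $ m" for k m
    unfolding assms fps_to_fls_power[symmetric] by simp
  then show ?thesis
    by (simp only: gen_ser_def gser_def)
qed

lemma gen_ser_diff: "gen_ser s (\<lambda>k. a k - b k) x = gen_ser s a x - gen_ser s b x"
proof -
  define F where "F h = Abs_fps (\<lambda>m. \<Sum>k\<le>m. of_cplx (fls_nth (inverse (U_ser s x) ^ (k + 1)) (int m)) * h k)" for h :: "nat \<Rightarrow> 'a"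
  have "F (\<lambda>k. a k - b k) = F a - F b"
    by (rule fps_ext) (simp only: F_def fps_nth_Abs_fps fps_sub_nth right_diff_distrib sum_subtractf)
  then show "gen_ser s (\<lambda>k. a k - b k) x = gen_ser s a x - gen_ser s b x"
    by (simp only: gen_ser_def F_def[symmetric] fps_to_fls_minus)
qed
lemma gen_ser_left: "gen_ser s (\<lambda>k. w * a k) x = fls_const w * gen_ser s a x"
proof -
  have oc: "of_cplx c * (w * b) = w * (of_cplx c * b)" for b c
    by (simp only: mult.assoc[symmetric] of_cplx_central[of c w])
  have "gen_ser s (\<lambda>k. w * a k) x = fps_to_fls (fps_const w * Abs_fps (\<lambda>m.
     \<Sum>k\<le>m. of_cplx (fls_nth (inverse (U_ser s x) ^ (k + 1)) (int m)) * a k))"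
    unfolding gen_ser_def
    by (auto intro!: arg_cong[of _ _ fps_to_fls] fps_ext sum.cong simp: sum_distrib_left oc)
  then show ?thesis
    by (simp add: gen_ser_def fls_times_fps_to_fls)
qed
lemma gen_ser_right: "gen_ser s (\<lambda>k. a k * w) x = gen_ser s a x * fls_const w"
proof -
  have "gen_ser s (\<lambda>k. a k * w) x = fps_to_fls (Abs_fps (\<lambda>m.
     \<Sum>k\<le>m. of_cplx (fls_nth (inverse (U_ser s x) ^ (k + 1)) (int m)) * a k) * fps_const w)"
    unfolding gen_ser_def
    by (auto intro!: arg_cong[of _ _ fps_to_fls] fps_ext sum.cong simp: sum_distrib_right mult.assoc)
  then show ?thesis
    by (simp add: gen_ser_def fls_times_fps_to_fls)
qed
lemma lift_const: "lift_fls (fls_const c) = fls_const (of_cplx c)"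
  by (rule fls_eqI) (simp add: of_cplx_0)
lemma gen_ser_scal: "gen_ser s (\<lambda>k. of_cplx c * a k) x = scal (gen_ser s a x) (fls_const c)"
  by (simp only: gen_ser_left lift_const[symmetric] lift_scal)

text \<open>The term in u^2 dominates, so 1/U has order 2 and is a power series without constant
  term; this makes the truncated sums in \<open>gen_ser\<close> exact.\<close>

lemma U_ser_inverse:
  assumes s: "s \<noteq> 0" "s\<^sup>2 + inverse (s\<^sup>2) \<noteq> 0" and \<alpha>: "\<alpha> \<noteq> 0" and x: "x = fls_const \<alpha> * fls_X_inv"
  obtains v :: "complex fps" where "inverse (U_ser s x) = fps_to_fls v" "v $ 0 = 0" "U_ser s x \<noteq> 0"
proof -
  have t: "qpw s 2 + qpw s (-2) = fls_const (s\<^sup>2 + inverse (s\<^sup>2))"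
    by (simp add: qpw_def fls_plus_const power_int_minus)
  have A: "qpw s 2 * x\<^sup>2 = fls_const (s\<^sup>2 * \<alpha>\<^sup>2) * fls_X_inv ^ 2"
    by (simp add: x qpw_def power_mult_distrib fls_const_power[symmetric] mult.assoc[symmetric])
  have B: "qpw s (-2) * inverse (x\<^sup>2) = fls_const (inverse (s\<^sup>2) * inverse (\<alpha>\<^sup>2)) * inverse (fls_X_inv ^ 2)"
    by (simp add: x qpw_def power_mult_distrib fls_const_power[symmetric] mult.assoc[symmetric] power_int_minus
      fls_inverse_const fls_const_mult_const[symmetric] del: fls_const_mult_const)
  have sA: "fls_subdegree (qpw s 2 * x\<^sup>2) = -2"
    unfolding A using s \<alpha> by (subst fls_subdegree_mult) (auto simp: fls_const_nonzero)
  have sB: "fls_subdegree (qpw s (-2) * inverse (x\<^sup>2)) = 2"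
    unfolding B using s \<alpha> by (subst fls_subdegree_mult) (auto simp: fls_const_nonzero)
  have nA: "qpw s 2 * x\<^sup>2 \<noteq> 0"
    proof
    assume z: "qpw s 2 * x\<^sup>2 = 0"
    show False using sA unfolding z by simp
  qed
  have sAB: "fls_subdegree (qpw s 2 * x\<^sup>2 + qpw s (-2) * inverse (x\<^sup>2)) = -2"
    using fls_subdegree_add_eq1[OF nA, of "qpw s (-2) * inverse (x\<^sup>2)"] sA sB by simp
  have sU: "fls_subdegree (U_ser s x) = -2"
  proof -
    have "U_ser s x = (qpw s 2 * x\<^sup>2 + qpw s (-2) * inverse (x\<^sup>2)) * fls_const (inverse (s\<^sup>2 + inverse (s\<^sup>2)))"
      unfolding U_ser_def t by (simp add: fls_inverse_const[symmetric] divide_inverse)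
    moreover have "qpw s 2 * x\<^sup>2 + qpw s (-2) * inverse (x\<^sup>2) \<noteq> 0"
      using sAB by auto
    ultimately show ?thesis
      using s sAB by (simp add: fls_subdegree_mult fls_const_nonzero)
  qed
  have U0: "U_ser s x \<noteq> 0" using sU by auto
  have sV: "fls_subdegree (inverse (U_ser s x)) = 2"
    using sU U0 by simp
  have "inverse (U_ser s x) = fps_to_fls (fls_regpart (inverse (U_ser s x)))"
    using sV by simp
  moreover have "fls_regpart (inverse (U_ser s x)) $ 0 = 0"
    using sV by (simp add: fls_eq0_below_subdegree)
  ultimately show ?thesis using that U0 by blast
qed

lemma lift_fps: "lift_fls (fps_to_fls v) = fps_to_fls (Abs_fps (\<lambda>m. of_cplx (fps_nth v m)))"
  by (rule fls_eqI) (simp add: of_cplx_0)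

lemma gen_ser_zero: "gen_ser s (\<lambda>_. 0) x = 0"
  using gen_ser_left[of s 0 "\<lambda>_. 0" x] by simp

section \<open>Reflection equation for the generating currents\<close>

definition "ux \<alpha> = fls_const \<alpha> * (fls_X_inv :: complex fls)"

context qroot
begin

context
  fixes g :: "gen \<Rightarrow> 'a::complex_alg_1" and kp km :: complex
  assumes kpm: "kp \<noteq> 0" "km \<noteq> 0" and rel: "oq_relators qc kp km g \<subseteq> {0}"
begin

abbreviation "aWm k \<equiv> g (Wgen (- int k))"
abbreviation "aWp k \<equiv> g (Wgen (int k + 1))"
abbreviation "aG k \<equiv> g (Ggen k)"
abbreviation "aGt k \<equiv> g (Gtgen k)"

lemma relator_0: "y \<in> oq_relators qc kp km g \<Longrightarrow> y = 0"
  using rel by blast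

lemmas relator_0' = relator_0[unfolded oq_relators_def Let_def two_def[symmetric] Suc_eq_plus1[symmetric]]
lemmas relation = eq_iff_diff_eq_0[THEN iffD2, OF relator_0']

lemma rels:
  "comm (aWm 0) (aWp k) = of_cplx (inverse two) * (aGt k - aG k)"
  "comm (aWm k) (aWp 0) = of_cplx (inverse two) * (aGt k - aG k)"
  "qcomm qc (aWm 0) (aG k) = of_cplx (kp * km * two\<^sup>2) * (aWm (Suc k) - aWp k)"
  "qcomm qc (aGt k) (aWm 0) = of_cplx (kp * km * two\<^sup>2) * (aWm (Suc k) - aWp k)"
  "qcomm qc (aG k) (aWp 0) = of_cplx (kp * km * two\<^sup>2) * (aWp (Suc k) - aWm k)"
  "qcomm qc (aWp 0) (aGt k) = of_cplx (kp * km * two\<^sup>2) * (aWp (Suc k) - aWm k)"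
  "comm (aWm k) (aWm l) = 0" "comm (aWp k) (aWp l) = 0" "comm (aG k) (aG l) = 0" "comm (aGt k) (aGt l) = 0"
  "comm (aWm k) (aWp l) + comm (aWp k) (aWm l) = 0"
  "comm (aWm k) (aG l) + comm (aG k) (aWm l) = 0"
  "comm (aWm k) (aGt l) + comm (aGt k) (aWm l) = 0"
  "comm (aWp k) (aG l) + comm (aG k) (aWp l) = 0"
  "comm (aWp k) (aGt l) + comm (aGt k) (aWp l) = 0"
  "comm (aGt k) (aG l) + comm (aG k) (aGt l) = 0"
  by ((rule relator_0', blast) | (rule relation, blast))+

lemma ux:
  assumes "\<alpha> \<noteq> 0"
  obtains v :: "complex fps" where "inverse (U_ser s (ux \<alpha>)) = fps_to_fls v" "fps_nth v 0 = 0" "U_ser s (ux \<alpha>) \<noteq> 0"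
  using U_ser_inverse[of s \<alpha> "ux \<alpha>"] assms s s0 nz(1) ux_def two_def by metis

lemma gen_exchange:
  assumes "\<alpha> \<noteq> 0" "\<beta> \<noteq> 0" "\<And>k l. comm (a k) (b l) + comm (c k) (d l) = (0 :: 'a)"
  shows "gen_ser s a (ux \<alpha>) * gen_ser s b (ux \<beta>) - gen_ser s b (ux \<beta>) * gen_ser s a (ux \<alpha>)
    + (gen_ser s c (ux \<alpha>) * gen_ser s d (ux \<beta>) - gen_ser s d (ux \<beta>) * gen_ser s c (ux \<alpha>)) = 0"
proof -
  obtain v where v: "inverse (U_ser s (ux \<alpha>)) = fps_to_fls v" using ux[OF assms(1)] by blast
  obtain w where w: "inverse (U_ser s (ux \<beta>)) = fps_to_fls w" using ux[OF assms(2)] by blast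
  show ?thesis
    using arg_cong[OF gser_exchange[of a b c d v w], of fps_to_fls] assms(3)
    by (simp add: gen_ser_conv[OF v] gen_ser_conv[OF w] fls_times_fps_to_fls comm_def)
qed

lemma gen_comm:
  assumes "\<alpha> \<noteq> 0" "\<beta> \<noteq> 0" "\<And>k l. comm (a k) (b l) = (0 :: 'a)"
  shows "gen_ser s b (ux \<beta>) * gen_ser s a (ux \<alpha>) = gen_ser s a (ux \<alpha>) * gen_ser s b (ux \<beta>)"
  using gen_exchange[of \<alpha> \<beta> a b "\<lambda>_. 0" "\<lambda>_. 0"] assms by (simp add: comm_def gen_ser_zero)

lemma gen_shift:
  assumes "\<alpha> \<noteq> 0"
  shows "gen_ser s (\<lambda>k. a (Suc k) :: 'a) (ux \<alpha>) = scal (gen_ser s a (ux \<alpha>)) (U_ser s (ux \<alpha>)) - fls_const (a 0)"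
proof -
  obtain v where v: "inverse (U_ser s (ux \<alpha>)) = fps_to_fls v" "fps_nth v 0 = 0" "U_ser s (ux \<alpha>) \<noteq> 0"
    using ux[OF assms(1)] by blast
  let ?L = "lift_fls (inverse (U_ser s (ux \<alpha>))) :: 'a fls"
  have "?L * gen_ser s (\<lambda>k. a (Suc k)) (ux \<alpha>) = gen_ser s a (ux \<alpha>) - ?L * fls_const (a 0)"
    using arg_cong[OF gser_shift[OF v(2), of a], of fps_to_fls]
    by (simp add: gen_ser_conv[OF v(1)] fls_times_fps_to_fls lift_fps v(1))
  then have "lift_fls (U_ser s (ux \<alpha>)) * (?L * gen_ser s (\<lambda>k. a (Suc k)) (ux \<alpha>)) =
     lift_fls (U_ser s (ux \<alpha>)) * (gen_ser s a (ux \<alpha>) - ?L * fls_const (a 0))"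
    by simp
  then show ?thesis
    using v(3) by (simp add: right_diff_distrib mult.assoc[symmetric] lift_mult[symmetric] lift_scal scal_scal scal_1)
qed

definition "gp \<alpha> = gen_ser s (\<lambda>k. aG k) (ux \<alpha>)"
definition "gm \<alpha> = gen_ser s (\<lambda>k. aGt k) (ux \<alpha>)"
definition "wp \<alpha> = gen_ser s (\<lambda>k. aWm k) (ux \<alpha>)"
definition "wm \<alpha> = gen_ser s (\<lambda>k. aWp k) (ux \<alpha>)"
definition "w0 = fls_const (aWm 0)"
definition "w1 = fls_const (aWp 0)"
definition "KP = fls_const kp"
definition "KM = fls_const km"
definition "tq = q + inverse q"
definition "bb1 = inverse (KM * tq)"
definition "bb2 = KP * tq / (q - inverse q)"
definition "cc1 = inverse (KP * tq)"
definition "cc2 = KM * tq / (q - inverse q)"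
definition "bK \<alpha> = scal (gp \<alpha>) bb1 + scal 1 bb2"
definition "cK \<alpha> = scal (gm \<alpha>) cc1 + scal 1 cc2"
definition "rho = KP * KM * tq\<^sup>2"

lemma coef: "KP \<noteq> 0" "KM \<noteq> 0" "tq \<noteq> 0" "bb2 * q - bb2 * inverse q = KP * tq" "cc2 * q - cc2 * inverse q = KM * tq"
  "KM * bb1 = inverse tq" "KP * cc1 = inverse tq" "KP * cc2 = KM * bb2" "rho * bb1 = KP * tq" "rho * cc1 = KM * tq"
proof -
  have v: "q - inverse q \<noteq> 0" using q_facts(1) by (simp add: cc_def)
  show "KP \<noteq> 0" "KM \<noteq> 0" "tq \<noteq> 0"
    using kpm q_facts by (simp_all add: KP_def KM_def tq_def)
  then show "KM * bb1 = inverse tq" "KP * cc1 = inverse tq" "rho * bb1 = KP * tq" "rho * cc1 = KM * tq"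
    by (simp_all add: bb1_def cc1_def rho_def power2_eq_square field_simps)
  show "KP * cc2 = KM * bb2" by (simp add: cc2_def bb2_def)
  have "bb2 * (q - inverse q) = KP * tq" "cc2 * (q - inverse q) = KM * tq"
    using v by (simp_all add: bb2_def cc2_def)
  then show "bb2 * q - bb2 * inverse q = KP * tq" "cc2 * q - cc2 * inverse q = KM * tq"
    by (simp_all add: right_diff_distrib)
qed

lemma const_eqs: "fls_const two = tq" "fls_const (inverse two) = inverse tq" "fls_const (kp * km * two\<^sup>2) = rho"
  "fls_const qc = q" "fls_const (inverse qc) = inverse q"
proof -
  show t: "fls_const two = tq" by (simp add: tq_def q_facts)
  show "fls_const (inverse two) = inverse tq" by (simp add: t[symmetric] fls_inverse_const)
  show "fls_const (kp * km * two\<^sup>2) = rho"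
    by (simp add: rho_def t[symmetric] KP_def KM_def fls_const_power[symmetric])
  show "fls_const qc = q" "fls_const (inverse qc) = inverse q"
    by (simp_all add: q fls_inverse_const)
qed

text \<open>The relations are summed over k; an index shift multiplies a current by U and leaves its
  first generator behind, which gives the inhomogeneous terms \<open>w0\<close> and
  \<open>w1\<close>.\<close>

lemma single:
  assumes \<alpha>: "\<alpha> \<noteq> 0"
  shows "w0 * wp \<alpha> = wp \<alpha> * w0" "w1 * wm \<alpha> = wm \<alpha> * w1"
    "w0 * wm \<alpha> - wm \<alpha> * w0 = scal (gm \<alpha> - gp \<alpha>) (inverse tq)"
    "scal (w0 * gp \<alpha>) q - scal (gp \<alpha> * w0) (inverse q) = scal (scal (wp \<alpha>) (U_ser s (ux \<alpha>)) - w0 - wm \<alpha>) rho"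
    "scal (gm \<alpha> * w0) q - scal (w0 * gm \<alpha>) (inverse q) = scal (scal (wp \<alpha>) (U_ser s (ux \<alpha>)) - w0 - wm \<alpha>) rho"
    "scal (gp \<alpha> * w1) q - scal (w1 * gp \<alpha>) (inverse q) = scal (scal (wm \<alpha>) (U_ser s (ux \<alpha>)) - w1 - wp \<alpha>) rho"
    "scal (w1 * gm \<alpha>) q - scal (gm \<alpha> * w1) (inverse q) = scal (scal (wm \<alpha>) (U_ser s (ux \<alpha>)) - w1 - wp \<alpha>) rho"
proof -
  note gg = gen_ser_scal gen_ser_left gen_ser_right gen_ser_diff const_eqs
  note fold = wp_def[symmetric] wm_def[symmetric] gp_def[symmetric] gm_def[symmetric] w0_def[symmetric] w1_def[symmetric]
  note sh = gen_shift[OF \<alpha>, of "\<lambda>k. aWm k"] gen_shift[OF \<alpha>, of "\<lambda>k. aWp k"]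
  have r: "gen_ser s (\<lambda>k. f k) (ux \<alpha>) = gen_ser s (\<lambda>k. h k) (ux \<alpha>)" if "\<And>k. f k = h k" for f h :: "nat \<Rightarrow> 'a"
    using that by simp
  show "w0 * wp \<alpha> = wp \<alpha> * w0"
  proof -
    have "aWm 0 * aWm k = aWm k * aWm 0" for k
      using rels(7)[of 0 k] by (simp add: comm_def)
    then have "gen_ser s (\<lambda>k. aWm 0 * aWm k) (ux \<alpha>) = gen_ser s (\<lambda>k. aWm k * aWm 0) (ux \<alpha>)"
      by simp
    then show ?thesis by (simp only: gg fold)
  qed
  show "w1 * wm \<alpha> = wm \<alpha> * w1"
  proof -
    have "aWp 0 * aWp k = aWp k * aWp 0" for k
      using rels(8)[of 0 k] by (simp add: comm_def)
    then have "gen_ser s (\<lambda>k. aWp 0 * aWp k) (ux \<alpha>) = gen_ser s (\<lambda>k. aWp k * aWp 0) (ux \<alpha>)"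
      by simp
    then show ?thesis by (simp only: gg fold)
  qed
  show "w0 * wm \<alpha> - wm \<alpha> * w0 = scal (gm \<alpha> - gp \<alpha>) (inverse tq)"
    using r[of "\<lambda>k. comm (aWm 0) (aWp k)", OF rels(1)] by (simp only: comm_def gg fold)
  show "scal (w0 * gp \<alpha>) q - scal (gp \<alpha> * w0) (inverse q) = scal (scal (wp \<alpha>) (U_ser s (ux \<alpha>)) - w0 - wm \<alpha>) rho"
    using r[of "\<lambda>k. qcomm qc (aWm 0) (aG k)", OF rels(3)] by (simp only: qcomm_def mult.assoc[where 'a='a] gg sh fold)
  show "scal (gm \<alpha> * w0) q - scal (w0 * gm \<alpha>) (inverse q) = scal (scal (wp \<alpha>) (U_ser s (ux \<alpha>)) - w0 - wm \<alpha>) rho"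
    using r[of "\<lambda>k. qcomm qc (aGt k) (aWm 0)", OF rels(4)] by (simp only: qcomm_def mult.assoc[where 'a='a] gg sh fold)
  show "scal (gp \<alpha> * w1) q - scal (w1 * gp \<alpha>) (inverse q) = scal (scal (wm \<alpha>) (U_ser s (ux \<alpha>)) - w1 - wp \<alpha>) rho"
    using r[of "\<lambda>k. qcomm qc (aG k) (aWp 0)", OF rels(5)] by (simp only: qcomm_def mult.assoc[where 'a='a] gg sh fold)
  show "scal (w1 * gm \<alpha>) q - scal (gm \<alpha> * w1) (inverse q) = scal (scal (wm \<alpha>) (U_ser s (ux \<alpha>)) - w1 - wp \<alpha>) rho"
    using r[of "\<lambda>k. qcomm qc (aWp 0) (aGt k)", OF rels(6)] by (simp only: qcomm_def mult.assoc[where 'a='a] gg sh fold)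
qed

text \<open>The constants in the off-diagonal entries of K remove the inhomogeneous terms: the
  q-commutator of a generator with a constant is q - 1/q times their product, and
  \<open>bb2\<close>, \<open>cc2\<close> have just the right size.\<close>

lemma single':
  assumes \<alpha>: "\<alpha> \<noteq> 0"
  defines "V \<equiv> U_ser s (ux \<alpha>)"
  shows "scal (w0 * wm \<alpha>) 1 + scal (wm \<alpha> * w0) (-1) + scal (cK \<alpha>) (- KP) + scal (bK \<alpha>) KM = 0"
    "scal (w0 * bK \<alpha>) q + scal (bK \<alpha> * w0) (- inverse q) + scal (wp \<alpha>) (- KP * tq * V) + scal (wm \<alpha>) (KP * tq) = 0"
    "scal (bK \<alpha> * w1) q + scal (w1 * bK \<alpha>) (- inverse q) + scal (wm \<alpha>) (- KP * tq * V) + scal (wp \<alpha>) (KP * tq) = 0"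
    "scal (cK \<alpha> * w0) q + scal (w0 * cK \<alpha>) (- inverse q) + scal (wp \<alpha>) (- KM * tq * V) + scal (wm \<alpha>) (KM * tq) = 0"
    "scal (w1 * cK \<alpha>) q + scal (cK \<alpha> * w1) (- inverse q) + scal (wm \<alpha>) (- KM * tq * V) + scal (wp \<alpha>) (KM * tq) = 0"
proof -
  have cert: "X = 0" if "X - scal (Y - Z) c = 0" "Y = Z" for X Y Z :: "'a fls" and c
    using that by simp
  show "scal (w0 * wm \<alpha>) 1 + scal (wm \<alpha> * w0) (-1) + scal (cK \<alpha>) (- KP) + scal (bK \<alpha>) KM = 0"
    by (rule cert[OF _ single(3)[OF \<alpha>], of _ 1], simp only: bK_def cK_def scal_nf mult_1_left mult_1_right,
      (simp only: add.assoc)?, (rule collect)+,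
      (simp_all add: field_simps bb1_def cc1_def rho_def power2_eq_square coef(1-3,8))?)
  show "scal (w0 * bK \<alpha>) q + scal (bK \<alpha> * w0) (- inverse q) + scal (wp \<alpha>) (- KP * tq * V) + scal (wm \<alpha>) (KP * tq) = 0"
    by (rule cert[OF _ single(4)[OF \<alpha>], of _ bb1],
      simp only: bK_def cK_def scal_nf mult_1_left mult_1_right V_def[symmetric], (simp only: add.assoc)?, (rule collect)+,
      (simp_all add: field_simps bb1_def cc1_def rho_def power2_eq_square coef(1-3,8))?,
      (insert coef(4,5), simp_all add: algebra_simps divide_inverse)?)
  show "scal (bK \<alpha> * w1) q + scal (w1 * bK \<alpha>) (- inverse q) + scal (wm \<alpha>) (- KP * tq * V) + scal (wp \<alpha>) (KP * tq) = 0"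
    by (rule cert[OF _ single(6)[OF \<alpha>], of _ bb1],
      simp only: bK_def cK_def scal_nf mult_1_left mult_1_right V_def[symmetric], (simp only: add.assoc)?, (rule collect)+,
      (simp_all add: field_simps bb1_def cc1_def rho_def power2_eq_square coef(1-3,8))?,
      (insert coef(4,5), simp_all add: algebra_simps divide_inverse)?)
  show "scal (cK \<alpha> * w0) q + scal (w0 * cK \<alpha>) (- inverse q) + scal (wp \<alpha>) (- KM * tq * V) + scal (wm \<alpha>) (KM * tq) = 0"
    by (rule cert[OF _ single(5)[OF \<alpha>], of _ cc1],
      simp only: bK_def cK_def scal_nf mult_1_left mult_1_right V_def[symmetric], (simp only: add.assoc)?, (rule collect)+,
      (simp_all add: field_simps bb1_def cc1_def rho_def power2_eq_square coef(1-3,8))?,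
      (insert coef(4,5), simp_all add: algebra_simps divide_inverse)?)
  show "scal (w1 * cK \<alpha>) q + scal (cK \<alpha> * w1) (- inverse q) + scal (wm \<alpha>) (- KM * tq * V) + scal (wp \<alpha>) (KM * tq) = 0"
    by (rule cert[OF _ single(7)[OF \<alpha>], of _ cc1],
      simp only: bK_def cK_def scal_nf mult_1_left mult_1_right V_def[symmetric], (simp only: add.assoc)?, (rule collect)+,
      (simp_all add: field_simps bb1_def cc1_def rho_def power2_eq_square coef(1-3,8))?,
      (insert coef(4,5), simp_all add: algebra_simps divide_inverse)?)
qed

text \<open>The constants in \<open>bK\<close> and \<open>cK\<close> are central and drop out of
  every exchange relation, so those of the bare currents carry over after rescaling.\<close>

lemma currents_at:
  assumes \<alpha>: "\<alpha> \<noteq> 0" and \<beta>: "\<beta> \<noteq> 0"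
  shows "currents (wp \<alpha>) (wm \<alpha>) (bK \<alpha>) (cK \<alpha>) (wp \<beta>) (wm \<beta>) (bK \<beta>) (cK \<beta>) w0 w1 q tq
    (U_ser s (ux \<alpha>)) (U_ser s (ux \<beta>)) KP KM"
proof -
  have ex: "v = w" if "v - w - scal X c = 0" "X = 0" for X v w :: "'a fls" and c
    using that by simp
  have GG: "gp \<beta> * gp \<alpha> = gp \<alpha> * gp \<beta>" "gm \<beta> * gm \<alpha> = gm \<alpha> * gm \<beta>"
    "wp \<beta> * wp \<alpha> = wp \<alpha> * wp \<beta>" "wm \<beta> * wm \<alpha> = wm \<alpha> * wm \<beta>"
    unfolding gp_def gm_def wp_def wm_def using \<alpha> \<beta> rels(7-10) by (auto intro!: gen_comm)
  have E: "wp \<alpha> * wm \<beta> - wm \<beta> * wp \<alpha> + (wm \<alpha> * wp \<beta> - wp \<beta> * wm \<alpha>) = 0"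
    "wp \<alpha> * gp \<beta> - gp \<beta> * wp \<alpha> + (gp \<alpha> * wp \<beta> - wp \<beta> * gp \<alpha>) = 0"
    "wp \<alpha> * gm \<beta> - gm \<beta> * wp \<alpha> + (gm \<alpha> * wp \<beta> - wp \<beta> * gm \<alpha>) = 0"
    "wm \<alpha> * gp \<beta> - gp \<beta> * wm \<alpha> + (gp \<alpha> * wm \<beta> - wm \<beta> * gp \<alpha>) = 0"
    "wm \<alpha> * gm \<beta> - gm \<beta> * wm \<alpha> + (gm \<alpha> * wm \<beta> - wm \<beta> * gm \<alpha>) = 0"
    "gm \<alpha> * gp \<beta> - gp \<beta> * gm \<alpha> + (gp \<alpha> * gm \<beta> - gm \<beta> * gp \<alpha>) = 0"
    unfolding gp_def gm_def wp_def wm_def using \<alpha> \<beta> rels(11-16) by (auto intro!: gen_exchange)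
  have GG': "gp \<beta> * gp \<alpha> - gp \<alpha> * gp \<beta> = 0" "gm \<beta> * gm \<alpha> - gm \<alpha> * gm \<beta> = 0"
    using GG by simp_all
  show ?thesis
  proof
    show "bK \<beta> * bK \<alpha> = bK \<alpha> * bK \<beta>"
      by (rule ex[OF _ GG'(1), of _ _ "bb1 * bb1"], simp only: bK_def cK_def scal_nf mult_1_left mult_1_right,
        (simp only: add.assoc)?, (rule collect)+, simp_all add: algebra_simps)
    show "cK \<beta> * cK \<alpha> = cK \<alpha> * cK \<beta>"
      by (rule ex[OF _ GG'(2), of _ _ "cc1 * cc1"], simp only: bK_def cK_def scal_nf mult_1_left mult_1_right,
        (simp only: add.assoc)?, (rule collect)+, simp_all add: algebra_simps)
    show "wp \<beta> * wm \<alpha> = wp \<alpha> * wm \<beta> - wm \<beta> * wp \<alpha> + wm \<alpha> * wp \<beta>"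
      using E(1) by (simp add: algebra_simps)
    show "bK \<beta> * wp \<alpha> = wp \<alpha> * bK \<beta> + bK \<alpha> * wp \<beta> - wp \<beta> * bK \<alpha>"
      by (rule ex[OF _ E(2), of _ _ "- bb1"], simp only: bK_def cK_def scal_nf mult_1_left mult_1_right,
        (simp only: add.assoc)?, (rule collect)+, simp_all add: algebra_simps)
    show "cK \<beta> * wp \<alpha> = wp \<alpha> * cK \<beta> + cK \<alpha> * wp \<beta> - wp \<beta> * cK \<alpha>"
      by (rule ex[OF _ E(3), of _ _ "- cc1"], simp only: bK_def cK_def scal_nf mult_1_left mult_1_right,
        (simp only: add.assoc)?, (rule collect)+, simp_all add: algebra_simps)
    show "bK \<beta> * wm \<alpha> = wm \<alpha> * bK \<beta> + bK \<alpha> * wm \<beta> - wm \<beta> * bK \<alpha>"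
      by (rule ex[OF _ E(4), of _ _ "- bb1"], simp only: bK_def cK_def scal_nf mult_1_left mult_1_right,
        (simp only: add.assoc)?, (rule collect)+, simp_all add: algebra_simps)
    show "cK \<beta> * wm \<alpha> = wm \<alpha> * cK \<beta> + cK \<alpha> * wm \<beta> - wm \<beta> * cK \<alpha>"
      by (rule ex[OF _ E(5), of _ _ "- cc1"], simp only: bK_def cK_def scal_nf mult_1_left mult_1_right,
        (simp only: add.assoc)?, (rule collect)+, simp_all add: algebra_simps)
    show "cK \<beta> * bK \<alpha> = cK \<alpha> * bK \<beta> + bK \<alpha> * cK \<beta> - bK \<beta> * cK \<alpha>"
      by (rule ex[OF _ E(6), of _ _ "- (bb1 * cc1)"], simp only: bK_def cK_def scal_nf mult_1_left mult_1_right,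
        (simp only: add.assoc)?, (rule collect)+, simp_all add: algebra_simps)
  qed (rule q(2) coef tq_def GG single[OF \<alpha>] single[OF \<beta>] single'[OF \<alpha>] single'[OF \<beta>])+
qed

lemma refl_eq_K_op:
  assumes \<alpha>: "\<alpha> \<noteq> 0" and \<beta>: "\<beta> \<noteq> 0"
  shows "refl_eq q (ux \<alpha>) (ux \<beta>) (kop (K_op s kp km g (ux \<alpha>))) (kop (K_op s kp km g (ux \<beta>)))"
proof -
  interpret c: currents "wp \<alpha>" "wm \<alpha>" "bK \<alpha>" "cK \<alpha>" "wp \<beta>" "wm \<beta>" "bK \<beta>" "cK \<beta>" w0 w1 q tq
    "U_ser s (ux \<alpha>)" "U_ser s (ux \<beta>)" KP KM
    by (rule currents_at[OF \<alpha> \<beta>])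
  have K: "kop (K_op s kp km g (ux \<gamma>)) = Kmat q (ux \<gamma>) (wp \<gamma>) (wm \<gamma>) (bK \<gamma>) (cK \<gamma>)" for \<gamma>
  proof -
    have c1: "fls_const (inverse (km * (qc + inverse qc))) = bb1" "fls_const (inverse (kp * (qc + inverse qc))) = cc1"
      by (simp_all add: bb1_def cc1_def two_def[symmetric] const_eqs(1)[symmetric] KP_def KM_def fls_inverse_const)
    have c2: "fls_const (kp * (qc + inverse qc) / (qc - inverse qc)) = bb2" "fls_const (km * (qc + inverse qc) / (qc - inverse qc)) = cc2"
      by (simp_all only: bb2_def cc2_def KP_def KM_def const_eqs(1)[symmetric] q(1) fls_inverse_const
        fls_minus_const fls_const_mult_const fls_const_divide_const two_def)
    have c3: "inverse (ux \<gamma>) * inverse q = inverse (ux \<gamma> * q)"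
      by simp
    show ?thesis
      unfolding K_op_def Let_def kop_mat s qpw c1 c2 c3 wp_def[symmetric] wm_def[symmetric] gp_def[symmetric] gm_def[symmetric]
        Kmat_def bK_def cK_def lift_scal
      by (simp add: scal_diff scal_def[of 1])
  qed
  have nz: "ux \<alpha> \<noteq> 0" "ux \<beta> \<noteq> 0"
    using \<alpha> \<beta> by (simp_all add: ux_def fls_const_nonzero)
  have U: "U_ser s x = (q * x\<^sup>2 + inverse (q * x\<^sup>2)) / tq" for x
    by (simp add: U_ser_def qpw tq_def)
  show ?thesis
    unfolding K by (rule c.refl_eq[OF nz U U])
qed
end
end

section \<open>Recursion in an algebra satisfying the relations\<close>

lemma K_op_carrier: "K_op s kp km g x \<in> carrier_mat 2 2"
  by (intro carrier_matI) (simp_all add: K_op_def Let_def mat_of_rows_list_def)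

text \<open>A multiple of u^2 and its inverse have opposite nonzero orders. Hence the scalar factors
  depending on u never vanish.\<close>

lemma cc_monom:
  assumes "\<alpha> \<noteq> 0"
  shows "cc (fls_const \<alpha> * fls_X_inv ^ 2) \<noteq> 0"
proof
  let ?y = "fls_const \<alpha> * fls_X_inv ^ 2 :: complex fls"
  assume "cc ?y = 0"
  then have "?y = inverse ?y" by (simp add: cc_def)
  then have e: "fls_subdegree ?y = fls_subdegree (inverse ?y)" by simp
  have y: "fls_subdegree ?y = -2" "?y \<noteq> 0"
    using assms by (simp_all add: fls_subdegree_mult fls_const_nonzero)
  show False
    using e y(1) fls_inverse_subdegree[of ?y] by (simp del: inverse_mult_distrib)
qed

context qroot
begin

lemma qpw_mult: "qpw s a * qpw s b = qpw s (a + b)"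
  using s0 by (simp add: qpw_def power_int_add)

lemma ux_qpw: "ux \<alpha> * qpw s m = ux (\<alpha> * s powi m)"
  by (simp add: ux_def qpw_def mult.assoc mult.commute[of fls_X_inv] fls_const_mult_const[symmetric] del: fls_const_mult_const)

lemma ux_mult: "ux \<alpha> * ux \<beta> = fls_const (\<alpha> * \<beta>) * fls_X_inv ^ 2"
  by (simp add: ux_def fls_const_mult_const[symmetric] power2_eq_square mult.assoc mult.left_commute[of fls_X_inv] del: fls_const_mult_const)

lemma ux_nz: "\<alpha> \<noteq> 0 \<Longrightarrow> ux \<alpha> \<noteq> 0"
  by (simp add: ux_def fls_const_nonzero)

lemma cc_ux: "\<alpha> \<noteq> 0 \<Longrightarrow> \<beta> \<noteq> 0 \<Longrightarrow> cc (ux \<alpha> * ux \<beta>) \<noteq> 0"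
  unfolding ux_mult by (rule cc_monom) simp

lemma cc_ux_qpw: "\<alpha> \<noteq> 0 \<Longrightarrow> \<beta> \<noteq> 0 \<Longrightarrow> cc (ux \<alpha> * ux \<beta> * qpw s m) \<noteq> 0"
  using s0 by (simp only: mult.assoc ux_qpw) (rule cc_ux, simp_all)

text \<open>For the parameters of the recursion these are the two denominators of the theorem. The
  sign turns the subtracted antisymmetric term into an added one.\<close>

lemma cross_eq: "cross q w = - (cc (w * qpw s 4) * cc w)"
  using qpw_mult[of 2 2] by (simp add: cross_def cc_def qpw power2_eq_square algebra_simps)

lemma cross_ux: "\<alpha> \<noteq> 0 \<Longrightarrow> \<beta> \<noteq> 0 \<Longrightarrow> cross q (ux \<alpha> * ux \<beta>) \<noteq> 0"
  using cc_ux[of \<alpha> \<beta>] cc_ux_qpw[of \<alpha> \<beta> 4] by (simp add: cross_eq)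

lemma Gamma_qdet:
  fixes K :: "complex fls \<Rightarrow> 'a::complex_alg_1 fls mat"
  assumes K: "\<And>y. K y \<in> carrier_mat 2 2"
  shows "mtrace (lift_mat (const_mat P_minus) * (K x \<otimes>\<^sub>K 1\<^sub>m 2) * lift_mat (R_mat s 1 (qpw s 2 * x\<^sup>2))
     * (1\<^sub>m 2 \<otimes>\<^sub>K K (x * qpw s 2))) = qdet q (x * (x * q)) (kop (K x)) (kop (K (x * q)))"
proof -
  have c: "K x \<otimes>\<^sub>K 1\<^sub>m 2 \<in> carrier_mat 4 4" "1\<^sub>m 2 \<otimes>\<^sub>K K (x * q) \<in> carrier_mat 4 4"
    using kron_carrier[OF K one_carrier_mat, of x 2] kron_carrier[OF one_carrier_mat[of 2] K, of "x * q"]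
    by simp_all
  have c': "P_minus \<in> carrier_mat 4 4"
    by (intro carrier_matI) (simp_all add: P_minus_def P_flip_def)
  have "fls_const (1 / 2) + fls_const (1 / 2) = (1 :: complex fls)"
    by (simp add: fls_plus_const)
  then have half: "fls_const (1 / 2) = (1 / 2 :: complex fls)"
    by (simp add: field_simps)
  have P: "emb all_idx i2 all_idx i2 (lift_mat (const_mat P_minus)) = lop Pm"
    apply (rule op_eqI2)
    subgoal for a b c d
      by (cases a; cases b; cases c; cases d) (simp_all add: emb_def idx_defs P_minus_def P_flip_def Pm_def half)
    done
  have w: "q * x\<^sup>2 = x * (x * q)"
    by (simp add: power2_eq_square algebra_simps)
  have "mtrace (lift_mat (const_mat P_minus) * (K x \<otimes>\<^sub>K 1\<^sub>m 2) * lift_mat (R_mat s 1 (x * (x * q))) * (1\<^sub>m 2 \<otimes>\<^sub>K K (x * q)))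
    = tr (emb all_idx i2 all_idx i2 (lift_mat (const_mat P_minus) * (K x \<otimes>\<^sub>K 1\<^sub>m 2) * lift_mat (R_mat s 1 (x * (x * q))) * (1\<^sub>m 2 \<otimes>\<^sub>K K (x * q)) * 1\<^sub>m 4))"
    using c c' R_mat_carriers(1) by (subst mtrace_tr[OF _ bij_i2]) (auto intro!: mult_carrier_mat simp del: One_nat_def)
  also have "\<dots> = tr (lop Pm * leg1 (kop (K x)) * lop (Rm q (x * (x * q))) * leg2 (kop (K (x * q))) * emb all_idx i2 all_idx i2 (1\<^sub>m 4))"
    using c c' R_mat_carriers(1)
    by (subst emb5[where m = 4 and r = 4 and v = all_idx and d = i2]) (simp_all add: P bij_i2 idx_less emb_lift[where r = 4 and c = 4] R1[symmetric] R_mat_carriers emb_kron K del: One_nat_def)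
  also have "emb all_idx i2 all_idx i2 (1\<^sub>m 4) = (1 :: (bool \<times> bool, 'a fls) op)"
    apply (rule op_eqI2)
    subgoal for a b c d
      by (cases a; cases b; cases c; cases d) (simp_all add: emb_def idx_defs one_op_def)
    done
  finally show ?thesis
    by (simp only: qdet_def mult.assoc qpw(6) w mult_1_right)
qed

context
  fixes g :: "gen \<Rightarrow> 'a::complex_alg_1" and kp km ep em hp hm :: complex
  assumes kpm: "kp \<noteq> 0" "km \<noteq> 0" and rel: "oq_relators qc kp km g \<subseteq> {0}"
begin

abbreviation "KK \<equiv> K_op s kp km g"
abbreviation "kk \<equiv> K_scal s em ep (- hm) (- hp)"
abbreviation "TT \<equiv> T KK kk"
abbreviation "GG \<equiv> Gam KK"

lemma rks: "\<forall>x y. x \<noteq> 0 \<longrightarrow> y \<noteq> 0 \<longrightarrow> refl_eq q x y (kop (kk x)) (kop (kk y))"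
  "\<forall>x y. x \<noteq> 0 \<longrightarrow> y \<noteq> 0 \<longrightarrow> refl_eq q x y (tp (kop (kk x))) (tp (kop (kk y)))"
  by (simp_all add: tp_kop refl_eq_K_scal)

lemmas re = refl_eq_K_op[OF kpm rel]
lemmas TT0 = T0[of KK kk, OF K_op_carrier K_scal_carrier rks]
  and TT1 = T1[of KK kk, OF K_op_carrier K_scal_carrier rks]
  and TT2 = T2[of KK kk, OF K_op_carrier K_scal_carrier rks]
  and TT3 = T3[of KK kk, OF K_op_carrier K_scal_carrier rks]

lemmas defs = T_def[of KK kk, OF K_op_carrier K_scal_carrier rks]
  Gam_def[of KK kk, OF K_op_carrier K_scal_carrier rks]
  gam_def[of KK kk, OF K_op_carrier K_scal_carrier rks]
  kap_def[of KK kk, OF K_op_carrier K_scal_carrier rks]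

lemma T_op_TT: "T_op s kp km ep em hp hm g = TT"
  by (intro ext) (simp add: T_op_def K_dual_def defs)

lemma Gamma_op_GG: "Gamma_op s kp km g = GG"
  by (intro ext) (simp only: Gamma_op_def Gamma_qdet[of KK, OF K_op_carrier] defs)

lemma gam_Gamma_plus: "a \<noteq> 0 \<Longrightarrow> gam kk a = Gamma_plus s ep em hp hm a"
  using q(2) by (subst Gamma_plus_eq[symmetric]) (auto simp: defs tp_kop mult.assoc mult.left_commute)

lemma TT_GG_commute:
  assumes \<alpha>: "\<alpha> \<noteq> 0"
  shows "TT 1 (ux \<alpha> * qpw s (-2)) * GG (ux \<alpha>) = GG (ux \<alpha>) * TT 1 (ux \<alpha> * qpw s (-2))"
proof -
  define z where "z = ux \<alpha> * qpw s (-2)"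
  have z: "z \<noteq> 0" "z = ux (\<alpha> * s powi (-2))" "ux \<alpha> / z = q" and x: "ux \<alpha> \<noteq> 0" "ux \<alpha> * q = ux (\<alpha> * s powi 2)"
    using ux_nz[OF \<alpha>] q(2) using ux_qpw[of \<alpha> 2] by (simp_all add: z_def ux_qpw[symmetric] qpw divide_inverse)
  have nz: "\<alpha> * s powi (-2) \<noteq> 0" "\<alpha> * s powi 2 \<noteq> 0"
    using \<alpha> s0 by simp_all
  have c: "GG (ux \<alpha>) * ent (kop (KK z)) i j = ent (kop (KK z)) i j * GG (ux \<alpha>)" for i j
    unfolding defs(2)
  proof (rule qdet_central[OF q(2) q_facts(1) x(1) z(1)])
    show "refl_eq q (ux \<alpha>) (ux \<alpha> * q) (kop (KK (ux \<alpha>))) (kop (KK (ux \<alpha> * q)))"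
      unfolding x by (rule re) fact+
    show "refl_eq q (ux \<alpha>) z (kop (KK (ux \<alpha>))) (kop (KK z))"
      unfolding z by (rule re) fact+
    show "refl_eq q (ux \<alpha> * q) z (kop (KK (ux \<alpha> * q))) (kop (KK z))"
      unfolding z x by (rule re) fact+
    \<comment> \<open>The parameters have ratio q, so this is c(q) c(q^3), nonzero because q is not
      a root of unity. The other product depends on u and is nonzero by its order.\<close>
    show "cc (ux \<alpha> / z) * cc (ux \<alpha> / z * q\<^sup>2) \<noteq> 0"
      using q_facts(1,3) unfolding z(3) by (simp add: power3_eq_cube power2_eq_square mult.assoc)
    have "q\<^sup>2 = qpw s 4"
      using qpw_mult[of 2 2] by (simp add: power2_eq_square qpw)
    then show "cc (ux \<alpha> * z) * cc (ux \<alpha> * z * q\<^sup>2) \<noteq> 0"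
      using cc_ux[OF \<alpha> nz(1)] cc_ux_qpw[OF \<alpha> nz(1), of 4] by (simp add: z(2))
  qed
  have "ent (lop (kap kk z)) i k * ent (kop (KK z)) k' j * GG (ux \<alpha>) = GG (ux \<alpha>) * (ent (lop (kap kk z)) i k * ent (kop (KK z)) k' j)" for i j k k'
  proof -
    have "GG (ux \<alpha>) * (lift_fls y * ent (kop (KK z)) k' j) = lift_fls y * (GG (ux \<alpha>) * ent (kop (KK z)) k' j)" for y
      by (simp only: mult.assoc[symmetric] lift_commute[of y "GG (ux \<alpha>)", symmetric])
    then show ?thesis
      by (simp only: ent_lop c mult.assoc)
  qed
  then show ?thesis
    by (simp only: z_def[symmetric] TT1 tr_def ent_mult sum_bool distrib_left distrib_right)
qed

lemma TT_recursion_2: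
  "TT 2 (ux 1) = TT 1 (ux 1 * qpw s (-1)) * TT 1 (ux 1 * qpw s 1)
    + GG (ux 1 * qpw s (-1)) * lift_fls (Gamma_plus s ep em hp hm (ux 1 * qpw s (-1))
        / (cc ((ux 1)\<^sup>2 * qpw s 4) * cc ((ux 1)\<^sup>2)))"
proof -
  have nz: "ux 1 \<noteq> 0" "ux 1 * inverse S \<noteq> 0"
    unfolding qpw(3)[symmetric] ux_qpw using s0 by (auto intro!: ux_nz)
  have re1: "refl_eq q (ux 1 * inverse S) (ux 1 * S) (kop (KK (ux 1 * inverse S))) (kop (KK (ux 1 * S)))"
    unfolding qpw(3)[symmetric] unfolding qpw(2)[symmetric] ux_qpw using s0 by (intro re) simp_all
  have cr: "cross q ((ux 1)\<^sup>2) \<noteq> 0"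
    using cross_ux[of 1 1] by (simp add: power2_eq_square)
  have "TT 2 (ux 1) = TT 1 (ux 1 * inverse S) * TT 1 (ux 1 * S)
     - lift_fls (Gamma_plus s ep em hp hm (ux 1 * inverse S) / cross q ((ux 1)\<^sup>2)) * GG (ux 1 * inverse S)"
    using TT2[OF nz(1) re1 cr] by (simp only: gam_Gamma_plus[OF nz(2)])
  then show ?thesis
    unfolding cross_eq qpw(2,3)
    by (simp add: lift_minus lift_commute[of _ "GG (ux 1 * inverse S)"])
qed

lemma TT_recursion_3:
  "TT 3 (ux 1) = TT 2 (ux 1 * qpw s (-1)) * TT 1 (ux 1 * qpw s 2)
    + GG (ux 1) * lift_fls (Gamma_plus s ep em hp hm (ux 1)
        / (cc ((ux 1)\<^sup>2 * qpw s 6) * cc ((ux 1)\<^sup>2 * qpw s 2))) * TT 1 (ux 1 * qpw s (-2))"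
proof -
  define a b c where abc: "a = ux 1 * inverse q" "b = ux 1" "c = ux 1 * q"
  define x where "x = ux 1 * inverse S"
  have i: "inverse q = qpw s (-2)" "inverse S = qpw s (-1)" by (simp_all add: qpw)
  have x: "x * inverse S = a" "x * S = b" "x\<^sup>2 = a * b"
    using qpw_mult[of "-1" "-1"] qpw_mult[of "-1" 1]
    by (simp_all add: x_def abc power2_eq_square qpw mult.assoc mult.left_commute[of "inverse S"])
  have u: "a = ux (s powi (-2))" "b = ux 1" "c = ux (s powi 2)" "x = ux (s powi (-1))"
    unfolding abc x_def i by (simp_all only: qpw(6)[symmetric] ux_qpw mult_1_left)
  have nz: "a \<noteq> 0" "b \<noteq> 0" "c \<noteq> 0" "x \<noteq> 0"
    unfolding u using s0 by (auto intro!: ux_nz)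
  have re1: "refl_eq q a b (kop (KK a)) (kop (KK b))" "refl_eq q b c (kop (KK b)) (kop (KK c))"
    unfolding u using s0 by (intro re; simp)+
  have cr: "cross q (a * b) \<noteq> 0" "cross q (a * c) \<noteq> 0" "cross q (b * c) \<noteq> 0"
    unfolding u using s0 by (intro cross_ux; simp)+
  have T3: "TT 3 b = TT 1 a * (TT 1 b * TT 1 c) - lift_fls (gam kk a / cross q (a * b)) * (GG a * TT 1 c)
    - lift_fls (gam kk b / cross q (b * c)) * (TT 1 a * GG b)"
    using TT3[OF nz(2)] re1 cr unfolding abc by blast
  have T2: "TT 2 x = TT 1 a * TT 1 b - lift_fls (gam kk a / cross q (a * b)) * GG a"
    using TT2[OF nz(4)] re1(1) cr(1) unfolding x by blast
  have cm: "TT 1 a * GG b = GG b * TT 1 a"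
    using TT_GG_commute[of 1] by (simp only: abc i one_neq_zero simp_thms)
  have bc: "b * c = (ux 1)\<^sup>2 * qpw s 2" "(ux 1)\<^sup>2 * qpw s 2 * qpw s 4 = (ux 1)\<^sup>2 * qpw s 6"
    using qpw_mult[of 2 4] by (simp_all add: abc power2_eq_square qpw(6) mult.assoc)
  \<comment> \<open>The first two terms of the spin 3/2 formula are the spin 1 formula multiplied by
    the last trace; in the third the determinant is moved to the front.\<close>
  have "TT 3 b = TT 2 x * TT 1 c - lift_fls (gam kk b / cross q (b * c)) * (GG b * TT 1 a)"
    by (simp only: T3 T2 cm left_diff_distrib mult.assoc)
  also have "\<dots> = TT 2 x * TT 1 c + GG b * lift_fls (gam kk b / (cc ((ux 1)\<^sup>2 * qpw s 6) * cc ((ux 1)\<^sup>2 * qpw s 2))) * TT 1 a"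
    by (simp add: bc cross_eq lift_minus mult.assoc[symmetric] lift_commute[of _ "GG b"])
  finally show ?thesis
    by (simp only: gam_Gamma_plus[OF nz(2)[unfolded abc]] abc x_def i qpw(6))
qed

theorem TT_recursion:
  assumes u: "u = fls_X_inv" and n: "n = 2 \<or> n = 3"
  defines "T' \<equiv> T_op s kp km ep em hp hm g"
  shows "T' n u = T' (n - 1) (u * qpw s (-1)) * T' 1 (u * qpw s (int n - 1))
            + Gamma_op s kp km g (u * qpw s (int n - 3))
              * lift_fls (Gamma_plus s ep em hp hm (u * qpw s (int n - 3))
                          / (cc (u\<^sup>2 * qpw s (2 * int n)) * cc (u\<^sup>2 * qpw s (2 * int n - 4))))
              * T' (n - 2) (u * qpw s (-2))" "T' 0 u = 1"
proof -
  have u1: "u = ux 1" by (simp add: u ux_def)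
  show "T' 0 u = 1" by (simp only: T'_def T_op_TT TT0)
  show "T' n u = T' (n - 1) (u * qpw s (-1)) * T' 1 (u * qpw s (int n - 1))
            + Gamma_op s kp km g (u * qpw s (int n - 3))
              * lift_fls (Gamma_plus s ep em hp hm (u * qpw s (int n - 3))
                          / (cc (u\<^sup>2 * qpw s (2 * int n)) * cc (u\<^sup>2 * qpw s (2 * int n - 4))))
              * T' (n - 2) (u * qpw s (-2))"
    using n
  proof
    assume n: "n = 2"
    show ?thesis
      using TT_recursion_2 by (simp add: n T'_def T_op_TT Gamma_op_GG u1 TT0 qpw(1))
  next
    assume n: "n = 3"
    show ?thesis
      using TT_recursion_3 by (simp add: n T'_def T_op_TT Gamma_op_GG u1 qpw(1) numeral_2_eq_2)
  qed
qed
end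
end

subsection \<open>Passage to the quotient algebra\<close>

text \<open>Everything in the recursion is built from the generators by ring operations and scalars,
  so it can be transported along a homomorphism, here from the free algebra to a quotient.\<close>

locale alg_hom =
  fixes h :: "'a::complex_alg_1 \<Rightarrow> 'b::complex_alg_1"
  assumes add: "h (x + y) = h x + h y" and mult: "h (x * y) = h x * h y" and cplx: "h (of_cplx c) = of_cplx c"
begin

lemma zero: "h 0 = 0" and one: "h 1 = 1"
  using cplx[of 0] cplx[of 1] by (simp_all add: of_cplx_0 of_cplx_1)
lemma diff: "h (x - y) = h x - h y"
  using add[of "x - y" y] by simp
lemma sum: "h (sum f A) = (\<Sum>i\<in>A. h (f i))"
  by (induction A rule: infinite_finite_induct) (simp_all add: zero add)

definition H :: "'a fls \<Rightarrow> 'b fls" where "H f = Abs_fls (\<lambda>m. h (fls_nth f m))"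

lemma nth_H: "fls_nth (H f) m = h (fls_nth f m)"
  unfolding H_def by (rule nth_Abs_fls_lower_bound[of "fls_subdegree f"]) (simp add: zero)

lemma H_lift: "H (lift_fls c) = lift_fls c"
  and H_add: "H (x + y) = H x + H y" and H_diff: "H (x - y) = H x - H y" and H_0: "H 0 = 0" and H_1: "H 1 = 1"
  by (rule fls_eqI; simp add: nth_H cplx add diff zero one)+

text \<open>The homomorphism may kill leading coefficients, so the product formula is applied with
  lower bounds in place of the orders.\<close>

lemma H_mult: "H (x * y) = H x * H y"
proof (rule fls_eqI)
  fix n
  show "fls_nth (H (x * y)) n = fls_nth (H x * H y) n"
    by (simp add: nth_H fls_times_nth_bounds[of "fls_subdegree x" _ "fls_subdegree y"] zero sum mult)
qed

lemma H_sum: "H (sum f A) = (\<Sum>i\<in>A. H (f i))"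
  by (induction A rule: infinite_finite_induct) (simp_all add: H_0 H_add)

lemma H_gen_ser: "H (gen_ser s a x) = gen_ser s (\<lambda>k. h (a k)) x"
  by (rule fls_eqI) (simp add: nth_H gen_ser_def zero sum mult cplx)

abbreviation "HM \<equiv> map_mat H"

lemma HM_mult: "A \<in> carrier_mat k m \<Longrightarrow> B \<in> carrier_mat m r \<Longrightarrow> HM (A * B) = HM A * HM B"
  by (rule eq_matI) (simp_all add: scalar_prod_def H_sum H_mult)

lemma HM_lift: "HM (lift_mat A) = lift_mat A"
  by (rule eq_matI) (simp_all add: H_lift)

lemma HM_one: "HM (1\<^sub>m m) = 1\<^sub>m m"
  by (rule eq_matI) (simp_all add: H_0 H_1)

lemma HM_kron: "HM (A \<otimes>\<^sub>K B) = HM A \<otimes>\<^sub>K HM B"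
proof (rule eq_matI)
  fix i j assume ij: "i < dim_row (HM A \<otimes>\<^sub>K HM B)" "j < dim_col (HM A \<otimes>\<^sub>K HM B)"
  then have "0 < dim_row B" "0 < dim_col B"
    by (auto simp: kron_def intro: gr0I)
  with ij show "HM (A \<otimes>\<^sub>K B) $$ (i, j) = (HM A \<otimes>\<^sub>K HM B) $$ (i, j)"
    by (simp add: kron_def H_mult less_mult_imp_div_less)
qed (simp_all add: kron_def)

lemma H_mtrace: "A \<in> carrier_mat m m \<Longrightarrow> H (mtrace A) = mtrace (HM A)"
  by (simp add: mtrace_def H_sum)

lemma HM_K_op: "HM (K_op s kp km g x) = K_op s kp km (\<lambda>y. h (g y)) x"
proof (rule eq_matI)
  fix i j assume "i < dim_row (K_op s kp km (\<lambda>y. h (g y)) x)" "j < dim_col (K_op s kp km (\<lambda>y. h (g y)) x)"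
  then have "i = 0 \<or> i = 1" "j = 0 \<or> j = 1"
    using K_op_carrier[of s kp km "\<lambda>y. h (g y)" x] by auto
  then show "HM (K_op s kp km g x) $$ (i, j) = K_op s kp km (\<lambda>y. h (g y)) x $$ (i, j)"
    by (elim disjE) (simp_all add: K_op_def Let_def mat_of_rows_list_def H_add H_diff H_mult H_lift H_gen_ser)
qed (use K_op_carrier[of s kp km g x] K_op_carrier[of s kp km "\<lambda>y. h (g y)" x] in auto)

lemma HM_fused:
  assumes K: "\<And>y. K y \<in> carrier_mat 2 2"
  shows "HM (fused_K s K n x) = fused_K s (\<lambda>y. HM (K y)) n x"
proof (induction n arbitrary: x)
  case (Suc n)
  have c: "lift_mat (const_mat (F_mat (s\<^sup>2) (Suc n))) \<in> carrier_mat (Suc n + 1) (2 * Suc n)"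
    "K (x * qpw s (- int n)) \<otimes>\<^sub>K 1\<^sub>m (Suc n) \<in> carrier_mat (2 * Suc n) (2 * Suc n)"
    "lift_mat (R_mat s n (x\<^sup>2 * qpw s (1 - int n))) \<in> carrier_mat (2 * Suc n) (2 * Suc n)"
    "1\<^sub>m 2 \<otimes>\<^sub>K fused_K s K n (x * qpw s 1) \<in> carrier_mat (2 * Suc n) (2 * Suc n)"
    "lift_mat (const_mat (E_mat (s\<^sup>2) (Suc n))) \<in> carrier_mat (2 * Suc n) (Suc n + 1)"
    using kron_carrier[OF K one_carrier_mat, of _ "Suc n"] kron_carrier[OF one_carrier_mat[of 2] fused_carrier[of s K n]]
      R_mat_carrier[of s n]
    by (simp_all add: F_mat_def E_mat_def mat1_def)
  note m = mult_carrier_mat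
  show ?case
    unfolding fused_K.simps
      HM_mult[OF m[OF m[OF m[OF c(1,2)] c(3)] c(4)] c(5)] HM_mult[OF m[OF m[OF c(1,2)] c(3)] c(4)]
      HM_mult[OF m[OF c(1,2)] c(3)] HM_mult[OF c(1,2)] HM_lift HM_kron HM_one Suc.IH ..
qed (simp add: HM_one)

lemma H_T_op: "H (T_op s kp km ep em hp hm g n x) = T_op s kp km ep em hp hm (\<lambda>y. h (g y)) n x"
proof -
  have c: "lift_mat (K_dual s ep em hp hm n x) \<in> carrier_mat (Suc n) (Suc n)"
    using fused_carrier[of s "K_scal s em ep (- hm) (- hp)" n] by (simp add: K_dual_def)
  have f: "fused_K s (K_op s kp km g) n x \<in> carrier_mat (Suc n) (Suc n)"
    by (rule fused_carrier)
  show ?thesis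
    unfolding T_op_def H_mtrace[OF mult_carrier_mat[OF c f]] HM_mult[OF c f] HM_lift HM_fused[of "K_op s kp km g", OF K_op_carrier] HM_K_op ..
qed

lemma H_Gamma_op: "H (Gamma_op s kp km g x) = Gamma_op s kp km (\<lambda>y. h (g y)) x"
proof -
  have c: "lift_mat (const_mat P_minus) \<in> carrier_mat 4 4"
    "K_op s kp km g x \<otimes>\<^sub>K 1\<^sub>m 2 \<in> carrier_mat 4 4"
    "lift_mat (R_mat s 1 (qpw s 2 * x\<^sup>2)) \<in> carrier_mat 4 4"
    "1\<^sub>m 2 \<otimes>\<^sub>K K_op s kp km g (x * qpw s 2) \<in> carrier_mat 4 4"
    using kron_carrier[OF K_op_carrier one_carrier_mat, of s kp km g x 2]
      kron_carrier[OF one_carrier_mat[of 2] K_op_carrier, of s kp km g "x * qpw s 2"] R_mat_carriers(1)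
    by (simp_all add: P_minus_def P_flip_def minus_mat_def smult_mat_def del: One_nat_def)
  note m = mult_carrier_mat
  show ?thesis
    unfolding Gamma_op_def H_mtrace[OF m[OF m[OF m[OF c(1,2)] c(3)] c(4)]]
      HM_mult[OF m[OF m[OF c(1,2)] c(3)] c(4)] HM_mult[OF m[OF c(1,2)] c(3)] HM_mult[OF c(1,2)]
      HM_lift HM_kron HM_one HM_K_op ..
qed

lemma oq_relators_hom: "oq_relators q kp km (\<lambda>y. h (g y)) = h ` oq_relators q kp km g"
  by (simp add: oq_relators_def Let_def image_Un image_UN comm_def qcomm_def add diff mult cplx)

end

definition recursion_defect ::
  "complex \<Rightarrow> complex \<Rightarrow> complex \<Rightarrow> complex \<Rightarrow> complex \<Rightarrow> complex \<Rightarrow> complex \<Rightarrow> (gen \<Rightarrow> 'a::complex_alg_1) \<Rightarrow> nat \<Rightarrow> 'a fls" where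
  "recursion_defect s kp km ep em hp hm g n = (let T = T_op s kp km ep em hp hm g; u = fls_X_inv in
     T n u - (T (n - 1) (u * qpw s (-1)) * T 1 (u * qpw s (int n - 1))
            + Gamma_op s kp km g (u * qpw s (int n - 3))
              * lift_fls (Gamma_plus s ep em hp hm (u * qpw s (int n - 3))
                          / (cc (u\<^sup>2 * qpw s (2 * int n)) * cc (u\<^sup>2 * qpw s (2 * int n - 4))))
              * T (n - 2) (u * qpw s (-2))))"

lemma (in alg_hom) H_recursion_defect:
  "H (recursion_defect s kp km ep em hp hm g n) = recursion_defect s kp km ep em hp hm (\<lambda>y. h (g y)) n"
  by (simp add: recursion_defect_def Let_def H_add H_diff H_mult H_T_op H_Gamma_op H_lift)

section \<open>One quotient type for all parameters\<close>

definition alg_ideal :: "free_alg set \<Rightarrow> bool" where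
  "alg_ideal J \<longleftrightarrow> 0 \<in> J \<and> (\<forall>x\<in>J. \<forall>y\<in>J. x + y \<in> J) \<and> (\<forall>x\<in>J. \<forall>a. a * x \<in> J \<and> x * a \<in> J)"

text \<open>All parameters are quantified inside, so that a single ideal, and hence a type without
  parameters, can stand for every possible failure.\<close>

definition recursion_fails :: "free_alg set \<Rightarrow> bool" where
  "recursion_fails J \<longleftrightarrow> (\<exists>s kp km ep em hp hm n m. qroot s (s\<^sup>2) \<and> kp \<noteq> 0 \<and> km \<noteq> 0 \<and> (n = 2 \<or> n = 3) \<and>
     oq_relators (s\<^sup>2) kp km free_gen \<subseteq> J \<and> fls_nth (recursion_defect s kp km ep em hp hm free_gen n) m \<notin> J)"

text \<open>A quotient by an ideal that depends on the parameters is not a type. The type below is the quotient by a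
  single proper ideal, chosen to be a counterexample to the theorem if there is one.\<close>

definition bad_ideal :: "free_alg set" where
  "bad_ideal = (SOME J. alg_ideal J \<and> 1 \<notin> J \<and>
     ((\<exists>J'. alg_ideal J' \<and> 1 \<notin> J' \<and> recursion_fails J') \<longrightarrow> recursion_fails J))"

lemma bad_ideal: "alg_ideal bad_ideal" "1 \<notin> bad_ideal"
  "alg_ideal J \<Longrightarrow> 1 \<notin> J \<Longrightarrow> recursion_fails J \<Longrightarrow> recursion_fails bad_ideal"
proof -
  have "alg_ideal {0} \<and> (1 :: free_alg) \<notin> {0}"
    by (simp add: alg_ideal_def)
  then have "\<exists>J. alg_ideal J \<and> 1 \<notin> J \<and> ((\<exists>J'. alg_ideal J' \<and> 1 \<notin> J' \<and> recursion_fails J') \<longrightarrow> recursion_fails J)"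
    by blast
  note someI_ex[OF this, folded bad_ideal_def]
  then show "alg_ideal bad_ideal" "1 \<notin> bad_ideal"
    "alg_ideal J \<Longrightarrow> 1 \<notin> J \<Longrightarrow> recursion_fails J \<Longrightarrow> recursion_fails bad_ideal"
    by blast+
qed

lemma ideal_uminus: "alg_ideal J \<Longrightarrow> x \<in> J \<Longrightarrow> - x \<in> J"
  unfolding alg_ideal_def by (drule conjunct2, drule conjunct2, drule (1) bspec, drule spec[of _ "- 1"]) simp

lemma bad_zero: "0 \<in> bad_ideal"
  and bad_add: "x \<in> bad_ideal \<Longrightarrow> y \<in> bad_ideal \<Longrightarrow> x + y \<in> bad_ideal"
  and bad_times: "x \<in> bad_ideal \<Longrightarrow> a * x \<in> bad_ideal" "x \<in> bad_ideal \<Longrightarrow> x * a \<in> bad_ideal"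
  and bad_uminus: "x \<in> bad_ideal \<Longrightarrow> - x \<in> bad_ideal"
  using bad_ideal(1) ideal_uminus unfolding alg_ideal_def by blast+

quotient_type oq = free_alg / "\<lambda>x y. x - y \<in> bad_ideal"
proof (rule equivpI)
  show "reflp (\<lambda>x y. x - y \<in> bad_ideal)"
    by (rule reflpI) (simp add: bad_zero)
  show "symp (\<lambda>x y. x - y \<in> bad_ideal)"
    by (rule sympI) (metis bad_uminus minus_diff_eq)
  show "transp (\<lambda>x y. x - y \<in> bad_ideal)"
    by (rule transpI) (metis bad_add diff_add_cancel add_diff_eq)
qed

instantiation oq :: complex_alg_1
begin
lift_definition zero_oq :: oq is 0 .
lift_definition one_oq :: oq is 1 .
lift_definition plus_oq :: "oq \<Rightarrow> oq \<Rightarrow> oq" is "(+)"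
  using bad_add by (simp add: add_diff_add)
lift_definition uminus_oq :: "oq \<Rightarrow> oq" is uminus
  by (metis bad_uminus minus_diff_minus)
lift_definition minus_oq :: "oq \<Rightarrow> oq \<Rightarrow> oq" is "(-)"
proof -
  fix x y z w :: free_alg
  assume "x - y \<in> bad_ideal" "z - w \<in> bad_ideal"
  then have "(x - y) + - (z - w) \<in> bad_ideal" using bad_add bad_uminus by blast
  then show "x - z - (y - w) \<in> bad_ideal" by (simp add: algebra_simps)
qed
lift_definition times_oq :: "oq \<Rightarrow> oq \<Rightarrow> oq" is "(*)"
proof -
  fix x y z w :: free_alg
  assume "x - y \<in> bad_ideal" "z - w \<in> bad_ideal"
  then have "(x - y) * z + y * (z - w) \<in> bad_ideal" using bad_add bad_times by blast
  then show "x * z - y * w \<in> bad_ideal" by (simp add: algebra_simps)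
qed
lift_definition of_cplx_oq :: "complex \<Rightarrow> oq" is of_cplx .
instance
proof
  show "(0 :: oq) \<noteq> 1"
    by transfer (use bad_ideal(2) bad_uminus in fastforce)
  fix a :: complex and x :: oq
  show "of_cplx a * x = x * of_cplx a"
    by transfer (subst of_cplx_central, simp add: bad_zero)
qed (transfer, simp add: bad_zero algebra_simps of_cplx_0 of_cplx_1 of_cplx_add of_cplx_mult; fail)+
end

lemma alg_hom_oq: "alg_hom abs_oq"
  by standard (simp_all add: plus_oq.abs_eq times_oq.abs_eq of_cplx_oq.abs_eq)

lemma abs_oq_0: "abs_oq x = 0 \<longleftrightarrow> x \<in> bad_ideal"
  by (simp add: zero_oq_def oq.abs_eq_iff)

text \<open>In the quotient \<open>oq\<close> the generators satisfy the relations for the failing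
  parameters, so the recursion for algebra types applies there; its defect is then zero, against the
  choice of these parameters.\<close>

lemma not_recursion_fails: "\<not> recursion_fails bad_ideal"
proof
  assume "recursion_fails bad_ideal"
  then obtain s kp km ep em hp hm n m where a: "qroot s (s\<^sup>2)" "kp \<noteq> 0" "km \<noteq> 0" "n = 2 \<or> n = 3"
    and r: "oq_relators (s\<^sup>2) kp km free_gen \<subseteq> bad_ideal"
    and d: "fls_nth (recursion_defect s kp km ep em hp hm free_gen n) m \<notin> bad_ideal"
    unfolding recursion_fails_def by blast
  interpret alg_hom abs_oq by (rule alg_hom_oq)
  have "oq_relators (s\<^sup>2) kp km (\<lambda>y. abs_oq (free_gen y)) \<subseteq> {0}"
    unfolding oq_relators_hom using r by (auto simp: abs_oq_0)
  then have "recursion_defect s kp km ep em hp hm (\<lambda>y. abs_oq (free_gen y)) n = 0"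
    using qroot.TT_recursion(1)[OF a(1-3) _ refl a(4)] by (simp add: recursion_defect_def Let_def)
  then have "abs_oq (fls_nth (recursion_defect s kp km ep em hp hm free_gen n) m) = 0"
    by (simp add: H_recursion_defect[symmetric] nth_H[symmetric])
  with d show False by (simp add: abs_oq_0)
qed

lemma alg_ideal_oq: "alg_ideal (oq_ideal q kp km)" "oq_relators q kp km free_gen \<subseteq> oq_ideal q kp km"
proof -
  interpret ideal "oq_ideal q kp km" free_ring by (rule ideal_oq_ideal)
  show "alg_ideal (oq_ideal q kp km)"
    unfolding alg_ideal_def
    using additive_subgroup.zero_closed[OF is_additive_subgroup] additive_subgroup.a_closed[OF is_additive_subgroup] I_l_closed I_r_closed
    by (simp add: free_ring_def)
  show "oq_relators q kp km free_gen \<subseteq> oq_ideal q kp km"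
    unfolding oq_ideal_def by (rule ring.genideal_self[OF ring_free_ring]) (simp add: free_ring_def)
qed

lemma oq_class_eqI:
  assumes "x - y \<in> oq_ideal q kp km"
  shows "oq_class q kp km x = oq_class q kp km y"
proof -
  have sub: "oq_class q kp km x \<subseteq> oq_class q kp km y" if d: "x - y \<in> oq_ideal q kp km" for x y
  proof
    fix z assume "z \<in> oq_class q kp km x"
    then obtain w where w: "w \<in> oq_ideal q kp km" "z = w + x"
      by (auto simp: oq_class_def a_r_coset_def' free_ring_def)
    then have "w + (x - y) \<in> oq_ideal q kp km"
      using d alg_ideal_oq(1) unfolding alg_ideal_def by blast
    then show "z \<in> oq_class q kp km y"
      using w(2) by (auto simp: oq_class_def a_r_coset_def' free_ring_def intro!: bexI[of _ "w + (x - y)"])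
  qed
  show ?thesis
    using sub[OF assms] sub[of y x] ideal_uminus[OF alg_ideal_oq(1) assms] by auto
qed

theorem mainTheorem2:
  fixes q s kp km ep em hp hm :: complex
    and n :: nat
    and u :: "complex fls"
    and T :: "nat \<Rightarrow> complex fls \<Rightarrow> free_alg fls"
  assumes "q \<noteq> 0"
    and "\<And>m::nat. m > 0 \<Longrightarrow> q ^ m \<noteq> 1"
    and "s\<^sup>2 = q"
    and "kp \<noteq> 0" and "km \<noteq> 0"
    and u: "u = fls_X_inv"
    and T: "T = T_op s kp km ep em hp hm free_gen"
    and n: "n = 2 \<or> n = 3"
  shows "oq_laurent q kp km (T n u) =
         oq_laurent q kp km
           (T (n - 1) (u * qpw s (-1)) * T 1 (u * qpw s (int n - 1))
            + Gamma_op s kp km free_gen (u * qpw s (int n - 3))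
              * lift_fls (Gamma_plus s ep em hp hm (u * qpw s (int n - 3))
                          / (cc (u\<^sup>2 * qpw s (2 * int n)) * cc (u\<^sup>2 * qpw s (2 * int n - 4))))
              * T (n - 2) (u * qpw s (-2)))
         \<and> oq_laurent q kp km (T 0 u) = oq_laurent q kp km 1"
proof -
  let ?J = "oq_ideal q kp km"
  have "qroot s (s\<^sup>2)"
    using assms(1-3) by unfold_locales auto
  then have "fls_nth (recursion_defect s kp km ep em hp hm free_gen n) m \<in> ?J" for m
  \<comment> \<open>The quotient type must satisfy 0 \<noteq> 1, so only proper ideals are covered
    by it. If the ideal is everything, every coefficient lies in it.\<close>
  proof (cases "1 \<in> ?J")
    case True
    then have "x * 1 \<in> ?J" for x
      using alg_ideal_oq(1)[of q kp km] unfolding alg_ideal_def by blast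
    then show ?thesis by simp
  next
    case False
    then have "\<not> recursion_fails ?J"
      using bad_ideal(3) not_recursion_fails alg_ideal_oq(1) by blast
    then show ?thesis
      using \<open>qroot s (s\<^sup>2)\<close> assms(3-5) n alg_ideal_oq(2) unfolding recursion_fails_def by blast
  qed
  then have "oq_laurent q kp km (T n u) =
         oq_laurent q kp km
           (T (n - 1) (u * qpw s (-1)) * T 1 (u * qpw s (int n - 1))
            + Gamma_op s kp km free_gen (u * qpw s (int n - 3))
              * lift_fls (Gamma_plus s ep em hp hm (u * qpw s (int n - 3))
                          / (cc (u\<^sup>2 * qpw s (2 * int n)) * cc (u\<^sup>2 * qpw s (2 * int n - 4))))
              * T (n - 2) (u * qpw s (-2)))"
    unfolding oq_laurent_def T u
    by (intro ext oq_class_eqI) (simp only: recursion_defect_def Let_def fls_minus_nth[symmetric])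
  moreover have "T 0 u = 1"
    by (simp add: T T_op_def K_dual_def f_norm_def mtrace_def scalar_prod_def)
  ultimately show ?thesis by simp
qed

end
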